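(* There exists a constant $K>1$ such that for all block subspaces $Y\prec T$ and all $n\in\mathbb{N}$ there exist a block subspace $Z\prec Y$ and $d>0$ satisfying: for all integers $0\le j<n$ and all $z\in S_Z$, $$d\le |z|_j^n\le Kd .$$
   Context: For finite sets $E,F\subseteq\mathbb{N}$ write $E<F$ (resp. $E\le F$) if $\max E<\min F$ (resp. $\max E\le\min F$) or if either set is empty. The Schreier classes are $S_0=\{\{n\}:n\in\mathbb{N}\}\cup\{\emptyset\}$ and $S_{k+1}=\{\bigcup_{p=1}^{\ell}E_p:\{\ell\}\le E_1<\cdots<E_\ell,\ E_p\in S_k \text{ for } 1\le p\le\ell\}$. A family of finite nonempty sets $(E_i)_{i=1}^\ell$ is $k$-admissible if $E_1<\cdots<E_\ell$ and $\{\min E_i\}_{i=1}^\ell\in S_k$. $c_{00}$ is the space of finitely supported real sequences, with unit vector basis $(e_i)$; for $x=\sum_i x(i)e_i$ put $Ex=\sum_{i\in E}x(i)e_i$. Tsirelson's space $T=T(S_1,2^{-1})$ is the completion of $c_{00}$ under the norm given implicitly by $\|x\|=\|x\|_\infty\vee\sup\{\frac12\sum_{i=1}^\ell\|E_ix\|:(E_i)_1^\ell \text{ is 1-admissible}\}$. An admissible tree is a finite tree of finite subsets of $\mathbb{N}$ (ordered by reverse inclusion), with a single set of level $0$, such that the successors (which have level one greater) of any set in the tree, if there are any, form a 1-admissible partition of that set, and every set of level $m+1$ is a successor of some set of level $m$. A set of the tree is terminal if it has no successors. For integers $j\ge0$, $n\ge1$ and $x\in T$, $$|x|_j^n=\sup\Big\{\sum_{i\in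 A}2^{-(j+nk(i))}\|E_ix\|_\infty\Big\},$$ the supremum being over all admissible trees all of whose terminal sets have levels in $\{j,j+n,j+2n,\ldots\}$, where $(E_i)_{i\in A}$ are the terminal sets of the tree and $E_i$ has level $j+nk(i)$, $k(i)\ge0$. Each $|\cdot|_j^n$ is an equivalent norm on $T$; $|\cdot|_0^n$ is the norm of the Tsirelson space $T(S_n,2^{-n})$ (defined by the implicit equation $\|x\|_n=\|x\|_\infty\vee\sup\{2^{-n}\sum_i\|E_ix\|_n:(E_i)\ n\text{-admissible}\}$). $Y\prec T$ means that $Y$ is the closed linear span of an (infinite) block basis $(y_i)$ of $(e_i)$, and $Z\prec Y$ means that $Z$ is the closed linear span of an infinite block basis of $(y_i)$. $S_Z=\{z\in Z:\|z\|=1\}$ is the unit sphere of $Z$ with respect to the Tsirelson norm $\|\cdot\|$. *)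

theory Defs
  imports "HOL-Analysis.Analysis"
begin

section \<open>Schreier classes and admissible families\<close>

text \<open>The index set is \<open>{1, 2, \<dots>}\<close>, realised as the positive elements of \<^typ>\<open>nat\<close>.\<close>

definition set_less :: "nat set \<Rightarrow> nat set \<Rightarrow> bool" where
  "set_less E F \<longleftrightarrow> E = {} \<or> F = {} \<or> Max E < Min F"

definition set_le :: "nat set \<Rightarrow> nat set \<Rightarrow> bool" where
  "set_le E F \<longleftrightarrow> E = {} \<or> F = {} \<or> Max E \<le> Min F"

text \<open>The relations \<open>E < F\<close> and \<open>E \<le> F\<close> are not transitive through the empty set, so the chain
  \<open>{l} \<le> E\<^sub>1 < \<dots> < E\<^sub>l\<close> is understood between any two of its members. (Read only between neighbours,
  \<open>E\<^sub>1 = {}\<close> would make the bound by \<open>l\<close> void.)\<close>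

primrec schreier :: "nat \<Rightarrow> nat set set" where
  "schreier 0 = insert {} {{n} | n. n \<ge> 1}"
| "schreier (Suc k) =
     {\<Union> (set Es) | Es. Es \<noteq> [] \<and> (\<forall>E\<in>set Es. E \<in> schreier k \<and> set_le {length Es} E)
                       \<and> sorted_wrt set_less Es}"

definition admissible :: "nat \<Rightarrow> nat set list \<Rightarrow> bool" where
  "admissible k Es \<longleftrightarrow>
     Es \<noteq> [] \<and> (\<forall>E\<in>set Es. finite E \<and> E \<noteq> {}) \<and> sorted_wrt set_less Es \<and> Min ` set Es \<in> schreier k"


section \<open>The Tsirelson norm on finitely supported sequences\<close>

text \<open>Sequences indexed by the positive integers are functions on \<^typ>\<open>nat\<close> vanishing at \<open>0\<close>.\<close>

definition c00 :: "(nat \<Rightarrow> real) set" where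
  "c00 = {x. x 0 = 0 \<and> finite {i. x i \<noteq> 0}}"

definition restr :: "nat set \<Rightarrow> (nat \<Rightarrow> real) \<Rightarrow> nat \<Rightarrow> real" where
  "restr E x = (\<lambda>i. if i \<in> E then x i else 0)"

definition sup_norm :: "(nat \<Rightarrow> real) \<Rightarrow> real" where
  "sup_norm x = (SUP i. \<bar>x i\<bar>)"

definition norm_on_c00 :: "((nat \<Rightarrow> real) \<Rightarrow> real) \<Rightarrow> bool" where
  "norm_on_c00 N \<longleftrightarrow>
     (\<forall>x\<in>c00. 0 \<le> N x \<and> (N x = 0 \<longleftrightarrow> x = (\<lambda>_. 0))) \<and>
     (\<forall>x\<in>c00. \<forall>c. N (\<lambda>i. c * x i) = \<bar>c\<bar> * N x) \<and>
     (\<forall>x\<in>c00. \<forall>y\<in>c00. N (\<lambda>i. x i + y i) \<le> N x + N y)"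

definition tsirelson_equation :: "((nat \<Rightarrow> real) \<Rightarrow> real) \<Rightarrow> bool" where
  "tsirelson_equation N \<longleftrightarrow>
     (\<forall>x\<in>c00. N x = max (sup_norm x)
        (SUP Es\<in>{Es. admissible 1 Es}. 1/2 * (\<Sum>E\<leftarrow>Es. N (restr E x))))"

text \<open>The value \<open>0\<close> off \<^const>\<open>c00\<close> is a convention that makes the solution unique as a function on
  the whole type; see \<open>tsirelson_norm_ex1\<close> below.\<close>

definition tsirelson_norm :: "(nat \<Rightarrow> real) \<Rightarrow> real" where
  "tsirelson_norm = (THE N. norm_on_c00 N \<and> tsirelson_equation N \<and> (\<forall>x. x \<notin> c00 \<longrightarrow> N x = 0))"


subsection \<open>Existence and uniqueness\<close>

lemma set_less_disjoint: 
  assumes "set_less E F" "finite E" "finite F" 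
  shows "E \<inter> F = {}"
proof (rule ccontr)
  assume "E \<inter> F \<noteq> {}"
  then obtain a where a: "a \<in> E" "a \<in> F" by blast
  then have "a \<le> Max E" "Min F \<le> a" "Max E < Min F" 
    using assms by (auto simp: set_less_def)
  then show False by linarith
qed

lemma admissible_disjoint:
  assumes "admissible k Es"
  shows "sorted_wrt (\<lambda>E F. E \<inter> F = {}) Es"
  using assms unfolding admissible_def
  by (auto intro!: sorted_wrt_mono_rel[of Es set_less] dest: set_less_disjoint)

lemma admissible_single: "n \<ge> 1 \<Longrightarrow> admissible 1 [{n}]"
  by (auto simp: admissible_def set_le_def set_less_def intro!: exI[of _ "[{n}]"])

lemma admissible_ne: "{Es. admissible 1 Es} \<noteq> {}"
  using admissible_single[of 1] by auto

lemma c00_I: "x 0 = 0 \<Longrightarrow> finite S \<Longrightarrow> {i. x i \<noteq> 0} \<subseteq> S \<Longrightarrow> x \<in> c00"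
  by (simp add: c00_def finite_subset)

lemma c00_D: "x \<in> c00 \<Longrightarrow> x 0 = 0" "x \<in> c00 \<Longrightarrow> finite {i. x i \<noteq> 0}"
  by (simp_all add: c00_def)

lemma restr_c00 [intro]: "x \<in> c00 \<Longrightarrow> restr E x \<in> c00"
  by (rule c00_I[of _ "{i. x i \<noteq> 0}"]) (auto simp: c00_D restr_def)

lemma restr_finite_c00: "finite E \<Longrightarrow> x 0 = 0 \<Longrightarrow> restr E x \<in> c00"
  by (rule c00_I[of _ E]) (auto simp: restr_def)

lemma c00_zero [simp]: "(\<lambda>_. 0) \<in> c00"
  by (simp add: c00_def)

lemma c00_scale: "x \<in> c00 \<Longrightarrow> (\<lambda>i. c * x i) \<in> c00"
  by (rule c00_I[of _ "{i. x i \<noteq> 0}"]) (auto simp: c00_D)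

lemma c00_add: 
  assumes "x \<in> c00" "y \<in> c00" shows "(\<lambda>i. x i + y i) \<in> c00"
  by (rule c00_I[of _ "{i. x i \<noteq> 0} \<union> {i. y i \<noteq> 0}"]) (use assms in \<open>auto simp: c00_D\<close>)

lemma c00_diff: 
  assumes "x \<in> c00" "y \<in> c00" shows "(\<lambda>i. x i - y i) \<in> c00"
  using c00_add[OF assms(1) c00_scale[OF assms(2), of "-1"]] by simp

lemma restr_restr: "restr E (restr F x) = restr (E \<inter> F) x"
  by (auto simp: restr_def)

lemma restr_commute: "restr E (restr F x) = restr F (restr E x)"
  by (auto simp: restr_def)

lemma restr_zero [simp]: "restr E (\<lambda>_. 0) = (\<lambda>_. 0)"
  by (auto simp: restr_def)

lemma restr_scale: "restr E (\<lambda>i. c * x i) = (\<lambda>i. c * restr E x i)"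
  by (auto simp: restr_def)

lemma restr_add: "restr E (\<lambda>i. x i + y i) = (\<lambda>i. restr E x i + restr E y i)"
  by (auto simp: restr_def)

lemma restr_diff: "restr E (\<lambda>i. x i - y i) = (\<lambda>i. restr E x i - restr E y i)"
  by (auto simp: restr_def)

definition l1 :: "(nat \<Rightarrow> real) \<Rightarrow> real" where
  "l1 x = (\<Sum>i | x i \<noteq> 0. \<bar>x i\<bar>)"

lemma l1_eq: "finite S \<Longrightarrow> {i. x i \<noteq> 0} \<subseteq> S \<Longrightarrow> l1 x = (\<Sum>i\<in>S. \<bar>x i\<bar>)"
  unfolding l1_def by (rule sum.mono_neutral_left) auto

lemma l1_restr: 
  assumes "x \<in> c00" shows "l1 (restr E x) = (\<Sum>i\<in>{i. x i \<noteq> 0} \<inter> E. \<bar>x i\<bar>)"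
proof -
  have "l1 (restr E x) = (\<Sum>i\<in>{i. x i \<noteq> 0} \<inter> E. \<bar>restr E x i\<bar>)"
    using assms by (intro l1_eq) (auto simp: c00_def restr_def)
  then show ?thesis by (simp add: restr_def)
qed

lemma l1_sum_restr:
  assumes "x \<in> c00" "sorted_wrt (\<lambda>E F. E \<inter> F = {}) Es"
  shows "(\<Sum>E\<leftarrow>Es. l1 (restr E x)) \<le> l1 x"
proof -
  let ?S = "{i. x i \<noteq> 0}"
  have fin: "finite ?S" using assms by (simp add: c00_def)
  have "(\<Sum>E\<leftarrow>Es. l1 (restr E x)) = (\<Sum>i\<in>?S \<inter> \<Union>(set Es). \<bar>x i\<bar>)"
    using assms(2)
  proof (induction Es)
    case (Cons E Es)
    have "?S \<inter> \<Union>(set (E # Es)) = (?S \<inter> E) \<union> (?S \<inter> \<Union>(set Es))" by auto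
    moreover have "(?S \<inter> E) \<inter> (?S \<inter> \<Union>(set Es)) = {}" using Cons.prems by auto
    ultimately have "(\<Sum>i\<in>?S \<inter> \<Union>(set (E # Es)). \<bar>x i\<bar>) =
        (\<Sum>i\<in>?S \<inter> E. \<bar>x i\<bar>) + (\<Sum>i\<in>?S \<inter> \<Union>(set Es). \<bar>x i\<bar>)"
      using fin by (metis (no_types, lifting) finite_Int sum.union_disjoint)
    then show ?case using Cons by (simp add: l1_restr[OF assms(1)])
  qed simp
  also have "\<dots> \<le> l1 x" unfolding l1_def using fin by (intro sum_mono2) auto
  finally show ?thesis .
qed

lemma sup_norm_bdd: "x \<in> c00 \<Longrightarrow> bdd_above (range (\<lambda>i. \<bar>x i\<bar>))"
proof -
  assume x: "x \<in> c00"
  have "range (\<lambda>i. \<bar>x i\<bar>) \<subseteq> insert 0 ((\<lambda>i. \<bar>x i\<bar>) ` {i. x i \<noteq> 0})" by auto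
  then have "finite (range (\<lambda>i. \<bar>x i\<bar>))" using x
    by (metis (mono_tags, lifting) c00_def finite.insertI finite_imageI finite_subset mem_Collect_eq)
  then show ?thesis by simp
qed

lemma abs_le_sup_norm: "x \<in> c00 \<Longrightarrow> \<bar>x i\<bar> \<le> sup_norm x"
  unfolding sup_norm_def by (rule cSUP_upper[OF _ sup_norm_bdd]) auto

lemma sup_norm_le: "(\<And>i. \<bar>x i\<bar> \<le> B) \<Longrightarrow> sup_norm x \<le> B"
  unfolding sup_norm_def by (rule cSUP_least) auto

lemma sup_norm_nonneg: "x \<in> c00 \<Longrightarrow> 0 \<le> sup_norm x"
  using abs_le_sup_norm[of x 0] by simp

lemma sup_norm_le_l1: assumes "x \<in> c00" shows "sup_norm x \<le> l1 x"
proof (rule sup_norm_le)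
  fix i show "\<bar>x i\<bar> \<le> l1 x"
  proof (cases "x i = 0")
    case True then show ?thesis by (simp add: l1_def sum_nonneg)
  next
    case False then show ?thesis unfolding l1_def
      using assms by (intro member_le_sum) (auto simp: c00_def)
  qed
qed

lemma sup_norm_scale: assumes "x \<in> c00" shows "sup_norm (\<lambda>i. c * x i) \<le> \<bar>c\<bar> * sup_norm x"
  by (rule sup_norm_le) (auto simp: abs_mult intro!: mult_left_mono abs_le_sup_norm assms)

lemma sup_norm_add: assumes "x \<in> c00" "y \<in> c00" 
  shows "sup_norm (\<lambda>i. x i + y i) \<le> sup_norm x + sup_norm y"
proof (rule sup_norm_le)
  fix i show "\<bar>x i + y i\<bar> \<le> sup_norm x + sup_norm y"
    using abs_le_sup_norm[OF assms(1), of i] abs_le_sup_norm[OF assms(2), of i] by linarith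
qed

lemma sup_norm_restr: assumes "x \<in> c00" shows "sup_norm (restr F x) \<le> sup_norm x"
  by (rule sup_norm_le) (auto simp: restr_def sup_norm_nonneg abs_le_sup_norm assms)

primrec approx_norm :: "nat \<Rightarrow> (nat \<Rightarrow> real) \<Rightarrow> real" where
  "approx_norm 0 x = sup_norm x"
| "approx_norm (Suc m) x = max (sup_norm x)
     (SUP Es\<in>{Es. admissible 1 Es}. 1/2 * (\<Sum>E\<leftarrow>Es. approx_norm m (restr E x)))"

lemma half_sum_le:
  assumes "x \<in> c00" "admissible 1 Es" "\<And>z. z \<in> c00 \<Longrightarrow> N z \<le> l1 z"
  shows "1/2 * (\<Sum>E\<leftarrow>Es. N (restr E x)) \<le> l1 x"
proof -
  have "(\<Sum>E\<leftarrow>Es. N (restr E x)) \<le> (\<Sum>E\<leftarrow>Es. l1 (restr E x))"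
    by (rule sum_list_mono) (use assms in auto)
  also have "\<dots> \<le> l1 x" using l1_sum_restr[OF assms(1) admissible_disjoint[OF assms(2)]] .
  finally have "(\<Sum>E\<leftarrow>Es. N (restr E x)) \<le> l1 x" .
  moreover have "0 \<le> l1 x" by (simp add: l1_def sum_nonneg)
  ultimately show ?thesis by linarith
qed

lemma half_sum_bdd:
  assumes "x \<in> c00" "\<And>z. z \<in> c00 \<Longrightarrow> N z \<le> l1 z"
  shows "bdd_above ((\<lambda>Es. 1/2 * (\<Sum>E\<leftarrow>Es. N (restr E x))) ` {Es. admissible 1 Es})"
  by (rule bdd_aboveI[of _ "l1 x"]) (use half_sum_le[OF assms(1) _ assms(2)] in auto)

lemma approx_norm_le_l1: "x \<in> c00 \<Longrightarrow> approx_norm m x \<le> l1 x"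
proof (induction m arbitrary: x)
  case 0 then show ?case by (simp add: sup_norm_le_l1)
next
  case (Suc m)
  have "(SUP Es\<in>{Es. admissible 1 Es}. 1/2 * (\<Sum>E\<leftarrow>Es. approx_norm m (restr E x))) \<le> l1 x"
    using half_sum_le[OF Suc.prems _ Suc.IH] admissible_ne by (intro cSUP_least) auto
  then show ?case using Suc by (simp add: sup_norm_le_l1)
qed

lemma approx_norm_upper:
  assumes "x \<in> c00" "admissible 1 Es"
  shows "1/2 * (\<Sum>E\<leftarrow>Es. approx_norm m (restr E x)) \<le> approx_norm (Suc m) x"
proof -
  have "1/2 * (\<Sum>E\<leftarrow>Es. approx_norm m (restr E x)) \<le>
     (SUP Es\<in>{Es. admissible 1 Es}. 1/2 * (\<Sum>E\<leftarrow>Es. approx_norm m (restr E x)))"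
    using assms approx_norm_le_l1 by (intro cSUP_upper half_sum_bdd) auto
  then show ?thesis by simp
qed

lemma approx_norm_Suc_leI:
  assumes "sup_norm x \<le> B" 
    "\<And>Es. admissible 1 Es \<Longrightarrow> 1/2 * (\<Sum>E\<leftarrow>Es. approx_norm m (restr E x)) \<le> B"
  shows "approx_norm (Suc m) x \<le> B"
  using assms admissible_ne by (auto intro!: cSUP_least)

lemma approx_norm_ge_sup: "sup_norm x \<le> approx_norm m x"
  by (cases m) auto

lemma approx_norm_nonneg: "x \<in> c00 \<Longrightarrow> 0 \<le> approx_norm m x"
  using approx_norm_ge_sup[of x m] sup_norm_nonneg[of x] by linarith

lemma approx_norm_mono1: "x \<in> c00 \<Longrightarrow> approx_norm m x \<le> approx_norm (Suc m) x"
proof (induction m arbitrary: x)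
  case 0 show ?case using approx_norm_ge_sup[of x "Suc 0"] by simp
next
  case (Suc m)
  show ?case
  proof (rule approx_norm_Suc_leI)
    show "sup_norm x \<le> approx_norm (Suc (Suc m)) x" by (rule approx_norm_ge_sup)
    fix Es assume Es: "admissible 1 Es"
    have "(\<Sum>E\<leftarrow>Es. approx_norm m (restr E x)) \<le> (\<Sum>E\<leftarrow>Es. approx_norm (Suc m) (restr E x))"
      using Suc by (intro sum_list_mono) blast
    then show "1/2 * (\<Sum>E\<leftarrow>Es. approx_norm m (restr E x)) \<le> approx_norm (Suc (Suc m)) x"
      using approx_norm_upper[OF Suc.prems Es, of "Suc m"] by linarith
  qed
qed

lemma approx_norm_scale: "x \<in> c00 \<Longrightarrow> approx_norm m (\<lambda>i. c * x i) \<le> \<bar>c\<bar> * approx_norm m x"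
proof (induction m arbitrary: x)
  case 0 then show ?case by (simp add: sup_norm_scale)
next
  case (Suc m)
  show ?case
  proof (rule approx_norm_Suc_leI)
    show "sup_norm (\<lambda>i. c * x i) \<le> \<bar>c\<bar> * approx_norm (Suc m) x" 
      by (rule order_trans[OF sup_norm_scale[OF Suc.prems]]) 
         (simp add: mult_left_mono approx_norm_ge_sup del: approx_norm.simps)
    fix Es assume Es: "admissible 1 Es"
    have "(\<Sum>E\<leftarrow>Es. approx_norm m (restr E (\<lambda>i. c * x i))) \<le> 
          (\<Sum>E\<leftarrow>Es. \<bar>c\<bar> * approx_norm m (restr E x))"
      unfolding restr_scale using Suc by (intro sum_list_mono) blast
    also have "\<dots> = \<bar>c\<bar> * (\<Sum>E\<leftarrow>Es. approx_norm m (restr E x))" by (simp add: sum_list_const_mult)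
    finally have "1/2 * (\<Sum>E\<leftarrow>Es. approx_norm m (restr E (\<lambda>i. c * x i))) \<le>
      \<bar>c\<bar> * (1/2 * (\<Sum>E\<leftarrow>Es. approx_norm m (restr E x)))" by simp
    also have "\<dots> \<le> \<bar>c\<bar> * approx_norm (Suc m) x"
      using approx_norm_upper[OF Suc.prems Es] by (intro mult_left_mono) auto
    finally show "1/2 * (\<Sum>E\<leftarrow>Es. approx_norm m (restr E (\<lambda>i. c * x i))) \<le> \<bar>c\<bar> * approx_norm (Suc m) x" .
  qed
qed

lemma approx_norm_add: 
  "x \<in> c00 \<Longrightarrow> y \<in> c00 \<Longrightarrow> approx_norm m (\<lambda>i. x i + y i) \<le> approx_norm m x + approx_norm m y"
proof (induction m arbitrary: x y)
  case 0 then show ?case by (simp add: sup_norm_add)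
next
  case (Suc m)
  show ?case
  proof (rule approx_norm_Suc_leI)
    show "sup_norm (\<lambda>i. x i + y i) \<le> approx_norm (Suc m) x + approx_norm (Suc m) y" 
      using sup_norm_add[OF Suc.prems] approx_norm_ge_sup[of x "Suc m"] approx_norm_ge_sup[of y "Suc m"]
      by linarith
    fix Es assume Es: "admissible 1 Es"
    have "(\<Sum>E\<leftarrow>Es. approx_norm m (restr E (\<lambda>i. x i + y i))) \<le> 
          (\<Sum>E\<leftarrow>Es. approx_norm m (restr E x) + approx_norm m (restr E y))"
      unfolding restr_add using Suc by (intro sum_list_mono) blast
    also have "\<dots> = (\<Sum>E\<leftarrow>Es. approx_norm m (restr E x)) + (\<Sum>E\<leftarrow>Es. approx_norm m (restr E y))" 
      by (simp add: sum_list_addf)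
    finally show "1/2 * (\<Sum>E\<leftarrow>Es. approx_norm m (restr E (\<lambda>i. x i + y i))) \<le> 
        approx_norm (Suc m) x + approx_norm (Suc m) y" 
      using approx_norm_upper[OF Suc.prems(1) Es, of m] approx_norm_upper[OF Suc.prems(2) Es, of m]
      by linarith
  qed
qed

lemma approx_norm_restr: "x \<in> c00 \<Longrightarrow> approx_norm m (restr F x) \<le> approx_norm m x"
proof (induction m arbitrary: x)
  case 0 then show ?case by (simp add: sup_norm_restr)
next
  case (Suc m)
  show ?case
  proof (rule approx_norm_Suc_leI)
    show "sup_norm (restr F x) \<le> approx_norm (Suc m) x"
      using sup_norm_restr[OF Suc.prems, of F] approx_norm_ge_sup[of x "Suc m"] by linarith
    fix Es assume Es: "admissible 1 Es"
    have "(\<Sum>E\<leftarrow>Es. approx_norm m (restr E (restr F x))) \<le> (\<Sum>E\<leftarrow>Es. approx_norm m (restr E x))"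
      unfolding restr_commute[of _ F] using Suc by (intro sum_list_mono) blast
    then show "1/2 * (\<Sum>E\<leftarrow>Es. approx_norm m (restr E (restr F x))) \<le> approx_norm (Suc m) x"
      using approx_norm_upper[OF Suc.prems(1) Es, of m] by linarith
  qed
qed

definition limit_norm :: "(nat \<Rightarrow> real) \<Rightarrow> real" where
  "limit_norm x = (if x \<in> c00 then (SUP m. approx_norm m x) else 0)"

lemma approx_norm_bdd: "x \<in> c00 \<Longrightarrow> bdd_above (range (\<lambda>m. approx_norm m x))"
  by (rule bdd_aboveI[of _ "l1 x"]) (auto simp: approx_norm_le_l1)

lemma limit_norm_lim: "x \<in> c00 \<Longrightarrow> (\<lambda>m. approx_norm m x) \<longlonglongrightarrow> limit_norm x"
  unfolding limit_norm_def
  using LIMSEQ_incseq_SUP[of "\<lambda>m. approx_norm m x"] approx_norm_bdd[of x] approx_norm_mono1[of x]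
  by (simp add: incseq_Suc_iff del: approx_norm.simps)

lemma limit_norm_upper: "x \<in> c00 \<Longrightarrow> approx_norm m x \<le> limit_norm x"
  unfolding limit_norm_def by (auto intro!: cSUP_upper approx_norm_bdd)

lemma limit_norm_least: "x \<in> c00 \<Longrightarrow> (\<And>m. approx_norm m x \<le> B) \<Longrightarrow> limit_norm x \<le> B"
  unfolding limit_norm_def by (auto intro!: cSUP_least)

lemma limit_norm_le_l1: "x \<in> c00 \<Longrightarrow> limit_norm x \<le> l1 x"
  by (auto intro!: limit_norm_least approx_norm_le_l1)

lemma limit_norm_ge_sup: "x \<in> c00 \<Longrightarrow> sup_norm x \<le> limit_norm x"
  using limit_norm_upper[of x 0] by simp

lemma limit_norm_restr: "x \<in> c00 \<Longrightarrow> limit_norm (restr F x) \<le> limit_norm x"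
  by (rule limit_norm_least) 
     (auto intro: order_trans[OF approx_norm_restr] limit_norm_upper)

lemma norm_on_c00_limit_norm: "norm_on_c00 limit_norm"
proof -
  have nn: "0 \<le> limit_norm x" if "x \<in> c00" for x
    using limit_norm_upper[OF that, of 0] approx_norm_nonneg[OF that, of 0] by linarith
  have z: "x = (\<lambda>_. 0)" if "x \<in> c00" "limit_norm x = 0" for x
  proof
    fix i show "x i = 0"
      using abs_le_sup_norm[OF that(1), of i] limit_norm_ge_sup[OF that(1)] that(2) by simp
  qed
  have sc1: "limit_norm (\<lambda>i. c * x i) \<le> \<bar>c\<bar> * limit_norm x" if "x \<in> c00" for x c
    using that by (intro limit_norm_least c00_scale order_trans[OF approx_norm_scale]
       mult_left_mono limit_norm_upper) auto
  have "limit_norm (\<lambda>_. 0) \<le> l1 (\<lambda>_. 0)" by (rule limit_norm_le_l1) simp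
  then have z0: "limit_norm (\<lambda>_. 0) = 0" using nn[OF c00_zero] by (simp add: l1_def)
  have sc: "limit_norm (\<lambda>i. c * x i) = \<bar>c\<bar> * limit_norm x" if x: "x \<in> c00" for x c
  proof (cases "c = 0")
    case True then show ?thesis using z0 by simp
  next
    case False
    have "limit_norm (\<lambda>i. inverse c * (c * x i)) \<le> \<bar>inverse c\<bar> * limit_norm (\<lambda>i. c * x i)"
      by (rule sc1) (rule c00_scale[OF x])
    then have "limit_norm x \<le> \<bar>inverse c\<bar> * limit_norm (\<lambda>i. c * x i)"
      using False by (simp add: mult.assoc[symmetric])
    then have "\<bar>c\<bar> * limit_norm x \<le> limit_norm (\<lambda>i. c * x i)"
      using False by (simp add: abs_inverse field_simps)
    then show ?thesis using sc1[OF x, of c] by linarith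
  qed
  have tri: "limit_norm (\<lambda>i. x i + y i) \<le> limit_norm x + limit_norm y" if "x \<in> c00" "y \<in> c00" for x y
    using that by (intro limit_norm_least c00_add order_trans[OF approx_norm_add]
       add_mono limit_norm_upper) auto
  show ?thesis unfolding norm_on_c00_def using nn z z0 sc tri by blast
qed

lemma tsirelson_equation_limit_norm: "tsirelson_equation limit_norm"
  unfolding tsirelson_equation_def
proof (intro ballI antisym)
  fix x assume x: "x \<in> c00"
  let ?S = "SUP Es\<in>{Es. admissible 1 Es}. 1/2 * (\<Sum>E\<leftarrow>Es. limit_norm (restr E x))"
  have up: "1/2 * (\<Sum>E\<leftarrow>Es. limit_norm (restr E x)) \<le> ?S" if "admissible 1 Es" for Es
    using that x by (intro cSUP_upper half_sum_bdd limit_norm_le_l1) auto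
  show "limit_norm x \<le> max (sup_norm x) ?S"
  proof (rule limit_norm_least[OF x])
    fix m show "approx_norm m x \<le> max (sup_norm x) ?S"
    proof (cases m)
      case (Suc k)
      show ?thesis unfolding Suc
      proof (rule approx_norm_Suc_leI)
        fix Es assume Es: "admissible 1 Es"
        have "(\<Sum>E\<leftarrow>Es. approx_norm k (restr E x)) \<le> (\<Sum>E\<leftarrow>Es. limit_norm (restr E x))"
          using x by (intro sum_list_mono limit_norm_upper) auto
        then show "1/2 * (\<Sum>E\<leftarrow>Es. approx_norm k (restr E x)) \<le> max (sup_norm x) ?S"
          using up[OF Es] by linarith
      qed simp
    qed simp
  qed
  have "?S \<le> limit_norm x"
  proof (rule cSUP_least[OF admissible_ne])
    fix Es assume "Es \<in> {Es. admissible 1 Es}"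
    then have Es: "admissible 1 Es" by simp
    have "(\<lambda>m. \<Sum>E\<leftarrow>Fs. approx_norm m (restr E x)) \<longlonglongrightarrow> (\<Sum>E\<leftarrow>Fs. limit_norm (restr E x))" for Fs
      using x by (induction Fs) (auto intro!: tendsto_add limit_norm_lim)
    then have "(\<lambda>m. 1/2 * (\<Sum>E\<leftarrow>Es. approx_norm m (restr E x))) \<longlonglongrightarrow> 
       1/2 * (\<Sum>E\<leftarrow>Es. limit_norm (restr E x))" by (intro tendsto_mult_left)
    then show "1/2 * (\<Sum>E\<leftarrow>Es. limit_norm (restr E x)) \<le> limit_norm x"
      by (rule LIMSEQ_le_const2) 
         (use order_trans[OF approx_norm_upper[OF x Es] limit_norm_upper[OF x]] in auto)
  qed
  then show "max (sup_norm x) ?S \<le> limit_norm x" using limit_norm_ge_sup[OF x] by simp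
qed

lemma norm_on_c00_restr_le:
  assumes "norm_on_c00 N" "x \<in> c00" "finite S"
  shows "N (restr S x) \<le> (\<Sum>i\<in>S. N (restr {i} x))"
  using assms(3)
proof (induction S)
  case empty
  have "restr {} x = (\<lambda>_. 0)" by (simp add: restr_def)
  moreover have "N (\<lambda>_. 0) = 0" using assms(1) c00_zero unfolding norm_on_c00_def by blast
  ultimately show ?case by simp
next
  case (insert i S)
  have "restr (insert i S) x = (\<lambda>j. restr {i} x j + restr S x j)"
    using insert by (auto simp: restr_def)
  then have "N (restr (insert i S) x) \<le> N (restr {i} x) + N (restr S x)"
    using assms by (simp add: norm_on_c00_def restr_c00)
  then show ?case using insert by simp
qed

lemma norm_on_c00_half_sum_bdd:
  assumes N: "norm_on_c00 N" and x: "x \<in> c00"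
  shows "bdd_above ((\<lambda>Es. 1/2 * (\<Sum>E\<leftarrow>Es. N (restr E x))) ` {Es. admissible 1 Es})"
proof -
  define x' where "x' = (\<lambda>i. N (restr {i} x))"
  have N0: "N (\<lambda>_. 0) = 0" and nn: "\<And>z. z \<in> c00 \<Longrightarrow> 0 \<le> N z"
    using N by (auto simp: norm_on_c00_def)
  have supp: "x' i = 0" if "x i = 0" for i
  proof -
    have "restr {i} x = (\<lambda>_. 0)" using that by (auto simp: restr_def)
    then show ?thesis by (simp add: x'_def N0)
  qed
  have x': "x' \<in> c00" 
    by (rule c00_I[of _ "{i. x i \<noteq> 0}"]) (use x supp in \<open>auto simp: c00_D\<close>)
  have le: "N (restr E x) \<le> l1 (restr E x')" for E
  proof -
    let ?S = "E \<inter> {i. x i \<noteq> 0}"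
    have fin: "finite ?S" using x by (simp add: c00_def)
    have "restr E x = restr ?S x" by (auto simp: restr_def)
    then have "N (restr E x) \<le> (\<Sum>i\<in>?S. N (restr {i} x))"
      using norm_on_c00_restr_le[OF N x fin] by simp
    also have "\<dots> = (\<Sum>i\<in>?S. \<bar>restr E x' i\<bar>)"
      using nn x by (intro sum.cong) (auto simp: x'_def restr_def[of E] restr_c00)
    also have "\<dots> = l1 (restr E x')"
      using fin supp by (intro l1_eq[symmetric]) (auto simp: restr_def)
    finally show ?thesis .
  qed
  show ?thesis
  proof (rule bdd_aboveI2)
    fix Es assume "Es \<in> {Es. admissible 1 Es}"
    then have "(\<Sum>E\<leftarrow>Es. l1 (restr E x')) \<le> l1 x'"
      using l1_sum_restr[OF x' admissible_disjoint] by auto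
    moreover have "(\<Sum>E\<leftarrow>Es. N (restr E x)) \<le> (\<Sum>E\<leftarrow>Es. l1 (restr E x'))"
      by (intro sum_list_mono le)
    ultimately show "1/2 * (\<Sum>E\<leftarrow>Es. N (restr E x)) \<le> 1/2 * l1 x'" by linarith
  qed
qed

lemma tsirelson_equation_le:
  assumes N: "norm_on_c00 N" "tsirelson_equation N"
    and N': "norm_on_c00 N'" "tsirelson_equation N'"
    and x: "x \<in> c00"
    and IH: "\<And>z. z \<in> c00 \<Longrightarrow> card {i. z i \<noteq> 0} < card {i. x i \<noteq> 0} \<Longrightarrow> N z = N' z"
  shows "N x \<le> N' x"
proof -
  let ?S = "{i. x i \<noteq> 0}"
  have fin: "finite ?S" using x by (simp add: c00_def)
  have nn: "0 \<le> N x" "0 \<le> N' x" and N0: "N (\<lambda>_. 0) = 0"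
    using N(1) N'(1) x by (auto simp: norm_on_c00_def)
  have eq: "N x = max (sup_norm x) (SUP Es\<in>{Es. admissible 1 Es}. 1/2 * (\<Sum>E\<leftarrow>Es. N (restr E x)))"
    using N(2) x unfolding tsirelson_equation_def by blast
  have eq': "N' x = max (sup_norm x) (SUP Es\<in>{Es. admissible 1 Es}. 1/2 * (\<Sum>E\<leftarrow>Es. N' (restr E x)))"
    using N'(2) x unfolding tsirelson_equation_def by blast
  have up': "1/2 * (\<Sum>E\<leftarrow>Es. N' (restr E x)) \<le> N' x" if "admissible 1 Es" for Es
    unfolding eq' using that by (intro max.coboundedI2 cSUP_upper norm_on_c00_half_sum_bdd N'(1) x) auto
  have "(SUP Es\<in>{Es. admissible 1 Es}. 1/2 * (\<Sum>E\<leftarrow>Es. N (restr E x))) \<le> max (N' x) (1/2 * N x)"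
  proof (rule cSUP_least[OF admissible_ne])
    fix Es assume "Es \<in> {Es. admissible 1 Es}"
    then have Es: "admissible 1 Es" by simp
    show "1/2 * (\<Sum>E\<leftarrow>Es. N (restr E x)) \<le> max (N' x) (1/2 * N x)"
    proof (cases "\<exists>E\<in>set Es. ?S \<subseteq> E")
      case True
      then obtain E where E: "E \<in> set Es" "?S \<subseteq> E" by blast
      then obtain as bs where Es_eq: "Es = as @ E # bs" by (meson split_list)
      have "restr F x = (\<lambda>_. 0)" if "F \<in> set as \<union> set bs" for F
      proof -
        have "F \<inter> E = {}" using that admissible_disjoint[OF Es] unfolding Es_eq
          by (auto simp: sorted_wrt_append)
        then show ?thesis using E(2) by (intro ext) (auto simp: restr_def)
      qed
      then have "N (restr F x) = 0" if "F \<in> set as \<union> set bs" for F using that N0 by metis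
      then have "map (\<lambda>F. N (restr F x)) as = map (\<lambda>_. 0) as" 
        "map (\<lambda>F. N (restr F x)) bs = map (\<lambda>_. 0) bs" by auto
      then have "(\<Sum>F\<leftarrow>as. N (restr F x)) = 0" "(\<Sum>F\<leftarrow>bs. N (restr F x)) = 0"
        by (simp_all only: sum_list_0)
      moreover have "restr E x = x" using E(2) by (intro ext) (auto simp: restr_def)
      ultimately show ?thesis by (simp add: Es_eq)
    next
      case False
      have "N (restr E x) = N' (restr E x)" if "E \<in> set Es" for E
      proof (rule IH)
        have "{i. restr E x i \<noteq> 0} \<subset> ?S" using False that by (auto simp: restr_def)
        then show "card {i. restr E x i \<noteq> 0} < card ?S" by (rule psubset_card_mono[OF fin])
      qed (use x in auto)
      then have "(\<Sum>E\<leftarrow>Es. N (restr E x)) = (\<Sum>E\<leftarrow>Es. N' (restr E x))"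
        by (intro arg_cong[where f = sum_list] map_cong) auto
      then show ?thesis using up'[OF Es] by simp
    qed
  qed
  moreover have "sup_norm x \<le> N' x" using eq' by linarith
  ultimately have "N x \<le> max (N' x) (1/2 * N x)" using eq by linarith
  then show ?thesis using nn by linarith
qed

lemma tsirelson_equation_unique:
  assumes "norm_on_c00 N" "tsirelson_equation N" "norm_on_c00 N'" "tsirelson_equation N'"
  shows "x \<in> c00 \<Longrightarrow> N x = N' x"
proof (induction "card {i. x i \<noteq> 0}" arbitrary: x rule: less_induct)
  case less
  show ?case
    using tsirelson_equation_le[OF assms less.prems] tsirelson_equation_le[OF assms(3,4,1,2) less.prems]
      less.hyps by (metis (lifting) order_antisym)
qed

lemma tsirelson_norm_ex1:
  "\<exists>!N. norm_on_c00 N \<and> tsirelson_equation N \<and> (\<forall>x. x \<notin> c00 \<longrightarrow> N x = 0)"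
proof (rule ex1I[of _ limit_norm])
  show "norm_on_c00 limit_norm \<and> tsirelson_equation limit_norm \<and> (\<forall>x. x \<notin> c00 \<longrightarrow> limit_norm x = 0)"
    using norm_on_c00_limit_norm tsirelson_equation_limit_norm by (simp add: limit_norm_def)
next
  fix N assume N: "norm_on_c00 N \<and> tsirelson_equation N \<and> (\<forall>x. x \<notin> c00 \<longrightarrow> N x = 0)"
  show "N = limit_norm"
  proof
    fix x show "N x = limit_norm x"
      using N tsirelson_equation_unique[OF _ _ norm_on_c00_limit_norm tsirelson_equation_limit_norm, of N x]
      by (cases "x \<in> c00") (auto simp: limit_norm_def)
  qed
qed

lemma norm_on_c00_tsirelson_norm: "norm_on_c00 tsirelson_norm"
  and tsirelson_equation_tsirelson_norm: "tsirelson_equation tsirelson_norm"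
  using theI'[OF tsirelson_norm_ex1] unfolding tsirelson_norm_def by auto

lemma tsirelson_norm_eq_limit_norm: "tsirelson_norm = limit_norm"
  unfolding tsirelson_norm_def
  by (rule the1_equality[OF tsirelson_norm_ex1])
     (use norm_on_c00_limit_norm tsirelson_equation_limit_norm in \<open>simp add: limit_norm_def\<close>)

lemma tsirelson_norm_nonneg: "x \<in> c00 \<Longrightarrow> 0 \<le> tsirelson_norm x"
  and tsirelson_norm_scale: "x \<in> c00 \<Longrightarrow> tsirelson_norm (\<lambda>i. c * x i) = \<bar>c\<bar> * tsirelson_norm x"
  and tsirelson_norm_add: "x \<in> c00 \<Longrightarrow> y \<in> c00 \<Longrightarrow>
        tsirelson_norm (\<lambda>i. x i + y i) \<le> tsirelson_norm x + tsirelson_norm y"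
  and tsirelson_norm_zero [simp]: "tsirelson_norm (\<lambda>_. 0) = 0"
  using norm_on_c00_tsirelson_norm c00_zero by (auto simp: norm_on_c00_def)

lemma tsirelson_norm_diff: 
  assumes "x \<in> c00" "y \<in> c00" 
  shows "tsirelson_norm (\<lambda>i. x i - y i) \<le> tsirelson_norm x + tsirelson_norm y"
  using tsirelson_norm_add[OF assms(1) c00_scale[OF assms(2), of "-1"]] 
    tsirelson_norm_scale[OF assms(2), of "-1"] by simp

lemma tsirelson_norm_restr: "x \<in> c00 \<Longrightarrow> tsirelson_norm (restr E x) \<le> tsirelson_norm x"
  and tsirelson_norm_le_l1: "x \<in> c00 \<Longrightarrow> tsirelson_norm x \<le> l1 x"
  and sup_norm_le_tsirelson_norm: "x \<in> c00 \<Longrightarrow> sup_norm x \<le> tsirelson_norm x"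
  by (simp_all add: tsirelson_norm_eq_limit_norm limit_norm_restr limit_norm_le_l1 limit_norm_ge_sup)

lemma tsirelson_norm_half_sum:
  assumes "x \<in> c00" "admissible 1 Es"
  shows "1/2 * (\<Sum>E\<leftarrow>Es. tsirelson_norm (restr E x)) \<le> tsirelson_norm x"
proof -
  have "tsirelson_norm x = max (sup_norm x) 
      (SUP Es\<in>{Es. admissible 1 Es}. 1/2 * (\<Sum>E\<leftarrow>Es. tsirelson_norm (restr E x)))"
    using tsirelson_equation_tsirelson_norm assms(1) unfolding tsirelson_equation_def by blast
  moreover have "1/2 * (\<Sum>E\<leftarrow>Es. tsirelson_norm (restr E x)) \<le> 
     (SUP Es\<in>{Es. admissible 1 Es}. 1/2 * (\<Sum>E\<leftarrow>Es. tsirelson_norm (restr E x)))"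
    using assms by (intro cSUP_upper norm_on_c00_half_sum_bdd norm_on_c00_tsirelson_norm) auto
  ultimately show ?thesis by linarith
qed


section \<open>Tsirelson's space as a Banach space\<close>

text \<open>The completion of \<^const>\<open>c00\<close> is realised inside the space of all sequences: a coordinate
  sequence \<open>x\<close> represents a point of the completion iff the partial sums of \<open>\<Sum>i. x(i) e\<^sub>i\<close> are
  Cauchy, and the norm is the limit of the norms of the partial sums. The class instance \<open>banach\<close>
  and the lemmas \<open>norm_Abs_c00\<close> and \<open>closure_span_unit_vec\<close> below confirm that this is a completion:
  the space is complete, contains \<^const>\<open>c00\<close> isometrically, and the span of the unit vectors is dense.\<close>

definition tset :: "(nat \<Rightarrow> real) set" where
  "tset = {x. x 0 = 0 \<and>
    (\<forall>\<epsilon>>0. \<exists>M. \<forall>m\<ge>M. \<forall>n\<ge>M. tsirelson_norm (\<lambda>i. restr {..n} x i - restr {..m} x i) < \<epsilon>)}"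

lemma zero_tset: "(\<lambda>_. 0) \<in> tset"
  unfolding tset_def by (simp add: restr_def)

typedef tsirelson = tset
  morphisms coord Abs_tsirelson
  using zero_tset by blast

lemma tset_zero: "x \<in> tset \<Longrightarrow> x 0 = 0" by (simp add: tset_def)

lemma tset_fin: "x \<in> tset \<Longrightarrow> finite E \<Longrightarrow> restr E x \<in> c00"
  by (rule restr_finite_c00) (auto simp: tset_zero)

lemma tsetI:
  assumes x0: "x 0 = 0" 
    and *: "\<And>\<epsilon>. \<epsilon> > 0 \<Longrightarrow> \<exists>M. \<forall>n\<ge>M. tsirelson_norm (restr {M<..n} x) < \<epsilon>"
  shows "x \<in> tset"
proof -
  have "\<exists>M. \<forall>m\<ge>M. \<forall>n\<ge>M. tsirelson_norm (\<lambda>i. restr {..n} x i - restr {..m} x i) < \<epsilon>" if eps: "\<epsilon> > 0" for \<epsilon>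
  proof -
  obtain M where M: "\<forall>n\<ge>M. tsirelson_norm (restr {M<..n} x) < \<epsilon>/2"
    using *[of "\<epsilon>/2"] eps by auto
  have "tsirelson_norm (\<lambda>i. restr {..n} x i - restr {..m} x i) < \<epsilon>" if "m \<ge> M" "n \<ge> M" for m n
  proof -
    have "(\<lambda>i. restr {..n} x i - restr {..m} x i) = (\<lambda>i. restr {M<..n} x i - restr {M<..m} x i)"
      using that by (auto simp: restr_def)
    then have "tsirelson_norm (\<lambda>i. restr {..n} x i - restr {..m} x i) \<le> 
        tsirelson_norm (restr {M<..n} x) + tsirelson_norm (restr {M<..m} x)"
      using tsirelson_norm_diff[of "restr {M<..n} x" "restr {M<..m} x"] x0 
      by (simp add: restr_finite_c00)
    moreover have "tsirelson_norm (restr {M<..n} x) < \<epsilon>/2" "tsirelson_norm (restr {M<..m} x) < \<epsilon>/2"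
      using M that by auto
    ultimately show ?thesis by linarith
  qed
  then show ?thesis by blast
  qed
  then show ?thesis using x0 unfolding tset_def by blast
qed

lemma tsetD:
  assumes "x \<in> tset" "\<epsilon> > 0"
  shows "\<exists>M. \<forall>n\<ge>M. tsirelson_norm (restr {M<..n} x) < \<epsilon>"
proof -
  obtain M where M: "\<forall>m\<ge>M. \<forall>n\<ge>M. tsirelson_norm (\<lambda>i. restr {..n} x i - restr {..m} x i) < \<epsilon>"
    using assms unfolding tset_def by auto
  have "restr {M<..n} x = (\<lambda>i. restr {..n} x i - restr {..M} x i)" if "n \<ge> M" for n
    using that by (auto simp: restr_def)
  then show ?thesis using M by (intro exI[of _ M]) auto
qed

lemma c00_subset_tset: "x \<in> c00 \<Longrightarrow> x \<in> tset"
proof (rule tsetI)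
  assume x: "x \<in> c00"
  then show "x 0 = 0" by (simp add: c00_def)
  fix \<epsilon> :: real assume "\<epsilon> > 0"
  obtain M where M: "\<forall>i\<in>{i. x i \<noteq> 0}. i \<le> M"
    using x finite_nat_set_iff_bounded_le[of "{i. x i \<noteq> 0}"] by (auto simp: c00_def)
  have z: "restr {M<..n} x = (\<lambda>_. 0)" for n using M by (intro ext) (fastforce simp: restr_def)
  have "\<forall>n\<ge>M. tsirelson_norm (restr {M<..n} x) < \<epsilon>" unfolding z using \<open>\<epsilon> > 0\<close> by simp
  then show "\<exists>M. \<forall>n\<ge>M. tsirelson_norm (restr {M<..n} x) < \<epsilon>" by blast
qed

lemma tset_add: 
  assumes x: "x \<in> tset" and y: "y \<in> tset" shows "(\<lambda>i. x i + y i) \<in> tset"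
proof (rule tsetI)
  show "x 0 + y 0 = 0" using assms by (simp add: tset_zero)
  fix \<epsilon> :: real assume "\<epsilon> > 0"
  then obtain M1 M2 where M: "\<forall>n\<ge>M1. tsirelson_norm (restr {M1<..n} x) < \<epsilon>/2"
    "\<forall>n\<ge>M2. tsirelson_norm (restr {M2<..n} y) < \<epsilon>/2"
    using tsetD[OF x, of "\<epsilon>/2"] tsetD[OF y, of "\<epsilon>/2"] by auto
  define M where "M = max M1 M2"
  have "tsirelson_norm (restr {M<..n} (\<lambda>i. x i + y i)) < \<epsilon>" if n: "n \<ge> M" for n
  proof -
    have 1: "restr {M<..n} x = restr {M<..n} (restr {M1<..n} x)"
      "restr {M<..n} y = restr {M<..n} (restr {M2<..n} y)" by (auto simp: restr_def M_def)
    have "tsirelson_norm (restr {M<..n} x) \<le> tsirelson_norm (restr {M1<..n} x)"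
      "tsirelson_norm (restr {M<..n} y) \<le> tsirelson_norm (restr {M2<..n} y)"
      unfolding 1 by (intro tsirelson_norm_restr tset_fin x y; simp)+
    moreover have "tsirelson_norm (restr {M<..n} (\<lambda>i. x i + y i)) \<le> 
      tsirelson_norm (restr {M<..n} x) + tsirelson_norm (restr {M<..n} y)"
      unfolding restr_add by (intro tsirelson_norm_add tset_fin x y; simp)
    moreover have "tsirelson_norm (restr {M1<..n} x) < \<epsilon>/2" "tsirelson_norm (restr {M2<..n} y) < \<epsilon>/2"
      using M n by (auto simp: M_def)
    ultimately show ?thesis by linarith
  qed
  then show "\<exists>M. \<forall>n\<ge>M. tsirelson_norm (restr {M<..n} (\<lambda>i. x i + y i)) < \<epsilon>" by blast
qed

lemma tset_scale: 
  assumes x: "x \<in> tset" shows "(\<lambda>i. c * x i) \<in> tset"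
proof (rule tsetI)
  show "c * x 0 = 0" using assms by (simp add: tset_zero)
  fix \<epsilon> :: real assume "\<epsilon> > 0"
  then have "\<epsilon> / (\<bar>c\<bar> + 1) > 0" by simp
  then obtain M where M: "\<forall>n\<ge>M. tsirelson_norm (restr {M<..n} x) < \<epsilon> / (\<bar>c\<bar> + 1)"
    using tsetD[OF x] by blast
  have "tsirelson_norm (restr {M<..n} (\<lambda>i. c * x i)) < \<epsilon>" if n: "n \<ge> M" for n
  proof -
    have t: "restr {M<..n} x \<in> c00" by (intro tset_fin x) simp
    have "tsirelson_norm (restr {M<..n} x) * (\<bar>c\<bar> + 1) < \<epsilon>"
      using M n by (simp add: pos_less_divide_eq)
    moreover have "0 \<le> tsirelson_norm (restr {M<..n} x)" by (rule tsirelson_norm_nonneg[OF t])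
    ultimately show ?thesis unfolding restr_scale tsirelson_norm_scale[OF t] 
      by (simp add: algebra_simps)
  qed
  then show "\<exists>M. \<forall>n\<ge>M. tsirelson_norm (restr {M<..n} (\<lambda>i. c * x i)) < \<epsilon>" by blast
qed

lemma tset_diff: 
  assumes x: "x \<in> tset" and y: "y \<in> tset" shows "(\<lambda>i. x i - y i) \<in> tset"
  using tset_add[OF x tset_scale[OF y, of "-1"]] by simp

lemma coord_tset: "coord x \<in> tset" by (rule coord)

lemma coord_fin: "finite E \<Longrightarrow> restr E (coord x) \<in> c00"
  by (rule tset_fin[OF coord_tset])

lemma partial_norm_mono:
  assumes "m \<le> n"
  shows "tsirelson_norm (restr {..m} (coord x)) \<le> tsirelson_norm (restr {..n} (coord x))"
proof -
  have 1: "restr {..m} (coord x) = restr {..m} (restr {..n} (coord x))"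
    using assms by (auto simp: restr_def)
  show ?thesis by (subst 1, rule tsirelson_norm_restr, rule coord_fin) simp
qed

lemma partial_norm_convergent: "convergent (\<lambda>n. tsirelson_norm (restr {..n} (coord x)))"
proof -
  obtain M where M: "\<forall>n\<ge>M. tsirelson_norm (restr {M<..n} (coord x)) < 1"
    using tsetD[OF coord_tset, of 1 x] by auto
  have "tsirelson_norm (restr {..n} (coord x)) \<le> tsirelson_norm (restr {..M} (coord x)) + 1" for n
  proof (cases "n \<le> M")
    case True then show ?thesis using partial_norm_mono[OF True, of x] by linarith
  next
    case False
    then have "restr {..n} (coord x) = (\<lambda>i. restr {..M} (coord x) i + restr {M<..n} (coord x) i)"
      by (auto simp: restr_def)
    then have "tsirelson_norm (restr {..n} (coord x)) \<le> 
        tsirelson_norm (restr {..M} (coord x)) + tsirelson_norm (restr {M<..n} (coord x))"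
      by (simp add: tsirelson_norm_add coord_fin)
    moreover have "tsirelson_norm (restr {M<..n} (coord x)) < 1" using M False by simp
    ultimately show ?thesis by linarith
  qed
  then have "bdd_above (range (\<lambda>n. tsirelson_norm (restr {..n} (coord x))))"
    by (intro bdd_aboveI2) 
  then have "(\<lambda>n. tsirelson_norm (restr {..n} (coord x))) \<longlonglongrightarrow> (SUP n. tsirelson_norm (restr {..n} (coord x)))"
    by (rule LIMSEQ_incseq_SUP) (auto simp: incseq_def partial_norm_mono)
  then show ?thesis by (rule convergentI)
qed

instantiation tsirelson :: real_normed_vector
begin

definition zero_tsirelson :: tsirelson where "0 = Abs_tsirelson (\<lambda>_. 0)"

definition plus_tsirelson :: "tsirelson \<Rightarrow> tsirelson \<Rightarrow> tsirelson" where
  "x + y = Abs_tsirelson (\<lambda>i. coord x i + coord y i)"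

definition minus_tsirelson :: "tsirelson \<Rightarrow> tsirelson \<Rightarrow> tsirelson" where
  "x - y = Abs_tsirelson (\<lambda>i. coord x i - coord y i)"

definition uminus_tsirelson :: "tsirelson \<Rightarrow> tsirelson" where
  "- x = Abs_tsirelson (\<lambda>i. - coord x i)"

definition scaleR_tsirelson :: "real \<Rightarrow> tsirelson \<Rightarrow> tsirelson" where
  "c *\<^sub>R x = Abs_tsirelson (\<lambda>i. c * coord x i)"

definition norm_tsirelson :: "tsirelson \<Rightarrow> real" where
  "norm_tsirelson x = lim (\<lambda>n. tsirelson_norm (restr {..n} (coord x)))"

definition dist_tsirelson :: "tsirelson \<Rightarrow> tsirelson \<Rightarrow> real" where
  "dist_tsirelson x y = norm (x - y)"

definition sgn_tsirelson :: "tsirelson \<Rightarrow> tsirelson" where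
  "sgn_tsirelson x = inverse (norm x) *\<^sub>R x"

definition uniformity_tsirelson :: "(tsirelson \<times> tsirelson) filter" where
  "uniformity_tsirelson = (INF e\<in>{0<..}. principal {(x, y). dist x y < e})"

definition open_tsirelson :: "tsirelson set \<Rightarrow> bool" where
  "open_tsirelson U \<longleftrightarrow> (\<forall>x\<in>U. eventually (\<lambda>(x', y). x' = x \<longrightarrow> y \<in> U) uniformity)"

lemma coord_zero: "coord 0 = (\<lambda>_. 0)"
  unfolding zero_tsirelson_def by (rule Abs_tsirelson_inverse, rule c00_subset_tset) simp

lemma coord_add: "coord (x + y) = (\<lambda>i. coord x i + coord y i)"
  unfolding plus_tsirelson_def by (rule Abs_tsirelson_inverse, intro tset_add coord_tset)

lemma coord_diff: "coord (x - y) = (\<lambda>i. coord x i - coord y i)"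
  unfolding minus_tsirelson_def by (rule Abs_tsirelson_inverse, intro tset_diff coord_tset)

lemma coord_uminus: "coord (- x) = (\<lambda>i. - coord x i)"
  unfolding uminus_tsirelson_def 
  by (rule Abs_tsirelson_inverse) (use tset_scale[OF coord_tset, of "-1" x] in simp)

lemma coord_scaleR: "coord (c *\<^sub>R x) = (\<lambda>i. c * coord x i)"
  unfolding scaleR_tsirelson_def by (rule Abs_tsirelson_inverse, intro tset_scale coord_tset)

lemma norm_tsirelson_lim: "(\<lambda>n. tsirelson_norm (restr {..n} (coord x))) \<longlonglongrightarrow> norm x"
  unfolding norm_tsirelson_def using partial_norm_convergent convergent_LIMSEQ_iff by blast

lemma tsirelson_norm_restr_le_norm:
  assumes "finite E" shows "tsirelson_norm (restr E (coord x)) \<le> norm x"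
proof -
  obtain n where n: "E \<subseteq> {..n}" using assms finite_nat_iff_bounded_le by auto
  have 1: "restr E (coord x) = restr E (restr {..n} (coord x))"
    using n by (intro ext) (auto simp: restr_def)
  have "tsirelson_norm (restr E (coord x)) \<le> tsirelson_norm (restr {..n} (coord x))"
    by (subst 1, rule tsirelson_norm_restr, rule coord_fin) simp
  also have "\<dots> \<le> norm x" 
    using incseq_le[OF _ norm_tsirelson_lim] by (auto simp: incseq_def partial_norm_mono)
  finally show ?thesis .
qed

lemma norm_tsirelson_least: 
  "(\<And>n. tsirelson_norm (restr {..n} (coord x)) \<le> B) \<Longrightarrow> norm x \<le> B"
  by (rule LIMSEQ_le_const2[OF norm_tsirelson_lim]) auto

lemma abs_coord_le_norm: "\<bar>coord x i\<bar> \<le> norm x"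
proof -
  have "\<bar>coord x i\<bar> \<le> sup_norm (restr {i} (coord x))"
    using abs_le_sup_norm[OF coord_fin, of "{i}" x i] by (simp add: restr_def)
  also have "\<dots> \<le> tsirelson_norm (restr {i} (coord x))"
    by (rule sup_norm_le_tsirelson_norm[OF coord_fin]) simp
  also have "\<dots> \<le> norm x" by (rule tsirelson_norm_restr_le_norm) simp
  finally show ?thesis .
qed

instance
proof
  fix x y z :: tsirelson and a b :: real
  note cs = coord_inject[symmetric] coord_add coord_diff coord_uminus coord_scaleR coord_zero
  show "x + y + z = x + (y + z)" "x + y = y + x" "0 + x = x" "- x + x = 0" "x - y = x + - y"
    "a *\<^sub>R (x + y) = a *\<^sub>R x + a *\<^sub>R y" "(a + b) *\<^sub>R x = a *\<^sub>R x + b *\<^sub>R x" 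
    "a *\<^sub>R b *\<^sub>R x = (a * b) *\<^sub>R x" "1 *\<^sub>R x = x"
    by (auto simp: cs algebra_simps)
  show "dist x y = norm (x - y)" "sgn x = inverse (norm x) *\<^sub>R x"
    "(uniformity :: (tsirelson \<times> tsirelson) filter) = (INF e\<in>{0<..}. principal {(x, y). dist x y < e})"
    by (rule dist_tsirelson_def sgn_tsirelson_def uniformity_tsirelson_def)+
  show "open U \<longleftrightarrow> (\<forall>x\<in>U. eventually (\<lambda>(x', y). x' = x \<longrightarrow> y \<in> U) uniformity)" for U :: "tsirelson set"
    by (rule open_tsirelson_def)
  show "norm x = 0 \<longleftrightarrow> x = 0"
  proof
    assume "norm x = 0"
    then have "coord x i = 0" for i using abs_coord_le_norm[of x i] by simp
    then show "x = 0" by (auto simp: cs)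
  next
    assume "x = 0"
    then have "norm x \<le> 0" by (intro norm_tsirelson_least) (simp add: coord_zero)
    moreover have "0 \<le> norm x" using abs_coord_le_norm[of x 0] by linarith
    ultimately show "norm x = 0" by simp
  qed
  show "norm (x + y) \<le> norm x + norm y"
  proof (rule norm_tsirelson_least)
    fix n
    have "tsirelson_norm (restr {..n} (coord (x + y))) \<le> 
       tsirelson_norm (restr {..n} (coord x)) + tsirelson_norm (restr {..n} (coord y))"
      unfolding coord_add restr_add by (intro tsirelson_norm_add coord_fin) auto
    also have "\<dots> \<le> norm x + norm y" by (intro add_mono tsirelson_norm_restr_le_norm) auto
    finally show "tsirelson_norm (restr {..n} (coord (x + y))) \<le> norm x + norm y" .
  qed
  have "(\<lambda>n. tsirelson_norm (restr {..n} (coord (a *\<^sub>R x)))) = 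
     (\<lambda>n. \<bar>a\<bar> * tsirelson_norm (restr {..n} (coord x)))"
    unfolding coord_scaleR restr_scale by (rule ext, rule tsirelson_norm_scale, rule coord_fin) simp
  then have "(\<lambda>n. tsirelson_norm (restr {..n} (coord (a *\<^sub>R x)))) \<longlonglongrightarrow> \<bar>a\<bar> * norm x"
    by (simp add: tendsto_mult_left norm_tsirelson_lim)
  then show "norm (a *\<^sub>R x) = \<bar>a\<bar> * norm x"
    using LIMSEQ_unique norm_tsirelson_lim by blast
qed

end

instance tsirelson :: banach
proof
  fix X :: "nat \<Rightarrow> tsirelson" assume "Cauchy X"
  then have C: "\<exists>K. \<forall>k\<ge>K. \<forall>l\<ge>K. norm (X k - X l) < \<epsilon>" if "\<epsilon> > 0" for \<epsilon>
    using that by (simp add: Cauchy_iff)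
  have "Cauchy (\<lambda>k. coord (X k) i)" for i
    unfolding Cauchy_iff
  proof (intro allI impI)
    fix \<epsilon> :: real assume "0 < \<epsilon>"
    then obtain K where K: "\<forall>k\<ge>K. \<forall>l\<ge>K. norm (X k - X l) < \<epsilon>" using C by blast
    have "norm (coord (X k) i - coord (X l) i) \<le> norm (X k - X l)" for k l
      using abs_coord_le_norm[of "X k - X l" i] by (simp add: coord_diff)
    then have "\<forall>m\<ge>K. \<forall>n\<ge>K. norm (coord (X m) i - coord (X n) i) < \<epsilon>"
      using K by (blast intro: le_less_trans)
    then show "\<exists>M. \<forall>m\<ge>M. \<forall>n\<ge>M. norm (coord (X m) i - coord (X n) i) < \<epsilon>" by blast
  qed
  then have "(\<lambda>k. coord (X k) i) \<longlonglongrightarrow> lim (\<lambda>k. coord (X k) i)" for i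
    by (simp add: Cauchy_convergent_iff convergent_LIMSEQ_iff)
  then obtain y where y: "\<And>i. (\<lambda>k. coord (X k) i) \<longlonglongrightarrow> y i" 
    using that[of "\<lambda>i. lim (\<lambda>k. coord (X k) i)"] by blast
  have "(\<lambda>k. 0) \<longlonglongrightarrow> y 0" using y[of 0] by (simp only: tset_zero[OF coord_tset])
  then have y0: "y 0 = 0" by (metis LIMSEQ_unique tendsto_const)
  have yd0: "y 0 - coord (X k) 0 = 0" for k using y0 tset_zero[OF coord_tset] by simp
  have A: "\<exists>K. \<forall>k\<ge>K. \<forall>E. finite E \<longrightarrow> tsirelson_norm (restr E (\<lambda>i. y i - coord (X k) i)) \<le> \<epsilon>" 
    if "\<epsilon> > 0" for \<epsilon>
  proof -
    obtain K where K: "\<forall>k\<ge>K. \<forall>l\<ge>K. norm (X k - X l) < \<epsilon>" using C[OF \<open>\<epsilon> > 0\<close>] by blast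
    have "tsirelson_norm (restr E (\<lambda>i. y i - coord (X k) i)) \<le> \<epsilon>" if k: "k \<ge> K" and E: "finite E" for k E
    proof -
      let ?t = "tsirelson_norm (restr E (\<lambda>i. y i - coord (X k) i))"
      have le: "?t \<le> (\<Sum>i\<in>E. \<bar>y i - coord (X l) i\<bar>) + \<epsilon>" if l: "l \<ge> K" for l
      proof -
        have c: "restr E (\<lambda>i. y i - coord (X l) i) \<in> c00" using E yd0 by (rule restr_finite_c00)
        have "restr E (\<lambda>i. y i - coord (X k) i) =
           (\<lambda>i. restr E (\<lambda>i. y i - coord (X l) i) i + restr E (coord (X l - X k)) i)"
          by (auto simp: restr_def coord_diff)
        then have "?t \<le> tsirelson_norm (restr E (\<lambda>i. y i - coord (X l) i)) 
            + tsirelson_norm (restr E (coord (X l - X k)))"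
          using tsirelson_norm_add[OF c coord_fin[OF E, of "X l - X k"]] by simp
        also have "tsirelson_norm (restr E (coord (X l - X k))) \<le> norm (X l - X k)"
          by (rule tsirelson_norm_restr_le_norm[OF E])
        also have "norm (X l - X k) \<le> \<epsilon>" using K k l by (simp add: less_imp_le)
        also have "tsirelson_norm (restr E (\<lambda>i. y i - coord (X l) i)) \<le> l1 (restr E (\<lambda>i. y i - coord (X l) i))"
          by (rule tsirelson_norm_le_l1[OF c])
        also have "\<dots> = (\<Sum>i\<in>E. \<bar>restr E (\<lambda>i. y i - coord (X l) i) i\<bar>)"
          by (rule l1_eq[OF E]) (auto simp: restr_def)
        also have "\<dots> = (\<Sum>i\<in>E. \<bar>y i - coord (X l) i\<bar>)" by (simp add: restr_def)
        finally show ?thesis by simp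
      qed
      have "(\<lambda>l. (\<Sum>i\<in>E. \<bar>y i - coord (X l) i\<bar>) + \<epsilon>) \<longlonglongrightarrow> (\<Sum>i\<in>E. \<bar>y i - y i\<bar>) + \<epsilon>"
        by (intro tendsto_intros y)
      then have "(\<lambda>l. (\<Sum>i\<in>E. \<bar>y i - coord (X l) i\<bar>) + \<epsilon>) \<longlonglongrightarrow> \<epsilon>" by simp
      then show ?thesis by (rule LIMSEQ_le_const) (use le in blast)
    qed
    then show ?thesis by blast
  qed
  have yt: "y \<in> tset"
  proof (rule tsetI)
    show "y 0 = 0" by (rule y0)
    fix \<epsilon> :: real assume "\<epsilon> > 0"
    then obtain K where K: "\<forall>k\<ge>K. \<forall>E. finite E \<longrightarrow> tsirelson_norm (restr E (\<lambda>i. y i - coord (X k) i)) \<le> \<epsilon>/2"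
      using A[of "\<epsilon>/2"] by auto
    obtain M where M: "\<forall>n\<ge>M. tsirelson_norm (restr {M<..n} (coord (X K))) < \<epsilon>/2"
      using tsetD[OF coord_tset, of "\<epsilon>/2" "X K"] \<open>\<epsilon> > 0\<close> by auto
    have "tsirelson_norm (restr {M<..n} y) < \<epsilon>" if "n \<ge> M" for n
    proof -
      have eq: "restr {M<..n} y = 
         (\<lambda>i. restr {M<..n} (\<lambda>i. y i - coord (X K) i) i + restr {M<..n} (coord (X K)) i)"
        by (auto simp: restr_def)
      have "tsirelson_norm (restr {M<..n} y) \<le> tsirelson_norm (restr {M<..n} (\<lambda>i. y i - coord (X K) i)) 
         + tsirelson_norm (restr {M<..n} (coord (X K)))"
        by (subst eq, intro tsirelson_norm_add restr_finite_c00 coord_fin yd0) simp_all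
      moreover have "tsirelson_norm (restr {M<..n} (\<lambda>i. y i - coord (X K) i)) \<le> \<epsilon>/2" using K by simp
      moreover have "tsirelson_norm (restr {M<..n} (coord (X K))) < \<epsilon>/2" using M that by simp
      ultimately show ?thesis by linarith
    qed
    then show "\<exists>M. \<forall>n\<ge>M. tsirelson_norm (restr {M<..n} y) < \<epsilon>" by blast
  qed
  define Y where "Y = Abs_tsirelson y"
  have cY: "coord Y = y" unfolding Y_def by (rule Abs_tsirelson_inverse[OF yt])
  have "X \<longlonglongrightarrow> Y"
    unfolding LIMSEQ_iff
  proof (intro allI impI)
    fix \<epsilon> :: real assume "\<epsilon> > 0"
    then obtain K where K: "\<forall>k\<ge>K. \<forall>E. finite E \<longrightarrow> tsirelson_norm (restr E (\<lambda>i. y i - coord (X k) i)) \<le> \<epsilon>/2"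
      using A[of "\<epsilon>/2"] by auto
    have "norm (X k - Y) < \<epsilon>" if "k \<ge> K" for k
    proof -
      have "norm (Y - X k) \<le> \<epsilon>/2"
        by (rule norm_tsirelson_least) (use K that in \<open>simp add: coord_diff cY\<close>)
      then show ?thesis using \<open>\<epsilon> > 0\<close> by (simp add: norm_minus_commute)
    qed
    then show "\<exists>K. \<forall>k\<ge>K. norm (X k - Y) < \<epsilon>" by blast
  qed
  then show "convergent X" by (rule convergentI)
qed

lemma coord_Abs_c00: "x \<in> c00 \<Longrightarrow> coord (Abs_tsirelson x) = x"
  by (intro Abs_tsirelson_inverse c00_subset_tset)

lemma norm_Abs_c00: assumes "x \<in> c00" shows "norm (Abs_tsirelson x) = tsirelson_norm x"
proof (rule antisym)
  show "norm (Abs_tsirelson x) \<le> tsirelson_norm x"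
    by (rule norm_tsirelson_least) (simp add: coord_Abs_c00 assms tsirelson_norm_restr)
  have "restr {i. x i \<noteq> 0} x = x" by (auto simp: restr_def)
  then show "tsirelson_norm x \<le> norm (Abs_tsirelson x)"
    using tsirelson_norm_restr_le_norm[of "{i. x i \<noteq> 0}" "Abs_tsirelson x"] assms
    by (simp add: coord_Abs_c00) (simp add: c00_def)
qed

text \<open>The unit vectors are enumerated from \<open>0\<close>: \<open>unit_vec k\<close> is \<open>e\<^bsub>k+1\<^esub>\<close>.\<close>

definition unit_vec :: "nat \<Rightarrow> tsirelson" where
  "unit_vec k = Abs_tsirelson (\<lambda>i. if i = Suc k then 1 else 0)"

lemma coord_unit_vec: "coord (unit_vec k) = (\<lambda>i. if i = Suc k then 1 else 0)"
  unfolding unit_vec_def by (rule coord_Abs_c00) (simp add: c00_def)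

lemma coord_sum: "finite A \<Longrightarrow> coord (sum f A) = (\<lambda>i. \<Sum>a\<in>A. coord (f a) i)"
  by (induction A rule: finite_induct) (auto simp: coord_zero coord_add)

lemma closure_span_unit_vec: "closure (span (range unit_vec)) = UNIV"
proof -
  have "X \<in> closure (span (range unit_vec))" for X :: tsirelson
    unfolding closure_approachable
  proof (intro allI impI)
    fix \<epsilon> :: real assume "\<epsilon> > 0"
    then obtain M where M: "\<forall>n\<ge>M. tsirelson_norm (restr {M<..n} (coord X)) < \<epsilon>/2"
      using tsetD[OF coord_tset, of "\<epsilon>/2" X] by auto
    define Z where "Z = (\<Sum>k<M. coord X (Suc k) *\<^sub>R unit_vec k)"
    have cZ: "coord Z = restr {..M} (coord X)"
    proof
      fix i
      show "coord Z i = restr {..M} (coord X) i"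
      proof (cases i)
        case 0 then show ?thesis using tset_zero[OF coord_tset] 
          by (simp add: Z_def coord_sum coord_scaleR coord_unit_vec restr_def)
      next
        case (Suc k)
        then show ?thesis
          by (simp add: Z_def coord_sum coord_scaleR coord_unit_vec restr_def if_distrib
              Suc_le_eq cong: if_cong)
      qed
    qed
    have "norm (X - Z) \<le> \<epsilon>/2"
    proof (rule norm_tsirelson_least)
      fix n
      have *: "restr {..n} (coord (X - Z)) = restr {..n} (restr {M<..max M n} (coord X))"
        unfolding coord_diff cZ by (intro ext) (auto simp: restr_def)
      have "tsirelson_norm (restr {..n} (coord (X - Z))) \<le> tsirelson_norm (restr {M<..max M n} (coord X))"
        unfolding * by (rule tsirelson_norm_restr[OF coord_fin]) simp
      also have "\<dots> \<le> \<epsilon>/2" using M by (simp add: less_imp_le)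
      finally show "tsirelson_norm (restr {..n} (coord (X - Z))) \<le> \<epsilon>/2" .
    qed
    then have "dist Z X < \<epsilon>" using \<open>\<epsilon> > 0\<close> by (simp add: dist_norm norm_minus_commute)
    moreover have "Z \<in> span (range unit_vec)" 
      unfolding Z_def by (intro span_sum span_scale span_base) auto
    ultimately show "\<exists>y\<in>span (range unit_vec). dist y X < \<epsilon>" by blast
  qed
  then show ?thesis by blast
qed


section \<open>Block subspaces\<close>

definition block_basis :: "(nat \<Rightarrow> 'a::real_vector) \<Rightarrow> (nat \<Rightarrow> 'a) \<Rightarrow> bool" where
  "block_basis u y \<longleftrightarrow>
     (\<exists>p a. strict_mono p \<and> (\<forall>i. y i \<noteq> 0 \<and> y i = (\<Sum>j\<in>{p i..<p (Suc i)}. a j *\<^sub>R u j)))"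

definition block_subspace :: "(nat \<Rightarrow> 'a::real_normed_vector) \<Rightarrow> 'a set \<Rightarrow> bool" where
  "block_subspace u Y \<longleftrightarrow> (\<exists>y. block_basis u y \<and> Y = closure (span (range y)))"


section \<open>Admissible trees and the norms \<open>|x|\<^sub>j\<^sup>n\<close>\<close>

text \<open>A set may be its own unique successor (\<open>{E}\<close> is a 1-admissible partition of \<open>E \<noteq> {}\<close>), so the
  same set may occur at several levels; nodes are therefore kept apart from their labels. The level
  of a node is its depth.\<close>

datatype set_tree = Node (node_set: "nat set") (succs: "set_tree list")

fun admissible_tree :: "set_tree \<Rightarrow> bool" where
  "admissible_tree (Node E ts) \<longleftrightarrow>
     finite E \<and> 0 \<notin> E \<and>
     (ts \<noteq> [] \<longrightarrow> admissible 1 (map node_set ts) \<and> \<Union> (set (map node_set ts)) = E) \<and>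
     (\<forall>t\<in>set ts. admissible_tree t)"

text \<open>Terminal sets paired with their levels, for a tree whose top node has level \<open>m\<close>.\<close>

fun terminals :: "nat \<Rightarrow> set_tree \<Rightarrow> (nat set \<times> nat) list" where
  "terminals m (Node E ts) = (if ts = [] then [(E, m)] else concat (map (terminals (Suc m)) ts))"

definition level_trees :: "nat \<Rightarrow> nat \<Rightarrow> set_tree set" where
  "level_trees j n = {t. admissible_tree t \<and> (\<forall>(E, l)\<in>set (terminals 0 t). \<exists>k. l = j + n * k)}"

definition tree_norm :: "nat \<Rightarrow> nat \<Rightarrow> tsirelson \<Rightarrow> real" where
  "tree_norm j n x =
     (SUP t\<in>level_trees j n. \<Sum>(E, l)\<leftarrow>terminals 0 t. (1/2) ^ l * sup_norm (restr E (coord x)))"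

text \<open>The supremum is taken over a nonempty bounded set of reals.\<close>

lemma level_trees_nonempty: "level_trees j n \<noteq> {}"
proof -
  have "\<exists>t. admissible_tree t \<and> node_set t = {1} \<and> (\<forall>m. terminals m t = [({1}, m + j)])"
  proof (induction j)
    case 0 show ?case by (rule exI[of _ "Node {1} []"]) simp
  next
    case (Suc j)
    then obtain t where "admissible_tree t \<and> node_set t = {1} \<and> (\<forall>m. terminals m t = [({1}, m + j)])"
      by blast
    then show ?case using admissible_single[of 1]
      by (intro exI[of _ "Node {1} [t]"]) auto
  qed
  then obtain t where "admissible_tree t" "terminals 0 t = [({1}, j)]" by auto
  then have "t \<in> level_trees j n" by (auto simp: level_trees_def)
  then show ?thesis by blast
qed

lemma terminals_sum_le:
  assumes "x \<in> c00"
  shows "admissible_tree t \<Longrightarrow> (\<Sum>(E, l)\<leftarrow>terminals m t. (1/2) ^ l * sup_norm (restr E x))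
           \<le> (1/2) ^ m * tsirelson_norm (restr (node_set t) x)"
proof (induction t arbitrary: m)
  case (Node E ts)
  show ?case
  proof (cases "ts = []")
    case True
    then show ?thesis using assms by (simp add: sup_norm_le_tsirelson_norm restr_c00)
  next
    case False
    let ?g = "\<lambda>(E, l). (1/2::real) ^ l * sup_norm (restr E x)"
    have adm: "admissible 1 (map node_set ts)" "\<Union> (set (map node_set ts)) = E" 
      using Node.prems False by auto
    have "(\<Sum>p\<leftarrow>terminals m (Node E ts). ?g p) = (\<Sum>t\<leftarrow>ts. \<Sum>p\<leftarrow>terminals (Suc m) t. ?g p)"
    proof -
      have "(\<Sum>p\<leftarrow>concat (map (terminals (Suc m)) us). ?g p) = (\<Sum>t\<leftarrow>us. \<Sum>p\<leftarrow>terminals (Suc m) t. ?g p)" for us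
        by (induction us) auto
      then show ?thesis using False by simp
    qed
    also have "\<dots> \<le> (\<Sum>t\<leftarrow>ts. (1/2) ^ Suc m * tsirelson_norm (restr (node_set t) x))"
      by (intro sum_list_mono Node.IH) (use Node.prems in auto)
    also have "\<dots> = (\<Sum>t\<leftarrow>ts. (1/2) ^ Suc m * tsirelson_norm (restr (node_set t) (restr E x)))"
    proof (intro arg_cong[where f = sum_list] map_cong refl)
      fix t assume "t \<in> set ts"
      then have "node_set t \<inter> E = node_set t" using adm(2) by auto
      then show "(1/2) ^ Suc m * tsirelson_norm (restr (node_set t) x) =
         (1/2) ^ Suc m * tsirelson_norm (restr (node_set t) (restr E x))" by (simp add: restr_restr)
    qed
    also have "\<dots> = (1/2) ^ m * (1/2 * (\<Sum>F\<leftarrow>map node_set ts. tsirelson_norm (restr F (restr E x))))"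
    proof -
      have "(\<Sum>t\<leftarrow>us. (1/2) ^ Suc m * tsirelson_norm (restr (node_set t) (restr E x))) =
         (1/2) ^ m * (1/2 * (\<Sum>F\<leftarrow>map node_set us. tsirelson_norm (restr F (restr E x))))" for us
        by (induction us) (auto simp: algebra_simps)
      then show ?thesis .
    qed
    also have "\<dots> \<le> (1/2) ^ m * tsirelson_norm (restr E x)"
      by (intro mult_left_mono tsirelson_norm_half_sum adm(1)) (use assms in auto)
    finally show ?thesis by simp
  qed
qed

lemma tree_sum_le_norm:
  assumes "admissible_tree t"
  shows "(\<Sum>(E, l)\<leftarrow>terminals 0 t. (1/2) ^ l * sup_norm (restr E (coord x))) \<le> norm x"
proof -
  let ?x = "restr (node_set t) (coord x)"
  have fin: "finite (node_set t)" using assms by (cases t) auto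
  have sub: "E \<subseteq> node_set t" if "admissible_tree t" "(E, l) \<in> set (terminals m t)" for E l m t
    using that
  proof (induction t arbitrary: m)
    case (Node F ts)
    show ?case
    proof (cases "ts = []")
      case False
      then obtain s where "s \<in> set ts" "(E, l) \<in> set (terminals (Suc m) s)" using Node.prems by auto
      moreover from this have "E \<subseteq> node_set s" using Node by auto
      ultimately show ?thesis using Node.prems False by auto
    qed (use Node in auto)
  qed
  have "(\<Sum>(E, l)\<leftarrow>terminals 0 t. (1/2) ^ l * sup_norm (restr E (coord x))) =
        (\<Sum>(E, l)\<leftarrow>terminals 0 t. (1/2) ^ l * sup_norm (restr E ?x))"
    using sub[OF assms, of _ _ 0] 
    by (intro arg_cong[where f = sum_list] map_cong) (auto simp: restr_restr Int_absorb2)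
  also have "\<dots> \<le> tsirelson_norm (restr (node_set t) ?x)"
    using terminals_sum_le[OF coord_fin[OF fin] assms, of x 0] by simp
  also have "\<dots> \<le> norm x" by (simp add: restr_restr tsirelson_norm_restr_le_norm fin)
  finally show ?thesis .
qed

lemma tree_norm_bdd:
  "bdd_above ((\<lambda>t. \<Sum>(E, l)\<leftarrow>terminals 0 t. (1/2) ^ l * sup_norm (restr E (coord x))) ` level_trees j n)"
  by (rule bdd_aboveI2[of _ _ "norm x"]) (auto simp: level_trees_def intro: tree_sum_le_norm)

end

theory Submission
  imports Defs
begin

text \<open>Unravelling the trees, \<open>|x|\<^sub>j\<^sup>n\<close> is the supremum of \<open>\<Sum>k\<in>F. 2\<^bsup>-l(k)\<^esup> \<bar>x(k)\<bar>\<close> over those pairs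
  \<open>(F, l)\<close> of a set of leaves and their levels which come from an admissible tree and satisfy
  \<open>l \<equiv> j (mod n)\<close> on \<open>F\<close>; here \<open>j\<close> may be any integer, and \<open>n = 1\<close> gives the Tsirelson norm.

  For a sufficiently sparse block sequence \<open>(u\<^sub>k)\<close>, grafting trees shows that bounds on all
  \<open>|u\<^sub>k|\<^sub>r\<^sup>n\<close> determine \<open>|\<Sum> a\<^sub>k u\<^sub>k|\<^sub>j\<^sup>n\<close> up to an absolute constant as the supremum of
  \<open>\<Sum>k. 2\<^bsup>-l(k)\<^esup> \<bar>a\<^sub>k\<bar> |u\<^sub>k|\<^bsub>j-l(k)\<^esub>\<^sup>n\<close>. So if the blocks satisfy \<open>|u\<^sub>k|\<^sub>j\<^sup>n \<approx> s\<close> for all \<open>j\<close> and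
  \<open>\<parallel>u\<^sub>k\<parallel> \<approx> t\<close>, with \<open>s\<close> and \<open>t\<close> independent of \<open>k\<close>, their span has the required property. To find
  such blocks, pass to a subsequence of the normalised \<open>(y\<^sub>k)\<close> on which each \<open>|\<cdot>|\<^sub>r\<^sup>n\<close> is almost
  constant, with value \<open>D(r)\<close>. An average of order \<open>M\<close> of it, scaled by \<open>2\<^sup>M\<close>, shifts the profile
  \<open>D\<close> by \<open>M\<close>, so adding up averages of the orders \<open>1, \<dots>, n\<close> gives a vector whose norms
  \<open>|\<cdot>|\<^sub>j\<^sup>n\<close> are all comparable to \<open>D(1) + \<dots> + D(n)\<close>.\<close>

section \<open>Levels of leaves in admissible trees\<close>

text \<open>Symmetric in its arguments, so that the successors of a node can be kept as an unordered
  family; the empty set is separated from everything.\<close>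

definition sep :: "nat set \<Rightarrow> nat set \<Rightarrow> bool" where
  "sep A B \<longleftrightarrow> (\<forall>a\<in>A. \<forall>b\<in>B. a < b) \<or> (\<forall>a\<in>A. \<forall>b\<in>B. b < a)"

text \<open>\<open>F\<close> is the set of leaves of a tree and \<open>l\<close> their levels below its top node; only the values of
  \<open>l\<close> on \<open>F\<close> matter. The bound on the number of successors is read at \<open>p k\<close> instead of \<open>k\<close>, so that
  a leaf may also stand for the \<open>k\<close>-th vector of a block sequence whose support begins at \<open>p k\<close>.\<close>

inductive adm :: "(nat \<Rightarrow> nat) \<Rightarrow> nat set \<Rightarrow> (nat \<Rightarrow> nat) \<Rightarrow> bool" for p where
  single: "l k = 0 \<Longrightarrow> 1 \<le> p k \<Longrightarrow> adm p {k} l"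
| node: "finite \<F> \<Longrightarrow> pairwise sep \<F> \<Longrightarrow> \<forall>F\<in>\<F>. adm p F l \<Longrightarrow>
    \<forall>k\<in>\<Union>\<F>. card \<F> \<le> p k \<and> l' k = Suc (l k) \<Longrightarrow> adm p (\<Union>\<F>) l'"

abbreviation tree_adm :: "nat set \<Rightarrow> (nat \<Rightarrow> nat) \<Rightarrow> bool" where
  "tree_adm \<equiv> adm (\<lambda>k. k)"

lemma sep_sym: "sep A B \<Longrightarrow> sep B A" unfolding sep_def by blast

lemma sep_subset: "sep A B \<Longrightarrow> A' \<subseteq> A \<Longrightarrow> B' \<subseteq> B \<Longrightarrow> sep A' B'"
  unfolding sep_def by blast

lemma sep_disjoint: "sep A B \<Longrightarrow> A \<inter> B = {}" unfolding sep_def by fastforce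

lemma adm_empty [simp]: "adm p {} l"
  using adm.node[of "{}" p l] by simp

lemma adm_finite: "adm p F l \<Longrightarrow> finite F"
  by (induction rule: adm.induct) auto

lemma adm_pos: "adm p F l \<Longrightarrow> k \<in> F \<Longrightarrow> 1 \<le> p k"
  by (induction rule: adm.induct) auto

lemma adm_cong: "adm p F l \<Longrightarrow> (\<And>k. k \<in> F \<Longrightarrow> l k = l' k) \<Longrightarrow> adm p F l'"
proof (induction arbitrary: l' rule: adm.induct)
  case (single l k) then show ?case by (intro adm.single) auto
next
  case (node \<F> l l1)
  show ?case by (rule adm.node[of _ _ l]) (use node in auto)
qed

text \<open>Children may be indexed and carry different level functions: \<open>l'\<close> already
  records all of them, so \<open>\<lambda>k. l' k - 1\<close> serves as the common one that the rule
  \<open>node\<close> asks for.\<close>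

lemma adm_nodeI:
  assumes "finite I" and sep: "\<And>i j. i \<in> I \<Longrightarrow> j \<in> I \<Longrightarrow> i \<noteq> j \<Longrightarrow> sep (F i) (F j)"
    and adm: "\<And>i. i \<in> I \<Longrightarrow> adm p (F i) (l i)"
    and card: "\<And>i k. i \<in> I \<Longrightarrow> k \<in> F i \<Longrightarrow> card I \<le> p k"
    and l': "\<And>i k. i \<in> I \<Longrightarrow> k \<in> F i \<Longrightarrow> l' k = Suc (l i k)"
  shows "adm p (\<Union>i\<in>I. F i) l'"
proof -
  have "card (F ` I) \<le> card I" using assms(1) by (rule card_image_le)
  have "adm p (\<Union> (F ` I)) l'"
  proof (rule adm.node)
    show "finite (F ` I)" using assms(1) by simp
    show "pairwise sep (F ` I)" using sep by (fastforce simp: pairwise_def)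
    show "\<forall>G\<in>F ` I. adm p G (\<lambda>k. l' k - 1)"
      using l' by (auto intro!: adm_cong[OF adm])
    show "\<forall>k\<in>\<Union> (F ` I). card (F ` I) \<le> p k \<and> l' k = Suc (l' k - 1)"
      using l' card \<open>card (F ` I) \<le> card I\<close> by fastforce
  qed
  then show ?thesis by simp
qed

text \<open>Pruning: intersecting every node with \<open>G\<close> preserves separation and levels,
  and the bound on the number of children has to hold at fewer points.\<close>

lemma adm_subset: "adm p F l \<Longrightarrow> G \<subseteq> F \<Longrightarrow> adm p G l"
proof (induction arbitrary: G rule: adm.induct)
  case (single l k)
  then have "G = {} \<or> G = {k}" by blast
  then show ?case using adm.single[of l k p] single by auto
next
  case (node \<F> l l')
  have "adm p (\<Union>F\<in>\<F>. F \<inter> G) l'"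
  proof (rule adm_nodeI[of _ _ _ "\<lambda>_. l"])
    fix F F' assume "F \<in> \<F>" "F' \<in> \<F>" "F \<noteq> F'"
    then have "sep F F'" using node.hyps(2) by (auto simp: pairwise_def)
    then show "sep (F \<inter> G) (F' \<inter> G)" by (rule sep_subset) auto
  qed (use node in auto)
  moreover have "(\<Union>F\<in>\<F>. F \<inter> G) = G" using node.prems by blast
  ultimately show ?case by simp
qed

text \<open>A node with a single child may be put on top because \<open>1 \<le> p k\<close> at every
  leaf; this is repeated \<open>t\<close> times.\<close>

lemma adm_shift: "adm p F l \<Longrightarrow> adm p F (\<lambda>k. l k + t)"
proof (induction t)
  case (Suc t)
  have "adm p (\<Union>i\<in>{()}. F) (\<lambda>k. l k + Suc t)"
    by (rule adm_nodeI[of _ _ _ "\<lambda>_ k. l k + t"]) (use Suc adm_pos in auto)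
  then show ?case by simp
qed simp

definition wt :: "nat set \<Rightarrow> (nat \<Rightarrow> nat) \<Rightarrow> (nat \<Rightarrow> real) \<Rightarrow> real" where
  "wt F l x = (\<Sum>k\<in>F. (1/2) ^ l k * \<bar>x k\<bar>)"

text \<open>The residue \<open>r\<close> is an integer, so that \<open>r - int t\<close> makes sense
  for the part of a tree below level \<open>t\<close>.\<close>

definition lev :: "nat \<Rightarrow> int \<Rightarrow> nat set \<Rightarrow> (nat \<Rightarrow> nat) \<Rightarrow> bool" where
  "lev n r F l \<longleftrightarrow> (\<forall>k\<in>F. int n dvd r - int (l k))"

lemma wt_nonneg: "0 \<le> wt F l x" by (auto simp: wt_def sum_nonneg)

lemma wt_empty [simp]: "wt {} l x = 0" by (simp add: wt_def)

lemma wt_mono: "finite F \<Longrightarrow> G \<subseteq> F \<Longrightarrow> wt G l x \<le> wt F l x"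
  unfolding wt_def by (rule sum_mono2) auto

lemma wt_UN:
  assumes "finite I" "\<And>i. i \<in> I \<Longrightarrow> finite (F i)" "\<And>i j. i \<in> I \<Longrightarrow> j \<in> I \<Longrightarrow> i \<noteq> j \<Longrightarrow> F i \<inter> F j = {}"
  shows "wt (\<Union>i\<in>I. F i) l x = (\<Sum>i\<in>I. wt (F i) l x)"
  unfolding wt_def by (rule sum.UNION_disjoint) (use assms in auto)

lemma wt_shift: "wt F (\<lambda>k. l k + t) x = (1/2) ^ t * wt F l x"
  by (simp add: wt_def power_add sum_distrib_left mult_ac)

lemma wt_Suc: "(\<And>k. k \<in> F \<Longrightarrow> l' k = Suc (l k)) \<Longrightarrow> wt F l' x = 1/2 * wt F l x"
  by (simp add: wt_def sum_distrib_left mult_ac)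

lemma wt_restr: "finite F \<Longrightarrow> wt F l (restr E x) = wt (F \<inter> E) l x"
  unfolding wt_def by (rule sum.mono_neutral_cong_right) (auto simp: restr_def)

lemma lev_subset: "lev n r F l \<Longrightarrow> G \<subseteq> F \<Longrightarrow> lev n r G l" by (auto simp: lev_def)

section \<open>Admissible trees and their leaf systems\<close>

text \<open>One half of the description of the first Schreier class by
  \<open>card A \<le> Min A\<close>: each of the \<open>length Es\<close> pieces has at most one
  point.\<close>

lemma schreier_Suc_0_card:
  assumes "A \<in> schreier (Suc 0)" "a \<in> A" shows "card A \<le> a"
proof -
  obtain Es where Es: "A = \<Union> (set Es)"
    "\<And>E. E \<in> set Es \<Longrightarrow> (E = {} \<or> (\<exists>n. E = {n})) \<and> set_le {length Es} E"
    using assms(1) by auto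
  have "card A \<le> (\<Sum>E\<in>set Es. card E)" unfolding Es(1) by (rule card_Union_le_sum_card)
  also have "\<dots> \<le> (\<Sum>E\<in>set Es. 1)" using Es(2) by (intro sum_mono) fastforce
  also have "\<dots> \<le> length Es" by (simp add: card_length)
  also obtain E where "E \<in> set Es" "a \<in> E" using Es(1) assms(2) by blast
  then have "length Es \<le> a" using Es(2)[of E] by (auto simp: set_le_def)
  finally show ?thesis .
qed

lemma schreier_Suc_0_I:
  assumes "finite A" "A \<noteq> {}" "\<And>a. a \<in> A \<Longrightarrow> card A \<le> a"
  shows "A \<in> schreier (Suc 0)"
proof -
  let ?xs = "sorted_list_of_set A"
  let ?Es = "map (\<lambda>a. {a}) ?xs"
  have "1 \<le> card A" using assms by (simp add: Suc_leI card_gt_0_iff)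
  then have "\<forall>E\<in>set ?Es. E \<in> schreier 0 \<and> set_le {length ?Es} E"
    using assms by (fastforce simp: set_le_def)
  moreover have "sorted_wrt set_less ?Es"
    by (simp add: sorted_wrt_map set_less_def)
  moreover have "A = \<Union> (set ?Es)" "?Es \<noteq> []" using assms by auto
  ultimately show ?thesis unfolding schreier.simps by blast
qed

lemma set_less_sep: "set_less E F \<Longrightarrow> finite E \<Longrightarrow> finite F \<Longrightarrow> sep E F"
  unfolding set_less_def sep_def 
  by (meson Max_ge Min_le ex_in_conv le_less_trans less_le_trans)

text \<open>Separated sets have distinct minima, so \<open>length Es\<close> is the size of the set
  of minima. That set lies in the first Schreier class, hence its size is at most each
  minimum.\<close>

lemma admissible_card:
  assumes "admissible 1 Es" "E \<in> set Es" "k \<in> E"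
  shows "length Es \<le> k"
proof -
  have Es: "\<And>E. E \<in> set Es \<Longrightarrow> finite E \<and> E \<noteq> {}" "sorted_wrt set_less Es" 
    "Min ` set Es \<in> schreier (Suc 0)" using assms(1) by (auto simp: admissible_def)
  have "distinct (map Min Es)" using Es(1,2)
  proof (induction Es)
    case (Cons E Es)
    have "Min E < Min F" if "F \<in> set Es" for F
    proof -
      have "Max E < Min F" using Cons.prems that by (auto simp: set_less_def)
      moreover have "Min E \<le> Max E" using Cons.prems by simp
      ultimately show ?thesis by simp
    qed
    then have "Min E \<notin> Min ` set Es" by force
    moreover have "distinct (map Min Es)" using Cons by simp
    ultimately show ?case by simp
  qed simp
  then have "card (Min ` set Es) = length Es" 
    using distinct_card[of "map Min Es"] by simp
  moreover have "card (Min ` set Es) \<le> Min E"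
    using schreier_Suc_0_card[OF Es(3)] assms(2) by blast
  moreover have "Min E \<le> k" using Es(1)[OF assms(2)] assms(3) by simp
  ultimately show ?thesis by simp
qed

lemma admissible_sep:
  assumes "admissible 1 Es" "i < length Es" "j < length Es" "i \<noteq> j"
  shows "sep (Es ! i) (Es ! j)"
proof -
  have "sep (Es ! i) (Es ! j)" if "i < j" "j < length Es" for i j
    using assms(1) that by (intro set_less_sep) (auto simp: admissible_def sorted_wrt_iff_nth_less)
  then show ?thesis using assms by (cases "i < j") (auto intro: sep_sym)
qed

text \<open>Leaf systems inside the members of a 1-admissible family are joined below one new node.
  They are disjoint, so \<open>l'\<close> reads the level off the unique child containing
  \<open>k\<close>; the extra level costs the factor \<open>1/2\<close>.\<close>

lemma admissible_adm:
  assumes Es: "admissible 1 Es" 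
    and adm: "\<And>i. i < length Es \<Longrightarrow> tree_adm (F i) (l i)" "\<And>i. i < length Es \<Longrightarrow> F i \<subseteq> Es ! i"
  shows "\<exists>l'. tree_adm (\<Union>i<length Es. F i) l' \<and> (\<forall>i<length Es. \<forall>k\<in>F i. l' k = Suc (l i k)) \<and>
     (\<forall>x. wt (\<Union>i<length Es. F i) l' x = 1/2 * (\<Sum>i<length Es. wt (F i) (l i) x))"
proof -
  have sep: "sep (F i) (F j)" if "i < length Es" "j < length Es" "i \<noteq> j" for i j
    using sep_subset[OF admissible_sep[OF Es that]] adm(2) that by blast
  define l' where "l' k = Suc (l (THE i. i < length Es \<and> k \<in> F i) k)" for k
  have l': "l' k = Suc (l i k)" if "i < length Es" "k \<in> F i" for i k
  proof -
    have "(THE i. i < length Es \<and> k \<in> F i) = i"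
      using that sep sep_disjoint by (intro the_equality) blast+
    then show ?thesis by (simp add: l'_def)
  qed
  have "tree_adm (\<Union>i\<in>{..<length Es}. F i) l'"
  proof (rule adm_nodeI)
    fix i k assume "i \<in> {..<length Es}" "k \<in> F i"
    then show "card {..<length Es} \<le> k" 
      using admissible_card[OF Es, of "Es ! i" k] adm(2)[of i] by auto
  qed (use sep adm l' in auto)
  moreover have "wt (\<Union>i<length Es. F i) l' x = 1/2 * (\<Sum>i<length Es. wt (F i) (l i) x)" for x
  proof -
    have "wt (\<Union>i<length Es. F i) l' x = (\<Sum>i<length Es. wt (F i) l' x)"
      using adm sep sep_disjoint by (intro wt_UN) (blast intro: adm_finite)+
    also have "\<dots> = (\<Sum>i<length Es. 1/2 * wt (F i) (l i) x)"
      using l' by (intro sum.cong wt_Suc) auto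
    finally show ?thesis by (simp add: sum_distrib_left)
  qed
  ultimately show ?thesis using l' by blast
qed

text \<open>On a nonempty terminal set the sup norm is attained at some coordinate. Keeping one such
  coordinate per terminal set gives a leaf system, depending on \<open>x\<close>, with the same
  value; empty terminal sets contribute nothing.\<close>

lemma terminals_adm:
  assumes "x 0 = 0"
  shows "admissible_tree t \<Longrightarrow> \<exists>F l. F \<subseteq> node_set t \<and> tree_adm F l \<and> 
     (\<forall>k\<in>F. \<exists>E. (E, m + l k) \<in> set (terminals m t)) \<and>
     (\<Sum>(E, q)\<leftarrow>terminals m t. (1/2) ^ q * sup_norm (restr E x)) = (1/2) ^ m * wt F l x"
proof (induction t arbitrary: m)
  case (Node E ts)
  then have E: "finite E" "0 \<notin> E" by auto
  show ?case
  proof (cases "ts = []")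
    case True
    show ?thesis
    proof (cases "E = {}")
      case True
      have "restr {} x = (\<lambda>_. 0)" by (auto simp: restr_def)
      then show ?thesis using \<open>ts = []\<close> True
        by (intro exI[of _ "{}"]) (simp add: sup_norm_def)
    next
      case False
      have "Max ((\<lambda>k. \<bar>x k\<bar>) ` E) \<in> (\<lambda>k. \<bar>x k\<bar>) ` E" using E(1) False by (intro Max_in) auto
      then obtain k where "k \<in> E" "Max ((\<lambda>k. \<bar>x k\<bar>) ` E) = \<bar>x k\<bar>" by blast
      then have k: "k \<in> E" "\<And>i. i \<in> E \<Longrightarrow> \<bar>x i\<bar> \<le> \<bar>x k\<bar>"
        using Max_ge[of "(\<lambda>k. \<bar>x k\<bar>) ` E"] E(1) by fastforce+
      have "sup_norm (restr E x) = \<bar>x k\<bar>"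
      proof (rule antisym)
        show "sup_norm (restr E x) \<le> \<bar>x k\<bar>" using k by (intro sup_norm_le) (auto simp: restr_def)
        show "\<bar>x k\<bar> \<le> sup_norm (restr E x)"
          using abs_le_sup_norm[OF restr_finite_c00[of E x], of k] E assms k by (simp add: restr_def)
      qed
      moreover have "tree_adm {k} (\<lambda>_. 0)" using k E by (intro adm.single) (auto simp: Suc_le_eq intro: gr0I)
      moreover have "wt {k} (\<lambda>_. 0) x = \<bar>x k\<bar>" by (simp add: wt_def)
      ultimately show ?thesis using True k(1)
        by (intro exI[of _ "{k}"] exI[of _ "\<lambda>_. 0"] conjI; (assumption | simp))
    qed
  next
    case False
    let ?g = "\<lambda>(E, q). (1/2::real) ^ q * sup_norm (restr E x)"
    let ?Es = "map node_set ts"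
    have Es: "admissible 1 ?Es" "\<Union> (set ?Es) = E" using Node.prems False by auto
    have "\<exists>F l. F \<subseteq> node_set (ts ! i) \<and> tree_adm F l \<and> 
       (\<forall>k\<in>F. \<exists>E. (E, Suc m + l k) \<in> set (terminals (Suc m) (ts ! i))) \<and>
       (\<Sum>p\<leftarrow>terminals (Suc m) (ts ! i). ?g p) = (1/2) ^ Suc m * wt F l x" if "i < length ts" for i
      by (rule Node.IH) (use that Node.prems in auto)
    then obtain F l where Fl: "\<And>i. i < length ts \<Longrightarrow> F i \<subseteq> node_set (ts ! i) \<and> tree_adm (F i) (l i) \<and> 
       (\<forall>k\<in>F i. \<exists>E. (E, Suc m + l i k) \<in> set (terminals (Suc m) (ts ! i))) \<and>
       (\<Sum>p\<leftarrow>terminals (Suc m) (ts ! i). ?g p) = (1/2) ^ Suc m * wt (F i) (l i) x"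
      by metis
    obtain l' where l': "tree_adm (\<Union>i<length ?Es. F i) l'" "\<And>i k. i < length ?Es \<Longrightarrow> k \<in> F i \<Longrightarrow> l' k = Suc (l i k)"
      "wt (\<Union>i<length ?Es. F i) l' x = 1/2 * (\<Sum>i<length ?Es. wt (F i) (l i) x)"
      using admissible_adm[OF Es(1), of F l] Fl by auto
    have "(\<Sum>p\<leftarrow>terminals m (Node E ts). ?g p) = (\<Sum>t\<leftarrow>ts. \<Sum>p\<leftarrow>terminals (Suc m) t. ?g p)"
    proof -
      have "(\<Sum>p\<leftarrow>concat (map (terminals (Suc m)) us). ?g p) = (\<Sum>t\<leftarrow>us. \<Sum>p\<leftarrow>terminals (Suc m) t. ?g p)" for us
        by (induction us) auto
      then show ?thesis using False by simp
    qed
    also have "\<dots> = (\<Sum>i<length ts. (1/2) ^ Suc m * wt (F i) (l i) x)"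
      by (subst sum_list_sum_nth) (auto simp: atLeast0LessThan Fl intro!: sum.cong)
    also have "\<dots> = (1/2) ^ m * wt (\<Union>i<length ?Es. F i) l' x"
      by (subst l'(3)) (simp add: sum_distrib_left)
    finally have 1: "(\<Sum>p\<leftarrow>terminals m (Node E ts). ?g p) = (1/2) ^ m * wt (\<Union>i<length ?Es. F i) l' x" .
    have 2: "\<exists>E'. (E', m + l' k) \<in> set (terminals m (Node E ts))" if "k \<in> (\<Union>i<length ?Es. F i)" for k
    proof -
      from that obtain i where i: "i < length ts" "k \<in> F i" by auto
      then obtain E' where "(E', Suc m + l i k) \<in> set (terminals (Suc m) (ts ! i))" using Fl by blast
      then have "(E', m + l' k) \<in> set (terminals m (Node E ts))" using False i l'(2)[of i k] by auto
      then show ?thesis by blast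
    qed
    have 3: "(\<Union>i<length ?Es. F i) \<subseteq> E"
    proof
      fix k assume "k \<in> (\<Union>i<length ?Es. F i)"
      then obtain i where i: "i < length ts" "k \<in> F i" by auto
      then have "k \<in> node_set (ts ! i)" "node_set (ts ! i) \<in> set ?Es" using Fl by auto
      then show "k \<in> E" using Es(2) by blast
    qed
    show ?thesis using 1 2 3 l'(1) by (intro exI[of _ "\<Union>i<length ?Es. F i"] exI[of _ l']) auto
  qed
qed

text \<open>Of two separated sets the one with the smaller minimum lies wholly before the other, so
  sorting by \<open>Min\<close> works.\<close>

lemma sep_family_sorted:
  assumes "finite \<F>" "pairwise sep \<F>" "\<And>F. F \<in> \<F> \<Longrightarrow> finite F \<and> F \<noteq> {}"
  shows "\<exists>Es. set Es = \<F> \<and> distinct Es \<and> sorted_wrt set_less Es"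
proof -
  obtain xs where xs: "set xs = \<F>" "distinct xs" using finite_distinct_list[OF assms(1)] by blast
  let ?Es = "sort_key Min xs"
  have "set_less (?Es ! i) (?Es ! j)" if ij: "i < j" "j < length ?Es" for i j
  proof -
    let ?A = "?Es ! i" and ?B = "?Es ! j"
    have mem: "?A \<in> \<F>" "?B \<in> \<F>" using ij xs(1) nth_mem[of i ?Es] nth_mem[of j ?Es] by auto
    have "?A \<noteq> ?B" using ij xs(2) nth_eq_iff_index_eq[of ?Es i j] by simp
    then have "sep ?A ?B" using assms(2) mem by (auto simp: pairwise_def)
    have "Min ?A \<le> Min ?B"
      using sorted_nth_mono[of "map Min ?Es" i j] ij by simp
    have "\<not> Min ?B < Min ?A" using \<open>Min ?A \<le> Min ?B\<close> by simp
    moreover have "Min ?A \<in> ?A" "Min ?B \<in> ?B" "Max ?A \<in> ?A" using mem assms(3) by (auto intro: Min_in Max_in)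
    ultimately have "Max ?A < Min ?B" using \<open>sep ?A ?B\<close> unfolding sep_def by blast
    then show ?thesis by (simp add: set_less_def)
  qed
  then have "sorted_wrt set_less ?Es" by (simp add: sorted_wrt_iff_nth_less)
  then show ?thesis using xs by (intro exI[of _ ?Es]) auto
qed

text \<open>Converse to \<open>terminals_adm\<close>: each leaf becomes a singleton terminal set,
  and the tree does not depend on \<open>x\<close>. The minima of the successors form a Schreier set
  because the number of children is at most every element of the node.\<close>

lemma adm_terminals:
  assumes "tree_adm F l" "F \<noteq> {}"
  shows "\<exists>t. admissible_tree t \<and> node_set t = F \<and> (\<forall>m E q. (E, q) \<in> set (terminals m t) \<longrightarrow> (\<exists>k\<in>F. q = m + l k)) \<and>
     (\<forall>m x. x 0 = 0 \<longrightarrow> (\<Sum>(E, q)\<leftarrow>terminals m t. (1/2) ^ q * sup_norm (restr E x)) = (1/2) ^ m * wt F l x)"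
  using assms
proof (induction rule: adm.induct)
  case (single l k)
  have "sup_norm (restr {k} x) = \<bar>x k\<bar>" if "x 0 = 0" for x
  proof (rule antisym)
    show "sup_norm (restr {k} x) \<le> \<bar>x k\<bar>" by (intro sup_norm_le) (auto simp: restr_def)
    show "\<bar>x k\<bar> \<le> sup_norm (restr {k} x)"
      using abs_le_sup_norm[OF restr_finite_c00[of "{k}" x], of k] that by (simp add: restr_def)
  qed
  then show ?case using single by (intro exI[of _ "Node {k} []"]) (auto simp: wt_def)
next
  case (node \<F> l l')
  \<comment> \<open>Members of a 1-admissible family are nonempty; dropping empty children only
    lowers their number.\<close>
  let ?G = "\<F> - {{}}"
  have adm_F: "tree_adm F l" if "F \<in> \<F>" for F using node.IH that by blast
  have fin: "finite F" if "F \<in> \<F>" for F using adm_finite[OF adm_F[OF that]] .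
  have low: "card \<F> \<le> k" "l' k = Suc (l k)" if "k \<in> F" "F \<in> \<F>" for k F
    using node.hyps(3) that by blast+
  obtain Es where Es: "set Es = ?G" "distinct Es" "sorted_wrt set_less Es"
  proof -
    have "finite ?G" "pairwise sep ?G" "\<And>F. F \<in> ?G \<Longrightarrow> finite F \<and> F \<noteq> {}"
      using node.hyps(1) pairwise_subset[OF node.hyps(2)] fin by auto
    then show thesis using sep_family_sorted[of ?G] that by blast
  qed
  have ne: "Es \<noteq> []"
  proof
    assume "Es = []"
    then have "\<F> - {{}} = {}" using Es(1) by simp
    then show False using node.prems by blast
  qed
  have len: "length Es \<le> card \<F>"
    using distinct_card[OF Es(2)] Es(1) node.hyps(1) by (metis Diff_subset card_mono)
  have adm: "admissible 1 Es"
  proof -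
    have "Min ` set Es \<in> schreier (Suc 0)"
    proof (rule schreier_Suc_0_I)
      fix a assume "a \<in> Min ` set Es"
      then obtain F where F: "F \<in> ?G" "a = Min F" using Es(1) by blast
      then have "a \<in> F" using fin by (auto intro: Min_in)
      then have "card \<F> \<le> a" using low F by auto
      moreover have "card (Min ` set Es) \<le> length Es"
        using card_image_le[of "set Es" Min] card_length[of Es] by simp
      ultimately show "card (Min ` set Es) \<le> a" using len by simp
    qed (use ne in auto)
    moreover have "\<forall>E\<in>set Es. finite E \<and> E \<noteq> {}" unfolding Es(1) using fin by blast
    ultimately show ?thesis using Es(3) ne unfolding admissible_def by simp
  qed
  have "\<forall>F\<in>?G. \<exists>t. admissible_tree t \<and> node_set t = F \<and> (\<forall>m E q. (E, q) \<in> set (terminals m t) \<longrightarrow> (\<exists>k\<in>F. q = m + l k)) \<and>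
     (\<forall>m x. x 0 = 0 \<longrightarrow> (\<Sum>(E, q)\<leftarrow>terminals m t. (1/2) ^ q * sup_norm (restr E x)) = (1/2) ^ m * wt F l x)"
    using node.IH by blast
  then obtain T where T: "\<And>F. F \<in> ?G \<Longrightarrow> admissible_tree (T F) \<and> node_set (T F) = F \<and> 
     (\<forall>m E q. (E, q) \<in> set (terminals m (T F)) \<longrightarrow> (\<exists>k\<in>F. q = m + l k)) \<and>
     (\<forall>m x. x 0 = 0 \<longrightarrow> (\<Sum>(E, q)\<leftarrow>terminals m (T F). (1/2) ^ q * sup_norm (restr E x)) = (1/2) ^ m * wt F l x)"
    by metis
  let ?t = "Node (\<Union>\<F>) (map T Es)"
  have ns: "map node_set (map T Es) = Es" 
    unfolding map_map by (rule map_idI) (use T Es(1) in auto)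
  have U: "\<Union> (set Es) = \<Union>\<F>" unfolding Es(1) by blast
  have "0 \<notin> \<Union>\<F>"
  proof
    assume "0 \<in> \<Union>\<F>"
    then obtain F where "F \<in> \<F>" "0 \<in> F" by blast
    then show False using adm_pos[OF adm_F] by auto
  qed
  moreover have "\<forall>t\<in>set (map T Es). admissible_tree t" using T Es(1) by auto
  moreover have "finite (\<Union>\<F>)" using node.hyps(1) fin by blast
  ultimately have "admissible_tree ?t" using ns U adm by (simp del: map_map set_map)
  moreover have "\<exists>k\<in>\<Union>\<F>. q = m + l' k" if "(E, q) \<in> set (terminals m ?t)" for m E q
  proof -
    from that ne obtain F where F: "F \<in> ?G" "(E, q) \<in> set (terminals (Suc m) (T F))" using Es(1) by auto
    then obtain k where "k \<in> F" "q = Suc m + l k" using T by blast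
    moreover have "l' k = Suc (l k)" using low F \<open>k \<in> F\<close> by blast
    ultimately have "k \<in> \<Union>\<F>" "q = m + l' k" using F(1) by auto
    then show ?thesis by blast
  qed
  moreover have "(\<Sum>(E, q)\<leftarrow>terminals m ?t. (1/2) ^ q * sup_norm (restr E x)) = (1/2) ^ m * wt (\<Union>\<F>) l' x"
    if x: "x 0 = 0" for m x
  proof -
    let ?g = "\<lambda>(E, q). (1/2::real) ^ q * sup_norm (restr E x)"
    have "(\<Sum>p\<leftarrow>terminals m ?t. ?g p) = (\<Sum>F\<leftarrow>Es. \<Sum>p\<leftarrow>terminals (Suc m) (T F). ?g p)"
    proof -
      have "(\<Sum>p\<leftarrow>concat (map (terminals (Suc m) \<circ> T) us). ?g p) = (\<Sum>F\<leftarrow>us. \<Sum>p\<leftarrow>terminals (Suc m) (T F). ?g p)" for us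
        by (induction us) auto
      then show ?thesis using ne by simp
    qed
    also have "\<dots> = (\<Sum>F\<in>set Es. \<Sum>p\<leftarrow>terminals (Suc m) (T F). ?g p)"
      by (rule sum_list_distinct_conv_sum_set[OF Es(2)])
    also have "\<dots> = (\<Sum>F\<in>set Es. (1/2) ^ m * wt F l' x)"
    proof (rule sum.cong[OF refl])
      fix F assume "F \<in> set Es"
      then have F: "F \<in> ?G" using Es(1) by simp
      have "wt F l' x = 1/2 * wt F l x" using low(2) F by (intro wt_Suc) auto
      then show "(\<Sum>p\<leftarrow>terminals (Suc m) (T F). ?g p) = (1/2) ^ m * wt F l' x" using T[OF F] x by simp
    qed
    also have "\<dots> = (1/2) ^ m * wt (\<Union>F\<in>set Es. F) l' x"
    proof (subst wt_UN)
      fix F F' assume "F \<in> set Es" "F' \<in> set Es" "F \<noteq> F'"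
      then show "F \<inter> F' = {}" using node.hyps(2) Es(1) by (intro sep_disjoint) (auto simp: pairwise_def)
    next
      show "finite (set Es)" by simp
      show "\<And>F. F \<in> set Es \<Longrightarrow> finite F" using fin Es(1) by blast
      show "(\<Sum>F\<in>set Es. (1/2) ^ m * wt F l' x) = (1/2) ^ m * (\<Sum>F\<in>set Es. wt F l' x)"
        by (simp add: sum_distrib_left)
    qed
    finally show ?thesis using U by simp
  qed
  ultimately show ?case by (intro exI[of _ ?t]) auto
qed

section \<open>The norms as suprema over leaf systems\<close>

lemma wt_le_norm:
  assumes "tree_adm F l" shows "wt F l (coord x) \<le> norm x"
proof (cases "F = {}")
  case False
  obtain t where t: "admissible_tree t" 
    "\<And>m x. x 0 = 0 \<Longrightarrow> (\<Sum>(E, q)\<leftarrow>terminals m t. (1/2) ^ q * sup_norm (restr E x)) = (1/2) ^ m * wt F l x"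
    using adm_terminals[OF assms False] by blast
  then show ?thesis using tree_sum_le_norm[OF t(1), of x] t(2)[of "coord x" 0] tset_zero[OF coord_tset] by simp
qed simp

text \<open>Since \<open>j < n\<close>, the congruence in \<open>lev\<close> makes \<open>j\<close>
  the remainder of each level, so the level has the form \<open>j + n * i\<close> with a natural
  number \<open>i\<close>.\<close>

lemma wt_le_tree_norm:
  assumes "tree_adm F l" "lev n (int j) F l" "j < n" 
  shows "wt F l (coord x) \<le> tree_norm j n x"
proof -
  have up: "(\<Sum>(E, q)\<leftarrow>terminals 0 t. (1/2) ^ q * sup_norm (restr E (coord x))) \<le> tree_norm j n x"
    if "t \<in> level_trees j n" for t
    unfolding tree_norm_def by (rule cSUP_upper[OF that tree_norm_bdd])
  show ?thesis
  proof (cases "F = {}")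
    case False
    obtain t where t: "admissible_tree t" 
      "\<And>m E q. (E, q) \<in> set (terminals m t) \<Longrightarrow> \<exists>k\<in>F. q = m + l k"
      "\<And>m x. x 0 = 0 \<Longrightarrow> (\<Sum>(E, q)\<leftarrow>terminals m t. (1/2) ^ q * sup_norm (restr E x)) = (1/2) ^ m * wt F l x"
      using adm_terminals[OF assms(1) False] by blast
    have sum: "(\<Sum>(E, q)\<leftarrow>terminals 0 t. (1/2) ^ q * sup_norm (restr E (coord x))) = wt F l (coord x)"
      using t(3)[of "coord x" 0] tset_zero[OF coord_tset] by simp
    have "\<exists>i. q = j + n * i" if "(E, q) \<in> set (terminals 0 t)" for E q
    proof -
      obtain k where k: "k \<in> F" "q = l k" using t(2)[OF \<open>(E, q) \<in> set (terminals 0 t)\<close>] by auto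
      then have "int n dvd int j - int q" using assms(2) by (auto simp: lev_def)
      then have "int j mod int n = int q mod int n" by (simp add: mod_eq_dvd_iff)
      then have "q mod n = j" using assms(3) by (simp flip: zmod_int)
      then have "q = j + n * (q div n)" using mod_mult_div_eq[of q n] by simp
      then show ?thesis by blast
    qed
    then have "t \<in> level_trees j n" using t(1) by (auto simp: level_trees_def)
    from up[OF this] show ?thesis using sum by simp
  next
    case True
    \<comment> \<open>No tree is built for the empty leaf system; there the claim is nonnegativity
      of the norm.\<close>
    have nn: "0 \<le> tree_norm j n x"
    proof -
      obtain t where t: "t \<in> level_trees j n" using level_trees_nonempty by blast
      then have "admissible_tree t" by (simp add: level_trees_def)
      from terminals_adm[where x = "coord x", OF tset_zero[OF coord_tset] this, of 0] obtain F l where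
        "(\<Sum>(E, q)\<leftarrow>terminals 0 t. (1/2) ^ q * sup_norm (restr E (coord x))) = wt F l (coord x)" by auto
      then show ?thesis using up[OF t] wt_nonneg[of F l "coord x"] by simp
    qed
    then show ?thesis using True by simp
  qed
qed

text \<open>Together with \<open>wt_le_tree_norm\<close> this identifies
  \<open>tree_norm j n\<close> for \<open>j < n\<close> as a supremum of \<open>wt\<close> over leaf
  systems.\<close>

lemma tree_norm_least:
  assumes "\<And>F l. tree_adm F l \<Longrightarrow> lev n (int j) F l \<Longrightarrow> wt F l (coord x) \<le> B"
  shows "tree_norm j n x \<le> B"
  unfolding tree_norm_def
proof (rule cSUP_least[OF level_trees_nonempty])
  fix t assume t: "t \<in> level_trees j n"
  then have "admissible_tree t" by (simp add: level_trees_def)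
  from terminals_adm[where x = "coord x", OF tset_zero[OF coord_tset] this, of 0] obtain F l where
    Fl: "tree_adm F l" "\<And>k. k \<in> F \<Longrightarrow> \<exists>E. (E, l k) \<in> set (terminals 0 t)"
     "(\<Sum>(E, q)\<leftarrow>terminals 0 t. (1/2) ^ q * sup_norm (restr E (coord x))) = wt F l (coord x)" by auto
  have "lev n (int j) F l" unfolding lev_def
  proof
    fix k assume "k \<in> F"
    then obtain E where "(E, l k) \<in> set (terminals 0 t)" using Fl(2) by blast
    then obtain i where "l k = j + n * i" using t unfolding level_trees_def by fast
    then show "int n dvd int j - int (l k)" by simp
  qed
  then show "(\<Sum>(E, q)\<leftarrow>terminals 0 t. (1/2) ^ q * sup_norm (restr E (coord x))) \<le> B"
    using assms Fl by simp
qed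

text \<open>Each unfolding of the implicit equation adds one level: choose a nearly optimal
  admissible family, apply induction inside its members, and join the resulting systems by
  \<open>admissible_adm\<close>.\<close>

lemma approx_norm_wt:
  assumes "x \<in> c00" "0 < \<epsilon>"
  shows "\<exists>F l. tree_adm F l \<and> approx_norm m x \<le> wt F l x + \<epsilon>"
  using assms
proof (induction m arbitrary: x \<epsilon>)
  have sup: "\<exists>F l. tree_adm F l \<and> sup_norm x \<le> wt F l x + \<epsilon>" if x: "x \<in> c00" and "0 < \<epsilon>" for x \<epsilon>
  proof -
    have "sup_norm x - \<epsilon> < (SUP i. \<bar>x i\<bar>)" using that by (simp add: sup_norm_def)
    then obtain k where k: "sup_norm x - \<epsilon> < \<bar>x k\<bar>"
      using less_cSUP_iff[OF _ sup_norm_bdd[OF x], of "sup_norm x - \<epsilon>"] by auto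
    show ?thesis
    proof (cases "k = 0")
      case True
      then show ?thesis using k that by (intro exI[of _ "{}"]) (auto simp: c00_D)
    next
      case False
      then show ?thesis using k 
        by (intro exI[of _ "{k}"] exI[of _ "\<lambda>_. 0"]) (auto simp: wt_def intro!: adm.single)
    qed
  qed
  {
    case 0 then show ?case using sup by simp
  next
    case (Suc m)
    let ?S = "SUP Es\<in>{Es. admissible 1 Es}. 1/2 * (\<Sum>E\<leftarrow>Es. approx_norm m (restr E x))"
    show ?case
    proof (cases "?S \<le> sup_norm x")
      case True
      then show ?thesis using sup[OF Suc.prems] by simp
    next
      case False
      have "?S - \<epsilon>/2 < ?S" using Suc.prems by simp
      then obtain Es where Es: "admissible 1 Es" "?S - \<epsilon>/2 < 1/2 * (\<Sum>E\<leftarrow>Es. approx_norm m (restr E x))"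
        using iffD1[OF less_cSUP_iff[OF admissible_ne 
            half_sum_bdd[where N = "approx_norm m", OF Suc.prems(1) approx_norm_le_l1]], of "?S - \<epsilon>/2"] 
        by blast
      have ne: "length Es > 0" using Es(1) by (auto simp: admissible_def)
      \<comment> \<open>After the factor \<open>1/2\<close> the errors of the children add up to
        \<open>\<epsilon>/2\<close>; the other half is spent on the near optimality of
        \<open>Es\<close>.\<close>
      let ?e = "\<epsilon> / length Es"
      have "?e > 0" using ne Suc.prems by simp
      then have "\<exists>F l. tree_adm F l \<and> approx_norm m (restr E x) \<le> wt F l (restr E x) + ?e" for E
        using Suc.prems by (intro Suc.IH restr_c00)
      then obtain F l where Fl: "\<And>E. tree_adm (F E) (l E)" 
        "\<And>E. approx_norm m (restr E x) \<le> wt (F E) (l E) (restr E x) + ?e" by metis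
      \<comment> \<open>Leaves outside \<open>Es ! i\<close> see only zeros of the restricted
        vector, and removing them makes the children separated.\<close>
      define G where "G i = F (Es ! i) \<inter> Es ! i" for i
      obtain l' where l': "tree_adm (\<Union>i<length Es. G i) l'"
        "wt (\<Union>i<length Es. G i) l' x = 1/2 * (\<Sum>i<length Es. wt (G i) (l (Es ! i)) x)"
        using admissible_adm[OF Es(1), of G "\<lambda>i. l (Es ! i)"] adm_subset[OF Fl(1), of "G _" "Es ! _"]
        by (auto simp: G_def)
      have "(\<Sum>E\<leftarrow>Es. approx_norm m (restr E x)) = (\<Sum>i<length Es. approx_norm m (restr (Es ! i) x))"
        by (simp add: sum_list_sum_nth atLeast0LessThan)
      also have "\<dots> \<le> (\<Sum>i<length Es. wt (G i) (l (Es ! i)) x + ?e)"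
        using Fl(2) adm_finite[OF Fl(1)] by (intro sum_mono) (simp add: G_def wt_restr)
      also have "\<dots> = 2 * wt (\<Union>i<length Es. G i) l' x + \<epsilon>" 
        unfolding l'(2) using ne by (simp add: sum.distrib)
      finally have "?S \<le> wt (\<Union>i<length Es. G i) l' x + \<epsilon>" using Es(2) by linarith
      then have "approx_norm (Suc m) x \<le> wt (\<Union>i<length Es. G i) l' x + \<epsilon>" using False by simp
      then show ?thesis using l'(1) by blast
    qed
  }
qed

text \<open>The norm is the limit of the iterates \<open>approx_norm m\<close>, which leaf systems
  nearly attain. With \<open>wt_le_norm\<close>, the Tsirelson norm is the supremum of
  \<open>wt\<close> over all leaf systems.\<close>

lemma norm_least:
  assumes "\<And>F l. tree_adm F l \<Longrightarrow> wt F l (coord x) \<le> B"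
  shows "norm x \<le> B"
proof (rule norm_tsirelson_least)
  fix n
  let ?x = "restr {..n} (coord x)"
  have c: "?x \<in> c00" by (rule coord_fin) simp
  show "tsirelson_norm ?x \<le> B"
    unfolding tsirelson_norm_eq_limit_norm
  proof (rule limit_norm_least[OF c], rule field_le_epsilon)
    fix m and \<epsilon> :: real assume "0 < \<epsilon>"
    then obtain F l where Fl: "tree_adm F l" "approx_norm m ?x \<le> wt F l ?x + \<epsilon>"
      using approx_norm_wt[OF c] by blast
    have "wt F l ?x \<le> wt F l (coord x)" 
      using adm_finite[OF Fl(1)] by (simp add: wt_restr wt_mono)
    then show "approx_norm m ?x \<le> B + \<epsilon>" using assms[OF Fl(1)] Fl(2) by linarith
  qed
qed

section \<open>Norms of combinations of sparse blocks\<close>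

text \<open>A lower bound comes with a leaf system that witnesses it, because grafting needs the
  system itself and not only a supremum.\<close>

definition lowb :: "nat \<Rightarrow> int \<Rightarrow> (nat \<Rightarrow> real) \<Rightarrow> real \<Rightarrow> bool" where
  "lowb n r x c \<longleftrightarrow> (\<exists>G g. tree_adm G g \<and> lev n r G g \<and> c \<le> wt G g x)"

definition uppb :: "nat \<Rightarrow> int \<Rightarrow> (nat \<Rightarrow> real) \<Rightarrow> real \<Rightarrow> bool" where
  "uppb n r x c \<longleftrightarrow> (\<forall>G g. tree_adm G g \<longrightarrow> lev n r G g \<longrightarrow> wt G g x \<le> c)"

lemma uppb_nonneg: "uppb n r x c \<Longrightarrow> 0 \<le> c"
  unfolding uppb_def using adm_empty[of "\<lambda>k. k" id] by (metis lev_def empty_iff wt_empty)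

text \<open>Applied to the numbers of the blocks that a node meets: a block strictly between two
  others is out of reach of every separated sibling of the node.\<close>

definition nonextremal :: "nat set \<Rightarrow> nat set" where
  "nonextremal K = {k \<in> K. (\<exists>k1\<in>K. k1 < k) \<and> (\<exists>k2\<in>K. k < k2)}"

lemma nonextremal_cases:
  assumes "finite K" "k \<in> K" "k \<notin> nonextremal K" shows "k = Min K \<or> k = Max K"
proof (rule ccontr)
  assume "\<not> ?thesis"
  then have "Min K < k" "k < Max K" using Min_le[OF assms(1,2)] Max_ge[OF assms(1,2)] by auto
  moreover have "Min K \<in> K" "Max K \<in> K" using assms by (auto intro: Min_in Max_in)
  ultimately show False using assms by (auto simp: nonextremal_def)
qed

text \<open>\<open>\<kappa> i\<close> is the number of the block that coordinate \<open>i\<close> belongs to. The factor \<open>3\<close> pays for the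
  blocks which a node of a tree only meets partially: each successor of the node produces at most two
  of them.\<close>

locale sparse_blocks =
  fixes u :: "nat \<Rightarrow> nat \<Rightarrow> real" and p :: "nat \<Rightarrow> nat" and \<kappa> :: "nat \<Rightarrow> nat"
  assumes mono_\<kappa>: "mono \<kappa>" and mono_p: "mono p" and p_pos: "1 \<le> p k"
    and supp: "u k i \<noteq> 0 \<Longrightarrow> \<kappa> i = k \<and> p k \<le> i"
    and gap: "\<kappa> i < k \<Longrightarrow> 3 * i \<le> p k"
begin

text \<open>This is \<open>\<Sum>k. a k * u k\<close>: at coordinate \<open>i\<close> only the block
  numbered \<open>\<kappa> i\<close> can be nonzero.\<close>

definition comb :: "(nat \<Rightarrow> real) \<Rightarrow> nat \<Rightarrow> real" where
  "comb a i = a (\<kappa> i) * u (\<kappa> i) i"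

lemma \<kappa>_less: "\<kappa> i < \<kappa> j \<Longrightarrow> i < j"
  using monoD[OF mono_\<kappa>, of j i] by (meson leD leI)

lemma wt_comb:
  assumes "finite G"
  shows "wt G g (comb a) = (\<Sum>k\<in>\<kappa> ` G. \<bar>a k\<bar> * wt (G \<inter> \<kappa> -` {k}) g (u k))"
proof -
  have "wt G g (comb a) = (\<Sum>k\<in>\<kappa> ` G. \<Sum>i\<in>{i\<in>G. \<kappa> i = k}. (1/2) ^ g i * \<bar>comb a i\<bar>)"
    unfolding wt_def by (rule sum.image_gen[OF assms])
  also have "\<dots> = (\<Sum>k\<in>\<kappa> ` G. \<bar>a k\<bar> * wt (G \<inter> \<kappa> -` {k}) g (u k))"
  proof (rule sum.cong[OF refl])
    fix k
    have "(\<Sum>i\<in>{i\<in>G. \<kappa> i = k}. (1/2) ^ g i * \<bar>comb a i\<bar>) = 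
       (\<Sum>i\<in>G \<inter> \<kappa> -` {k}. \<bar>a k\<bar> * ((1/2) ^ g i * \<bar>u k i\<bar>))"
      by (rule sum.cong) (auto simp: comb_def abs_mult)
    then show "(\<Sum>i\<in>{i\<in>G. \<kappa> i = k}. (1/2) ^ g i * \<bar>comb a i\<bar>) = \<bar>a k\<bar> * wt (G \<inter> \<kappa> -` {k}) g (u k)"
      by (simp add: wt_def sum_distrib_left)
  qed
  finally show ?thesis .
qed

text \<open>Grafting at the leaves: leaf \<open>k\<close> is replaced by a tree on coordinates of
  block \<open>k\<close>. Bounds read at \<open>p k\<close> remain valid at \<open>i\<close> because
  \<open>p k \<le> i\<close>, and separation of block numbers passes to coordinates by monotonicity
  of \<open>\<kappa>\<close>.\<close>

lemma adm_substitute: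
  assumes "adm p F l" 
    and "\<And>k. k \<in> F \<Longrightarrow> tree_adm (G k) (g k)"
    and "\<And>k i. k \<in> F \<Longrightarrow> i \<in> G k \<Longrightarrow> \<kappa> i = k \<and> p k \<le> i"
    and "\<And>k i. k \<in> F \<Longrightarrow> i \<in> G k \<Longrightarrow> l' i = l k + g k i"
  shows "tree_adm (\<Union>k\<in>F. G k) l'"
  using assms
proof (induction arbitrary: l' rule: adm.induct)
  case (single l k)
  have "tree_adm (G k) l'" by (rule adm_cong[OF single.prems(1)[of k]]) (use single in auto)
  then show ?case by simp
next
  case (node \<F> l l1)
  have "tree_adm (\<Union>F\<in>\<F>. \<Union>k\<in>F. G k) l'"
  proof (rule adm_nodeI[where l = "\<lambda>_ i. l' i - 1"])
    fix F F' assume F: "F \<in> \<F>" "F' \<in> \<F>" "F \<noteq> F'"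
    then have "sep F F'" using node.hyps(2) by (auto simp: pairwise_def)
    then show "sep (\<Union>k\<in>F. G k) (\<Union>k\<in>F'. G k)"
      unfolding sep_def using node.prems(2) F \<kappa>_less by (smt (verit) UN_E UnionI)
  next
    fix F assume F: "F \<in> \<F>"
    show "tree_adm (\<Union>k\<in>F. G k) (\<lambda>i. l' i - 1)"
    proof (rule node.IH[rule_format, OF F, THEN conjunct2, rule_format])
      fix k i assume "k \<in> F" "i \<in> G k"
      then have "l' i = l1 k + g k i" "l1 k = Suc (l k)" using node.prems(3) node.hyps(3) F by blast+
      then show "l' i - 1 = l k + g k i" by simp
    qed (use node.prems F in blast)+
  next
    fix F i assume F: "F \<in> \<F>" and "i \<in> (\<Union>k\<in>F. G k)"
    then obtain k where k: "k \<in> F" "i \<in> G k" by blast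
    then have "card \<F> \<le> p k" "l1 k = Suc (l k)" "p k \<le> i" "l' i = l1 k + g k i" 
      using node.hyps(3) node.prems(2,3) F by blast+
    then show "card \<F> \<le> i" "l' i = Suc (l' i - 1)" by auto
  qed (rule node.hyps)
  then show ?case by simp
qed

text \<open>Graft a witness for \<open>u k\<close> with residue \<open>r - int (l k)\<close> onto
  each leaf \<open>k\<close>. Levels add up to the residue \<open>r\<close>, and weights
  multiply.\<close>

lemma lower_estimate:
  assumes F: "adm p F l" and e: "\<And>k. k \<in> F \<Longrightarrow> lowb n (r - int (l k)) (u k) (e k)"
  shows "lowb n r (comb a) (\<Sum>k\<in>F. (1/2) ^ l k * e k * \<bar>a k\<bar>)"
proof -
  have "\<forall>k\<in>F. \<exists>G g. tree_adm G g \<and> lev n (r - int (l k)) G g \<and> e k \<le> wt G g (u k)"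
    using e by (auto simp: lowb_def)
  then obtain G' g where G': "\<And>k. k \<in> F \<Longrightarrow> tree_adm (G' k) (g k)" 
    "\<And>k. k \<in> F \<Longrightarrow> lev n (r - int (l k)) (G' k) (g k)" "\<And>k. k \<in> F \<Longrightarrow> e k \<le> wt (G' k) (g k) (u k)"
    by metis
  \<comment> \<open>Cutting down to the support keeps the value and places \<open>G k\<close> inside
    block \<open>k\<close>, at or after \<open>p k\<close>.\<close>
  define G where "G k = G' k \<inter> {i. u k i \<noteq> 0}" for k
  define h where "h i = l (\<kappa> i) + g (\<kappa> i) i" for i
  let ?G = "\<Union>k\<in>F. G k"
  have G: "tree_adm (G k) (g k)" "lev n (r - int (l k)) (G k) (g k)" if "k \<in> F" for k
    using G' that by (auto simp: G_def intro: adm_subset lev_subset)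
  have ki: "\<kappa> i = k \<and> p k \<le> i" if "i \<in> G k" for i k using that supp by (auto simp: G_def)
  have wG: "wt (G k) (g k) (u k) = wt (G' k) (g k) (u k)" if "k \<in> F" for k
    unfolding wt_def G_def using adm_finite[OF G'(1)[OF that]] by (intro sum.mono_neutral_left) auto
  have adm: "tree_adm ?G h"
    by (rule adm_substitute[OF F G(1)]) (use ki in \<open>auto simp: h_def\<close>)
  have "lev n r ?G h" unfolding lev_def
  proof
    fix i assume "i \<in> ?G"
    then obtain k where k: "k \<in> F" "i \<in> G k" by blast
    then have "int n dvd r - int (l k) - int (g k i)" using G(2) by (auto simp: lev_def)
    then show "int n dvd r - int (h i)" using ki[OF k(2)] by (simp add: h_def algebra_simps)
  qed
  moreover have "(\<Sum>k\<in>F. (1/2) ^ l k * e k * \<bar>a k\<bar>) \<le> wt ?G h (comb a)"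
  proof -
    have fin: "finite (G k)" if "k \<in> F" for k using G(1)[OF that] by (rule adm_finite)
    have "wt ?G h (comb a) = (\<Sum>k\<in>F. wt (G k) h (comb a))"
      using adm_finite[OF F] fin ki by (intro wt_UN) blast+
    also have "\<dots> = (\<Sum>k\<in>F. (1/2) ^ l k * wt (G k) (g k) (u k) * \<bar>a k\<bar>)"
    proof (rule sum.cong[OF refl])
      fix k 
      have "wt (G k) h (comb a) = (\<Sum>i\<in>G k. (1/2) ^ l k * ((1/2) ^ g k i * \<bar>u k i\<bar>) * \<bar>a k\<bar>)"
        unfolding wt_def
        by (rule sum.cong) (use ki in \<open>auto simp: h_def comb_def power_add abs_mult\<close>)
      then show "wt (G k) h (comb a) = (1/2) ^ l k * wt (G k) (g k) (u k) * \<bar>a k\<bar>"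
        by (simp add: wt_def sum_distrib_left sum_distrib_right)
    qed
    also have "\<dots> \<ge> (\<Sum>k\<in>F. (1/2) ^ l k * e k * \<bar>a k\<bar>)"
      using G'(3) wG by (intro sum_mono mult_right_mono mult_left_mono) auto
    finally show ?thesis .
  qed
  ultimately show ?thesis unfolding lowb_def using adm by blast
qed

text \<open>Induction reads a tree on coordinates as a tree on block numbers. Blocks inner to a
  child are handled by that child; the other inner blocks of the node become leaves attached to it
  directly. Leaves sit at level \<open>Suc (l k)\<close> although the weight is
  \<open>(1/2) ^ l k\<close>: a left-over block is bounded as a whole by \<open>D\<close> at the
  node, but becomes a leaf one level below.\<close>

lemma upper_estimate_inner:
  assumes "tree_adm G g" "lev n r G g" and D: "\<And>k r. uppb n r (u k) (D r)"
  shows "\<exists>l. adm p (nonextremal (\<kappa> ` G)) (\<lambda>k. Suc (l k)) \<and>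
     (\<forall>k\<in>nonextremal (\<kappa> ` G). wt (G \<inter> \<kappa> -` {k}) g (u k) \<le> (1/2) ^ l k * D (r - int (l k)))"
  using assms(1,2)
proof (induction arbitrary: r rule: adm.induct)
  case (single g i)
  have "nonextremal (\<kappa> ` {i}) = {}" by (simp add: nonextremal_def)
  then show ?case by simp
next
  case (node \<G> g g1)
  have admH: "tree_adm H g" if "H \<in> \<G>" for H using node.IH that by blast
  have finH: "finite H" if "H \<in> \<G>" for H using adm_finite[OF admH[OF that]] .
  have g1: "g1 i = Suc (g i)" "card \<G> \<le> i" if "i \<in> H" "H \<in> \<G>" for i H 
    using node.hyps(3) that by blast+
  have admG: "tree_adm (\<Union>\<G>) g1" by (rule adm.node[OF node.hyps(1,2) _ node.hyps(3)]) (use admH in blast)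
  have levH: "lev n (r - 1) H g" if "H \<in> \<G>" for H
    unfolding lev_def
  proof
    fix i assume "i \<in> H"
    then have "int n dvd r - int (g1 i)" using node.prems that by (auto simp: lev_def)
    then show "int n dvd r - 1 - int (g i)" using g1(1)[OF \<open>i \<in> H\<close> that] by (simp add: algebra_simps)
  qed
  have sepH: "sep H H'" if "H \<in> \<G>" "H' \<in> \<G>" "H \<noteq> H'" for H H'
    using node.hyps(2) that by (auto simp: pairwise_def)
  define J where "J H = nonextremal (\<kappa> ` H)" for H
  let ?K = "\<kappa> ` (\<Union>\<G>)"
  have "\<forall>H\<in>\<G>. \<exists>l. adm p (J H) (\<lambda>k. Suc (l k)) \<and>
     (\<forall>k\<in>J H. wt (H \<inter> \<kappa> -` {k}) g (u k) \<le> (1/2) ^ l k * D (r - 1 - int (l k)))"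
    using node.IH levH unfolding J_def by blast
  then obtain L where L: "\<And>H. H \<in> \<G> \<Longrightarrow> adm p (J H) (\<lambda>k. Suc (L H k))"
     "\<And>H k. H \<in> \<G> \<Longrightarrow> k \<in> J H \<Longrightarrow> wt (H \<inter> \<kappa> -` {k}) g (u k) \<le> (1/2) ^ L H k * D (r - 1 - int (L H k))"
    by metis
  \<comment> \<open>A point of \<open>H'\<close> whose block lies strictly between two blocks met by
    \<open>H\<close> lies between two points of \<open>H\<close>, which separation allows only for
    \<open>H' = H\<close>.\<close>
  have only: "H' = H" if "H \<in> \<G>" "H' \<in> \<G>" "i1 \<in> H" "i2 \<in> H" "i \<in> H'" "\<kappa> i1 < \<kappa> i" "\<kappa> i < \<kappa> i2" 
    for H H' i i1 i2
  proof (rule ccontr)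
    assume "H' \<noteq> H"
    then have "sep H H'" using sepH that by blast
    moreover have "i1 < i" "i < i2" using that \<kappa>_less by blast+
    ultimately show False using that unfolding sep_def by (meson less_asym)
  qed
  have fib: "\<Union>\<G> \<inter> \<kappa> -` {k} = H \<inter> \<kappa> -` {k}" if H: "H \<in> \<G>" and k: "k \<in> J H" for H k
  proof -
    obtain i1 i2 where i: "i1 \<in> H" "i2 \<in> H" "\<kappa> i1 < k" "k < \<kappa> i2"
      using k by (auto simp: J_def nonextremal_def)
    have "H' = H" if "H' \<in> \<G>" "i \<in> H'" "\<kappa> i = k" for H' i
      using only[OF H that(1) i(1,2) that(2)] i that(3) by simp
    then show ?thesis using H by blast
  qed
  have uniq: "H' = H" if H: "H \<in> \<G>" and k: "k \<in> J H" and H': "H' \<in> \<G>" and k': "k \<in> J H'" for H H' k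
  proof -
    obtain i1 i2 where i: "i1 \<in> H" "i2 \<in> H" "\<kappa> i1 < k" "k < \<kappa> i2"
      using k by (auto simp: J_def nonextremal_def)
    obtain i' where "i' \<in> H'" "\<kappa> i' = k" using k' by (auto simp: J_def nonextremal_def)
    then show ?thesis using only[OF H H' i(1,2)] i by simp
  qed
  have convex: "k \<in> J H" if c: "H \<in> \<G>" "k \<in> ?K" "k1 \<in> J H" "k2 \<in> J H" "k1 < k" "k < k2" for H k k1 k2
  proof -
    have "k1 \<in> \<kappa> ` H" "k2 \<in> \<kappa> ` H" using c(3,4) by (simp_all add: J_def nonextremal_def)
    then obtain i1 i2 where i: "i1 \<in> H" "i2 \<in> H" "\<kappa> i1 = k1" "\<kappa> i2 = k2" by blast
    obtain i H' where "i \<in> H'" "H' \<in> \<G>" "\<kappa> i = k" using c(2) by auto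
    then have "i \<in> H" using only[OF c(1) \<open>H' \<in> \<G>\<close> i(1,2) \<open>i \<in> H'\<close>] i c(5,6) by simp
    then have "k \<in> \<kappa> ` H" "k1 \<in> \<kappa> ` H" "k2 \<in> \<kappa> ` H" using \<open>\<kappa> i = k\<close> i by auto
    then show ?thesis using c(5,6) by (auto simp: J_def nonextremal_def)
  qed
  have JK: "J H \<subseteq> nonextremal ?K" if "H \<in> \<G>" for H
    using that by (fastforce simp: J_def nonextremal_def)
  \<comment> \<open>The left-over blocks: each is the first or the last block of some child, so
    there are at most two per child.\<close>
  define B where "B = nonextremal ?K - (\<Union>H\<in>\<G>. J H)"
  define l where "l k = (if \<exists>H\<in>\<G>. k \<in> J H then Suc (L (SOME H. H \<in> \<G> \<and> k \<in> J H) k) else 0)" for k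
  have l_J: "l k = Suc (L H k)" if "H \<in> \<G>" "k \<in> J H" for H k
  proof -
    have "(SOME H. H \<in> \<G> \<and> k \<in> J H) = H" using that uniq by (intro some_equality) blast+
    then show ?thesis using that by (auto simp: l_def)
  qed
  have l_B: "l k = 0" if "k \<in> B" for k using that by (auto simp: l_def B_def)
  let ?F = "J ` \<G> \<union> (\<lambda>k. {k}) ` B"
  have finK: "finite ?K" using node.hyps(1) finH by blast
  have finB: "finite B" unfolding B_def nonextremal_def using finK by simp
  have cardB: "card B \<le> 2 * card \<G>"
  proof -
    have "B \<subseteq> (\<lambda>H. Min (\<kappa> ` H)) ` \<G> \<union> (\<lambda>H. Max (\<kappa> ` H)) ` \<G>"
    proof
      fix k assume k: "k \<in> B"
      then obtain H where H: "H \<in> \<G>" "k \<in> \<kappa> ` H" by (auto simp: B_def nonextremal_def)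
      then have "k \<notin> nonextremal (\<kappa> ` H)" using k by (auto simp: B_def J_def)
      then have "k = Min (\<kappa> ` H) \<or> k = Max (\<kappa> ` H)" using H finH by (intro nonextremal_cases) auto
      then show "k \<in> (\<lambda>H. Min (\<kappa> ` H)) ` \<G> \<union> (\<lambda>H. Max (\<kappa> ` H)) ` \<G>" using H by blast
    qed
    then have "card B \<le> card ((\<lambda>H. Min (\<kappa> ` H)) ` \<G> \<union> (\<lambda>H. Max (\<kappa> ` H)) ` \<G>)"
      using node.hyps(1) by (intro card_mono) auto
    also have "\<dots> \<le> card ((\<lambda>H. Min (\<kappa> ` H)) ` \<G>) + card ((\<lambda>H. Max (\<kappa> ` H)) ` \<G>)" by (rule card_Un_le)
    also have "\<dots> \<le> card \<G> + card \<G>" by (intro add_mono card_image_le node.hyps(1))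
    finally show ?thesis by simp
  qed
  have cardF: "card ?F \<le> 3 * card \<G>"
  proof -
    have "card ?F \<le> card (J ` \<G>) + card ((\<lambda>k. {k}) ` B)" by (rule card_Un_le)
    also have "\<dots> \<le> card \<G> + card B" by (intro add_mono card_image_le node.hyps(1) finB)
    finally show ?thesis using cardB by simp
  qed
  have UF: "\<Union>?F = nonextremal ?K" using JK by (auto simp: B_def)
  have "adm p (\<Union>?F) (\<lambda>k. Suc (l k))"
  proof (rule adm.node[where l = l])
    show "finite ?F" using node.hyps(1) finB by simp
    show "pairwise sep ?F"
    proof -
      have 1: "sep (J H) (J H')" if H: "H \<in> \<G>" "H' \<in> \<G>" "J H \<noteq> J H'" for H H'
      proof -
        \<comment> \<open>\<open>H\<close> and \<open>H'\<close> may share a block; passing to inner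
          blocks on both sides restores the strict order.\<close>
        have aux: "\<forall>k\<in>J H. \<forall>k'\<in>J H'. k < k'" if lt: "\<forall>i\<in>H. \<forall>i'\<in>H'. i < i'" for H H'
        proof (intro ballI)
          fix k k' assume k: "k \<in> J H" "k' \<in> J H'"
          then obtain i i' where i: "i \<in> H" "k < \<kappa> i" "i' \<in> H'" "\<kappa> i' < k'" 
            by (auto simp: J_def nonextremal_def)
          have "\<kappa> i \<le> \<kappa> i'" using lt i monoD[OF mono_\<kappa>, of i i'] by (simp add: less_imp_le)
          then show "k < k'" using i by simp
        qed
        have "sep H H'" using sepH H by blast
        then show ?thesis using aux[of H H'] aux[of H' H] unfolding sep_def by blast
      qed
      have 2: "sep (J H) {k}" if "H \<in> \<G>" "k \<in> B" for H k
      proof -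
        have "k \<in> ?K" "k \<notin> J H" using that by (auto simp: B_def nonextremal_def)
        then have "\<not> (\<exists>k1\<in>J H. \<exists>k2\<in>J H. k1 < k \<and> k < k2)" using convex that by blast
        then show ?thesis using \<open>k \<notin> J H\<close> unfolding sep_def by (metis linorder_neqE_nat singletonD)
      qed
      have 3: "sep {k} {k'}" if "k \<noteq> k'" for k k' using that by (auto simp: sep_def)
      show ?thesis unfolding pairwise_def
        using 1 2 3 sep_sym by (smt (verit) UnE imageE)
    qed
    show "\<forall>F\<in>?F. adm p F l"
    proof
      fix F assume "F \<in> ?F"
      then consider H where "H \<in> \<G>" "F = J H" | k where "k \<in> B" "F = {k}" by blast
      then show "adm p F l"
      proof cases
        case 1 then show ?thesis using l_J by (auto intro: adm_cong[OF L(1)])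
      next
        case 2 then show ?thesis using l_B p_pos by (simp add: adm.single)
      qed
    qed
    show "\<forall>k\<in>\<Union>?F. card ?F \<le> p k \<and> Suc (l k) = Suc (l k)"
    proof (intro ballI conjI refl)
      fix k assume "k \<in> \<Union>?F"
      then have "k \<in> nonextremal ?K" unfolding UF .
      \<comment> \<open>An inner block has an earlier block met by the node. A point
        \<open>i\<close> there bounds the number of children, and \<open>gap\<close> raises this
        bound to \<open>3 * card \<G> \<le> p k\<close>.\<close>
      then obtain i H where i: "i \<in> H" "H \<in> \<G>" "\<kappa> i < k" by (auto simp: nonextremal_def)
      then have "3 * card \<G> \<le> p k" using gap[of i k] g1(2)[of i H] by simp
      then show "card ?F \<le> p k" using cardF by simp
    qed
  qed
  then have "adm p (nonextremal ?K) (\<lambda>k. Suc (l k))" unfolding UF .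
  moreover have "wt (\<Union>\<G> \<inter> \<kappa> -` {k}) g1 (u k) \<le> (1/2) ^ l k * D (r - int (l k))" if k: "k \<in> nonextremal ?K" for k
  proof (cases "k \<in> B")
    case False
    then obtain H where H: "H \<in> \<G>" "k \<in> J H" using k by (auto simp: B_def)
    have "wt (\<Union>\<G> \<inter> \<kappa> -` {k}) g1 (u k) = 1/2 * wt (H \<inter> \<kappa> -` {k}) g (u k)"
      unfolding fib[OF H] using g1(1) H by (intro wt_Suc) auto
    also have "\<dots> \<le> 1/2 * ((1/2) ^ L H k * D (r - 1 - int (L H k)))"
      using L(2)[OF H] by (rule mult_left_mono) simp
    also have "\<dots> = (1/2) ^ l k * D (r - int (l k))" by (simp add: l_J[OF H] algebra_simps)
    finally show ?thesis .
  next
    case True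
    have "wt (\<Union>\<G> \<inter> \<kappa> -` {k}) g1 (u k) \<le> D r"
      using D[of r k] adm_subset[OF admG] lev_subset[OF node.prems] unfolding uppb_def by blast
    then show ?thesis using l_B[OF True] by simp
  qed
  ultimately show ?case by blast
qed

text \<open>At most two blocks met by \<open>G\<close> are extremal, and each costs at most
  \<open>c * D r\<close>; all others are covered by \<open>upper_estimate_inner\<close>.\<close>

lemma upper_estimate:
  assumes G: "tree_adm G g" "lev n r G g" and D: "\<And>k r. uppb n r (u k) (D r)"
    and c: "\<And>k. \<bar>a k\<bar> \<le> c"
  shows "\<exists>F l. adm p F (\<lambda>k. Suc (l k)) \<and>
     wt G g (comb a) \<le> 2 * c * D r + (\<Sum>k\<in>F. (1/2) ^ l k * D (r - int (l k)) * \<bar>a k\<bar>)"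
proof -
  let ?K = "\<kappa> ` G"
  let ?w = "\<lambda>k. \<bar>a k\<bar> * wt (G \<inter> \<kappa> -` {k}) g (u k)"
  obtain l where l: "adm p (nonextremal ?K) (\<lambda>k. Suc (l k))"
    "\<And>k. k \<in> nonextremal ?K \<Longrightarrow> wt (G \<inter> \<kappa> -` {k}) g (u k) \<le> (1/2) ^ l k * D (r - int (l k))"
    using upper_estimate_inner[OF G D] by blast
  have finG: "finite G" using adm_finite[OF G(1)] .
  have Dr: "0 \<le> D r" using uppb_nonneg D by blast
  have "0 \<le> c" using c[of 0] by simp
  have rest: "?K - nonextremal ?K \<subseteq> {Min ?K, Max ?K}" using nonextremal_cases[of ?K] finG by blast
  have "wt G g (comb a) = (\<Sum>k\<in>?K. ?w k)" by (rule wt_comb[OF finG])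
  also have "\<dots> = (\<Sum>k\<in>?K - nonextremal ?K. ?w k) + (\<Sum>k\<in>nonextremal ?K. ?w k)"
    using finG by (intro sum.subset_diff) (auto simp: nonextremal_def)
  also have "(\<Sum>k\<in>?K - nonextremal ?K. ?w k) \<le> (\<Sum>k\<in>?K - nonextremal ?K. c * D r)"
  proof (rule sum_mono)
    fix k
    have "wt (G \<inter> \<kappa> -` {k}) g (u k) \<le> D r"
      using D[of r k] adm_subset[OF G(1)] lev_subset[OF G(2)] unfolding uppb_def by blast
    then show "?w k \<le> c * D r" using c \<open>0 \<le> c\<close> by (intro mult_mono) (auto simp: wt_nonneg)
  qed
  also have "\<dots> \<le> 2 * c * D r"
  proof -
    have "card (?K - nonextremal ?K) \<le> card {Min ?K, Max ?K}" using rest by (intro card_mono) auto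
    also have "\<dots> \<le> 2" by (simp add: card_insert_if)
    finally have "real (card (?K - nonextremal ?K)) * (c * D r) \<le> 2 * (c * D r)"
      using Dr \<open>0 \<le> c\<close> by (intro mult_right_mono) auto
    then show ?thesis by simp
  qed
  also have "(\<Sum>k\<in>nonextremal ?K. ?w k) \<le> (\<Sum>k\<in>nonextremal ?K. (1/2) ^ l k * D (r - int (l k)) * \<bar>a k\<bar>)"
    using l(2) by (intro sum_mono) (simp add: mult_left_mono mult.commute)
  finally show ?thesis using l(1) by auto
qed

end

section \<open>Averages of order \<open>M\<close>\<close>

text \<open>A form of the special convex combinations (repeated averages) of Schreier theory: the
  support fits at level \<open>M\<close> of one tree, while every tree captures at most mass
  \<open>\<epsilon>\<close> above that level.\<close>

definition average :: "(nat \<Rightarrow> nat) \<Rightarrow> nat \<Rightarrow> real \<Rightarrow> nat set \<Rightarrow> (nat \<Rightarrow> real) \<Rightarrow> bool" where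
  "average p M \<epsilon> A b \<longleftrightarrow> finite A \<and> (\<forall>k. 0 \<le> b k) \<and> (\<forall>k. k \<notin> A \<longrightarrow> b k = 0) \<and> sum b A = 1 \<and>
     adm p A (\<lambda>_. M) \<and> (\<forall>F l. adm p F l \<longrightarrow> sum b {k\<in>F. l k < M} \<le> \<epsilon>)"

lemma average_sum_le_1:
  assumes "average p M \<epsilon> A b" "finite F" shows "sum b F \<le> 1"
proof -
  have "sum b F = sum b (F \<inter> A)" using assms 
    by (intro sum.mono_neutral_right) (auto simp: average_def)
  also have "\<dots> \<le> sum b A" using assms by (intro sum_mono2) (auto simp: average_def)
  finally show ?thesis using assms by (simp add: average_def)
qed

text \<open>A single leaf forms a system of level \<open>0 < M\<close>, so the smallness condition
  applies to one coefficient.\<close>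

lemma average_le:
  assumes "average p M \<epsilon> A b" "0 < M" "1 \<le> p k" shows "b k \<le> \<epsilon>"
proof -
  have "adm p {k} (\<lambda>_. 0)" using assms by (intro adm.single) auto
  then have "sum b {j\<in>{k}. (0::nat) < M} \<le> \<epsilon>" using assms(1) unfolding average_def by blast
  then show ?thesis using assms(2) by (simp cong: conj_cong)
qed

text \<open>Below the top node there are at most \<open>p j\<close> children, and each captures at
  most \<open>\<delta>\<close> at its levels below \<open>M\<close>. If the tree is a single leaf,
  that leaf is \<open>j\<close>, where \<open>b\<close> vanishes.\<close>

lemma average_sum_Suc:
  assumes F: "adm p F l" "j \<in> F" and b: "average p M \<delta> A b" "j \<notin> A" and "0 \<le> \<delta>"
  shows "sum b {k\<in>F. l k < Suc M} \<le> real (p j) * \<delta>"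
  using F(1)
proof cases
  case (single k)
  then have "sum b {k\<in>F. l k < Suc M} = 0"
    using F(2) b by (intro sum.neutral) (auto simp: average_def)
  then show ?thesis using assms(5) by simp
next
  case (node \<F> l0)
  have b0: "0 \<le> b k" for k using b by (auto simp: average_def)
  have fin: "finite H" if "H \<in> \<F>" for H using node that adm_finite by blast
  have "{k\<in>F. l k < Suc M} = (\<Union>H\<in>\<F>. {k\<in>H. l0 k < M})" using node by auto
  also have "sum b \<dots> = (\<Sum>H\<in>\<F>. sum b {k\<in>H. l0 k < M})"
  proof (rule sum.UNION_disjoint)
    show "\<forall>H\<in>\<F>. \<forall>H'\<in>\<F>. H \<noteq> H' \<longrightarrow> {k\<in>H. l0 k < M} \<inter> {k\<in>H'. l0 k < M} = {}"
      using node(3) sep_disjoint unfolding pairwise_def by blast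
  qed (use node(2) fin in auto)
  also have "\<dots> \<le> (\<Sum>H\<in>\<F>. \<delta>)" using node b by (intro sum_mono) (auto simp: average_def)
  also have "\<dots> = real (card \<F>) * \<delta>" by simp
  also have "\<dots> \<le> real (p j) * \<delta>" using node F(2) assms(5) by (intro mult_right_mono) auto
  finally show ?thesis .
qed

text \<open>Used for all successive choices: the next cut point may depend on the stage and on the
  current cut point.\<close>

lemma funpow_intervals:
  fixes N :: "nat \<Rightarrow> nat \<Rightarrow> nat"
  assumes "\<And>i m. m < N i m"
  shows "\<exists>K. K 0 = k0 \<and> strict_mono K \<and> (\<forall>i. K (Suc i) = N i (K i))"
proof (intro exI conjI allI)
  let ?K = "rec_nat k0 N"
  show "strict_mono ?K" using assms by (simp add: strict_mono_Suc_iff)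
qed simp_all

lemma sep_intervals:
  assumes "strict_mono K" "i \<noteq> j" "A \<subseteq> {K i..<K (Suc i)}" "B \<subseteq> {K j..<K (Suc j)}"
  shows "sep A B"
proof -
  have "a < b" if "i < j" "a < K (Suc i)" "K j \<le> b" for i j a b :: nat
  proof -
    have "K (Suc i) \<le> K j" using assms(1) that(1) by (simp add: strict_mono_less_eq Suc_le_eq)
    then show ?thesis using that by simp
  qed
  then show ?thesis using assms(2-4) unfolding sep_def 
    by (meson atLeastLessThan_iff linorder_neqE_nat subsetD)
qed

text \<open>The average of order \<open>Suc M\<close> is the mean of \<open>L\<close> successive
  averages of order \<open>M\<close> with rapidly improving accuracy. A tree can capture the first
  average that it meets, but little of the later ones.\<close>

lemma average_exists:
  assumes p: "mono p" "\<And>N. \<exists>k. N \<le> p k" "\<And>k. 1 \<le> p k" and "0 < \<epsilon>"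
  shows "\<exists>A b. average p M \<epsilon> A b \<and> A \<subseteq> {k0..}"
  using assms(4)
proof (induction M arbitrary: k0 \<epsilon>)
  case 0
  have "average p 0 \<epsilon> {k0} (\<lambda>k. if k = k0 then 1 else 0)"
    using 0 p(3) by (auto simp: average_def intro: adm.single)
  then show ?case by blast
next
  case (Suc M)
  \<comment> \<open>With \<open>L \<ge> 2 / \<epsilon>\<close>, capturing one whole average costs at
    most \<open>\<epsilon> / 2\<close> of the mean.\<close>
  define L where "L = nat \<lceil>2 / \<epsilon>\<rceil>"
  have "2 / \<epsilon> \<le> real L" unfolding L_def by linarith
  then have L: "1 \<le> real L * (\<epsilon> / 2)" "0 < L" using Suc.prems by (auto simp: field_simps intro!: gr0I)
  \<comment> \<open>Starting this far out, \<open>L\<close> averages may be children of a single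
    node.\<close>
  obtain k1 where "L \<le> p k1" using p(2) by blast
  define k2 where "k2 = max k0 k1"
  have k2: "L \<le> p k" if "k2 \<le> k" for k 
    using \<open>L \<le> p k1\<close> monoD[OF p(1), of k1 k] that by (simp add: k2_def)
  \<comment> \<open>Chosen so that \<open>p j\<close> children capture at most
    \<open>\<epsilon> / 2\<close> of an average beginning at \<open>m\<close> when
    \<open>p j \<le> p m\<close>.\<close>
  let ?e = "\<lambda>m. \<epsilon> / (2 * real (p m))"
  have e: "0 < ?e m" for m using p(3)[of m] Suc.prems by simp
  have "\<forall>m. \<exists>A b N. average p M (?e m) A b \<and> A \<subseteq> {m..<N} \<and> m < N"
  proof
    fix m
    obtain A b where Ab: "average p M (?e m) A b" "A \<subseteq> {m..}" using Suc.IH[OF e] by blast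
    then have "finite A" by (simp add: average_def)
    then obtain N where "A \<subseteq> {..<N}" using finite_nat_iff_bounded by blast
    then show "\<exists>A b N. average p M (?e m) A b \<and> A \<subseteq> {m..<N} \<and> m < N" 
      using Ab by (intro exI[of _ A] exI[of _ b] exI[of _ "max N (Suc m)"]) fastforce
  qed
  then obtain A' b' N where *: "\<And>m. average p M (?e m) (A' m) (b' m) \<and> A' m \<subseteq> {m..<N m} \<and> m < N m" by metis
  obtain K where K: "K 0 = k2" "strict_mono K" "\<And>i. K (Suc i) = N (K i)"
    using funpow_intervals[of "\<lambda>_. N" k2] * by auto
  define A where "A i = A' (K i)" for i
  define b where "b i = b' (K i)" for i
  have avg: "average p M (?e (K i)) (A i) (b i)" and sub: "A i \<subseteq> {K i..<K (Suc i)}" for i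
    using *[of "K i"] by (auto simp: A_def b_def K(3))
  have b0: "0 \<le> b i k" for i k using avg[of i] by (simp add: average_def)
  have bA: "b i k = 0" if "k \<notin> A i" for i k using avg[of i] that by (simp add: average_def)
  have finA: "finite (A i)" for i using avg[of i] by (simp add: average_def)
  have ge: "k2 \<le> k" if "k \<in> A i" for i k
    using sub[of i] that K(1) monoD[OF strict_mono_mono[OF K(2)], of 0 i] by fastforce
  let ?A = "\<Union>i\<in>{..<L}. A i"
  let ?b = "\<lambda>k. (\<Sum>i<L. b i k) / real L"
  have sum_b: "sum ?b F = (\<Sum>i<L. sum (b i) F) / real L" for F
    by (simp add: sum_divide_distrib[symmetric] sum.swap[of _ F])
  have sumA: "sum (b i) ?A = 1" if "i < L" for i
  proof -
    have "sum (b i) ?A = sum (b i) (A i)"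
      using finA bA that by (intro sum.mono_neutral_right) auto
    then show ?thesis using avg[of i] by (simp add: average_def)
  qed
  have "average p (Suc M) \<epsilon> ?A ?b" unfolding average_def
  proof (intro conjI allI impI)
    show "finite ?A" using finA by simp
    show "0 \<le> ?b k" for k using b0 by (simp add: sum_nonneg)
    show "?b k = 0" if "k \<notin> ?A" for k using bA that by (simp add: sum.neutral)
    show "sum ?b ?A = 1" unfolding sum_b using sumA L(2) by simp
    show "adm p ?A (\<lambda>_. Suc M)"
    proof (rule adm_nodeI[where l = "\<lambda>_ _. M"])
      show "sep (A i) (A j)" if "i \<noteq> j" for i j
        by (rule sep_intervals[OF K(2) that sub sub])
      show "adm p (A i) (\<lambda>_. M)" for i using avg[of i] by (simp add: average_def)
      show "card {..<L} \<le> p k" if "k \<in> A i" for i k using k2 ge[OF that] by simp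
    qed auto
    fix F l assume F: "adm p F l"
    let ?s = "\<lambda>i. sum (b i) {k\<in>F. l k < Suc M}"
    have finF: "finite F" using adm_finite[OF F] .
    have "(\<Sum>i<L. ?s i) \<le> 1 + real L * (\<epsilon> / 2)"
    proof (cases "\<exists>i. F \<inter> A i \<noteq> {}")
      case False
      then have "?s i = 0" for i using bA by (intro sum.neutral) auto
      then show ?thesis using Suc.prems by simp
    next
      case True
      \<comment> \<open>A point of the first average met bounds the number of children of
        \<open>F\<close>, which controls every later average by
        \<open>average_sum_Suc\<close>.\<close>
      define i0 where "i0 = (LEAST i. F \<inter> A i \<noteq> {})"
      have "F \<inter> A i0 \<noteq> {}" unfolding i0_def using True by (rule LeastI_ex)
      then obtain j where j: "j \<in> F" "j \<in> A i0" by blast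
      have "?s i \<le> (if i = i0 then 1 else 0) + \<epsilon> / 2" for i
      proof -
        consider "i < i0" | "i = i0" | "i0 < i" by linarith
        then show ?thesis
        proof cases
          case 1
          then have "F \<inter> A i = {}" using not_less_Least[of i "\<lambda>i. F \<inter> A i \<noteq> {}"] by (simp add: i0_def)
          then have "?s i = 0" using bA by (intro sum.neutral) auto
          then show ?thesis using Suc.prems by simp
        next
          case 2
          have "?s i \<le> 1" using finF by (intro average_sum_le_1[OF avg]) simp
          then show ?thesis using 2 Suc.prems by simp
        next
          case 3
          then have "j \<le> K i" using sub[of i0] j(2) K(2) strict_mono_less_eq[OF K(2), of "Suc i0" i]
            by fastforce
          then have "p j \<le> p (K i)" using p(1) by (simp add: monoD)
          have "j \<notin> A i" using sep_disjoint[OF sep_intervals[OF K(2) _ sub sub], of i0 i] j(2) 3 by auto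
          then have "?s i \<le> real (p j) * ?e (K i)"
            using F j(1) avg e by (intro average_sum_Suc) (auto intro: less_imp_le)
          also have "\<dots> \<le> real (p (K i)) * ?e (K i)"
            using \<open>p j \<le> p (K i)\<close> e[of "K i"] by (intro mult_right_mono) auto
          also have "\<dots> = \<epsilon> / 2" using p(3)[of "K i"] by simp
          finally show ?thesis using 3 by simp
        qed
      qed
      then have "(\<Sum>i<L. ?s i) \<le> (\<Sum>i<L. (if i = i0 then 1 else 0) + \<epsilon> / 2)" by (intro sum_mono) auto
      also have "\<dots> \<le> 1 + real L * (\<epsilon> / 2)" by (simp add: sum.distrib)
      finally show ?thesis .
    qed
    then have "(\<Sum>i<L. ?s i) \<le> real L * \<epsilon>" using L(1) by simp
    then show "sum ?b {k\<in>F. l k < Suc M} \<le> \<epsilon>" unfolding sum_b using L(2) by (simp add: field_simps)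
  qed
  moreover have "?A \<subseteq> {k0..}" using ge by (fastforce simp: k2_def)
  ultimately show ?case by blast
qed

text \<open>The vector \<open>\<Sum>\<^sub>M 2\<^sup>M x\<^sub>M\<close> with one average \<open>x\<^sub>M\<close> of each order \<open>M = 1, \<dots>, n\<close>: whatever the
  weights \<open>D\<close> are, it averages them over a full period.\<close>

lemma balanced_coefficients:
  fixes n :: nat
  assumes p: "mono p" "\<And>N. \<exists>k. N \<le> p k" "\<And>k. 1 \<le> p k" and \<epsilon>: "0 < \<epsilon>"
  obtains a K where "\<And>k. 0 \<le> a k" "\<And>k. a k \<noteq> 0 \<Longrightarrow> k \<in> {k0..<K}" "\<And>k. a k \<le> real n * 2 ^ n * \<epsilon>"
    "\<exists>F l. adm p F l \<and> (\<forall>r e. (\<Sum>k\<in>F. (1/2) ^ l k * e (r - int (l k)) * a k) = 1/2 * (\<Sum>M\<in>{1..n}. e (r - int M - 1)))"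
    "\<And>F l D r. adm p F (\<lambda>k. Suc (l k)) \<Longrightarrow> (\<And>r. 0 \<le> D r \<and> D r \<le> 2) \<Longrightarrow> (\<And>r t. D (r - int t) \<le> 2 ^ t * D r) \<Longrightarrow>
       (\<Sum>k\<in>F. (1/2) ^ l k * D (r - int (l k)) * a k) \<le> 2 * (\<Sum>M\<in>{1..n}. D (r - int M + 1)) + real n * 2 ^ (n + 1) * \<epsilon>"
proof -
  \<comment> \<open>Far enough out for the \<open>n\<close> averages to be children of one
    node.\<close>
  obtain k1 where "n \<le> p k1" using p(2) by blast
  define k2 where "k2 = max k0 k1"
  have k2: "n \<le> p k" if "k2 \<le> k" for k 
    using \<open>n \<le> p k1\<close> monoD[OF p(1), of k1 k] that by (simp add: k2_def)
  have "\<forall>M m. \<exists>A b N. average p M \<epsilon> A b \<and> A \<subseteq> {m..<N} \<and> m < N"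
  proof (intro allI)
    fix M m
    obtain A b where Ab: "average p M \<epsilon> A b" "A \<subseteq> {m..}" using average_exists[OF p \<epsilon>] by blast
    then have "finite A" by (simp add: average_def)
    then obtain N where "A \<subseteq> {..<N}" using finite_nat_iff_bounded by blast
    then show "\<exists>A b N. average p M \<epsilon> A b \<and> A \<subseteq> {m..<N} \<and> m < N" 
      using Ab by (intro exI[of _ A] exI[of _ b] exI[of _ "max N (Suc m)"]) fastforce
  qed
  then obtain A' b' N where *: "\<And>M m. average p M \<epsilon> (A' M m) (b' M m) \<and> A' M m \<subseteq> {m..<N M m} \<and> m < N M m" by metis
  obtain K where K: "K 0 = k2" "strict_mono K" "\<And>i. K (Suc i) = N i (K i)"
    using funpow_intervals[of N k2] * by auto
  define A where "A i = A' i (K i)" for i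
  define b where "b i = b' i (K i)" for i
  have avg: "average p i \<epsilon> (A i) (b i)" and sub: "A i \<subseteq> {K i..<K (Suc i)}" for i
    using *[of i "K i"] by (auto simp: A_def b_def K(3))
  have b0: "0 \<le> b i k" for i k using avg[of i] by (simp add: average_def)
  have bA: "b i k = 0" if "k \<notin> A i" for i k using avg[of i] that by (simp add: average_def)
  have finA: "finite (A i)" for i using avg[of i] by (simp add: average_def)
  have sumA: "sum (b i) (A i) = 1" for i using avg[of i] by (simp add: average_def)
  have ge: "k2 \<le> k" if "k \<in> A i" for i k
    using sub[of i] that K(1) monoD[OF strict_mono_mono[OF K(2)], of 0 i] by fastforce
  have sepA: "sep (A i) (A j)" if "i \<noteq> j" for i j
    by (rule sep_intervals[OF K(2) that sub sub])
  define a where "a k = (\<Sum>M\<in>{1..n}. 2 ^ M * b M k)" for k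
  have pow: "(2::real) ^ M \<le> 2 ^ n" if "M \<in> {1..n}" for M using that by (intro power_increasing) auto
  show thesis
  proof (rule that[of a "K (Suc n)"])
    show "0 \<le> a k" for k unfolding a_def using b0 by (simp add: sum_nonneg)
    show "k \<in> {k0..<K (Suc n)}" if "a k \<noteq> 0" for k
    proof -
      obtain M where M: "M \<in> {1..n}" "b M k \<noteq> 0" using \<open>a k \<noteq> 0\<close> unfolding a_def by (metis (no_types, lifting) mult_zero_right sum.neutral)
      then have "k \<in> A M" using bA by blast
      moreover have "K (Suc M) \<le> K (Suc n)" using M by (simp add: strict_mono_less_eq[OF K(2)])
      ultimately show ?thesis using ge[of k M] sub[of M] by (auto simp: k2_def)
    qed
    show "a k \<le> real n * 2 ^ n * \<epsilon>" for k
    proof -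
      have "a k \<le> (\<Sum>M\<in>{1..n}. 2 ^ n * \<epsilon>)" unfolding a_def
        using average_le[OF avg _ p(3)] b0 pow by (intro sum_mono mult_mono) auto
      then show ?thesis by simp
    qed
    show "\<exists>F l. adm p F l \<and> (\<forall>r e. (\<Sum>k\<in>F. (1/2) ^ l k * e (r - int (l k)) * a k) = 1/2 * (\<Sum>M\<in>{1..n}. e (r - int M - 1)))"
    proof -
      \<comment> \<open>The average of order \<open>M\<close> is placed at level
        \<open>M + 1\<close>. Its scale \<open>2 ^ M\<close> leaves the factor \<open>1/2\<close>,
        and the residue becomes \<open>r - int M - 1\<close>.\<close>
      define l where "l k = Suc (THE M. k \<in> A M)" for k
      have l: "l k = Suc M" if "k \<in> A M" for k M
        unfolding l_def using that sep_disjoint[OF sepA] by (auto intro!: the_equality)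
      have aA: "a k = 2 ^ M * b M k" if "k \<in> A M" "M \<in> {1..n}" for k M
      proof -
        have "b M' k = 0" if "M' \<noteq> M" for M' using bA[of k M'] sep_disjoint[OF sepA[OF that]] \<open>k \<in> A M\<close> by blast
        then have "a k = (\<Sum>M'\<in>{1..n}. if M' = M then 2 ^ M * b M k else 0)"
          unfolding a_def by (intro sum.cong) auto
        then show ?thesis using that by simp
      qed
      have "adm p (\<Union>M\<in>{1..n}. A M) l"
      proof (rule adm_nodeI[where l = "\<lambda>M _. M"])
        show "adm p (A i) (\<lambda>_. i)" for i using avg[of i] by (simp add: average_def)
        show "card {1..n} \<le> p k" if "k \<in> A i" for i k using k2 ge[OF that] by simp
      qed (use sepA l in auto)
      moreover have "(\<Sum>k\<in>(\<Union>M\<in>{1..n}. A M). (1/2) ^ l k * e (r - int (l k)) * a k) = 1/2 * (\<Sum>M\<in>{1..n}. e (r - int M - 1))"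
        for r and e :: "int \<Rightarrow> real"
      proof -
        have "(\<Sum>k\<in>(\<Union>M\<in>{1..n}. A M). (1/2) ^ l k * e (r - int (l k)) * a k) = 
           (\<Sum>M\<in>{1..n}. \<Sum>k\<in>A M. (1/2) ^ l k * e (r - int (l k)) * a k)"
          using finA sep_disjoint[OF sepA] by (intro sum.UNION_disjoint) auto
        also have "\<dots> = (\<Sum>M\<in>{1..n}. \<Sum>k\<in>A M. 1/2 * e (r - int M - 1) * b M k)"
        proof (intro sum.cong refl)
          fix M k assume M: "M \<in> {1..n}" "k \<in> A M"
          have "(1/2::real) ^ M * 2 ^ M = 1" by (simp flip: power_mult_distrib)
          moreover have "(1/2) ^ l k * e (r - int (l k)) * a k = ((1/2) ^ M * 2 ^ M) * (1/2 * e (r - int M - 1) * b M k)"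
            by (simp add: l[OF M(2)] aA[OF M(2,1)] algebra_simps)
          ultimately show "(1/2) ^ l k * e (r - int (l k)) * a k = 1/2 * e (r - int M - 1) * b M k" by simp
        qed
        also have "\<dots> = (\<Sum>M\<in>{1..n}. 1/2 * e (r - int M - 1))"
          by (simp only: sum_distrib_left[symmetric] sumA mult_1_right)
        finally show ?thesis by (simp add: sum_distrib_left)
      qed
      ultimately show ?thesis by blast
    qed
    fix F l r and D :: "int \<Rightarrow> real"
    assume F: "adm p F (\<lambda>k. Suc (l k))" and D: "\<And>r. 0 \<le> D r \<and> D r \<le> 2" "\<And>r t. D (r - int t) \<le> 2 ^ t * D r"
    have finF: "finite F" using adm_finite[OF F] .
    define w where "w k = (1/2) ^ l k * D (r - int (l k))" for k
    have w: "0 \<le> w k" "w k \<le> 2" for k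
    proof -
      have "(1/2::real) ^ l k \<le> 1" by (simp add: power_le_one)
      then have "w k \<le> 1 * 2" unfolding w_def using D(1) by (intro mult_mono) auto
      then show "w k \<le> 2" by simp
    qed (use D(1) in \<open>simp add: w_def\<close>)
    \<comment> \<open>Leaves with \<open>Suc (l k) < M\<close> carry mass at most
      \<open>\<epsilon>\<close>. For the others \<open>l k + 1 = M + t\<close>, and the growth
      \<open>2 ^ t\<close> of \<open>D\<close> is cancelled by the weight up to the factor
      \<open>2\<close>.\<close>
    have M: "2 ^ M * (\<Sum>k\<in>F. w k * b M k) \<le> 2 * D (r - int M + 1) + 2 ^ (n + 1) * \<epsilon>" if "M \<in> {1..n}" for M
    proof -
      let ?F1 = "{k\<in>F. Suc (l k) < M}" and ?F2 = "{k\<in>F. \<not> Suc (l k) < M}"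
      have "2 ^ M * (\<Sum>k\<in>F. w k * b M k) = 2 ^ M * (\<Sum>k\<in>?F1. w k * b M k) + (\<Sum>k\<in>?F2. 2 ^ M * w k * b M k)"
      proof -
        have "F = ?F1 \<union> ?F2" by blast
        then have "(\<Sum>k\<in>F. w k * b M k) = (\<Sum>k\<in>?F1 \<union> ?F2. w k * b M k)" by simp
        also have "\<dots> = (\<Sum>k\<in>?F1. w k * b M k) + (\<Sum>k\<in>?F2. w k * b M k)"
          using finF by (intro sum.union_disjoint) auto
        finally show ?thesis by (simp add: distrib_left sum_distrib_left mult_ac)
      qed
      also have "(\<Sum>k\<in>?F1. w k * b M k) \<le> (\<Sum>k\<in>?F1. 2 * b M k)"
        using w b0 by (intro sum_mono mult_right_mono) auto
      also have "\<dots> = 2 * sum (b M) ?F1" by (simp add: sum_distrib_left)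
      also have "sum (b M) ?F1 \<le> \<epsilon>" using avg[of M] F unfolding average_def by blast
      also have "(2::real) ^ M * (2 * \<epsilon>) \<le> 2 ^ (n + 1) * \<epsilon>" using pow[OF that] \<epsilon> by simp
      also have "(\<Sum>k\<in>?F2. 2 ^ M * w k * b M k) \<le> (\<Sum>k\<in>?F2. 2 * D (r - int M + 1) * b M k)"
      proof (intro sum_mono mult_right_mono b0)
        fix k assume "k \<in> ?F2"
        then have le: "M \<le> Suc (l k)" by simp
        define t where "t = Suc (l k) - M"
        have lk: "l k + 1 = M + t" using le by (simp add: t_def)
        then have "r - int (l k) = r - int M + 1 - int t" by linarith
        then have "D (r - int (l k)) \<le> 2 ^ t * D (r - int M + 1)" by (simp only: D(2))
        then have "2 ^ M * w k \<le> 2 ^ M * ((1/2) ^ l k * (2 ^ t * D (r - int M + 1)))"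
          unfolding w_def by (intro mult_left_mono) auto
        also have "\<dots> = (2 ^ (M + t) * (1/2) ^ l k) * D (r - int M + 1)" by (simp add: power_add)
        also have "(2::real) ^ (M + t) * (1/2) ^ l k = 2"
          unfolding lk[symmetric] by (simp add: power_one_over)
        finally show "2 ^ M * w k \<le> 2 * D (r - int M + 1)" .
      qed
      also have "\<dots> = 2 * D (r - int M + 1) * sum (b M) ?F2" by (simp add: sum_distrib_left)
      also have "\<dots> \<le> 2 * D (r - int M + 1) * 1"
        using D(1) finF by (intro mult_left_mono average_sum_le_1[OF avg]) auto
      finally show ?thesis by simp
    qed
    have "(\<Sum>k\<in>F. (1/2) ^ l k * D (r - int (l k)) * a k) = (\<Sum>k\<in>F. \<Sum>M\<in>{1..n}. 2 ^ M * (w k * b M k))"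
      by (simp add: w_def a_def sum_distrib_left mult_ac)
    also have "\<dots> = (\<Sum>M\<in>{1..n}. 2 ^ M * (\<Sum>k\<in>F. w k * b M k))"
      by (subst sum.swap) (simp add: sum_distrib_left)
    also have "\<dots> \<le> (\<Sum>M\<in>{1..n}. 2 * D (r - int M + 1) + 2 ^ (n + 1) * \<epsilon>)"
      by (intro sum_mono M)
    also have "\<dots> = 2 * (\<Sum>M\<in>{1..n}. D (r - int M + 1)) + real n * 2 ^ (n + 1) * \<epsilon>"
      by (simp add: sum.distrib sum_distrib_left)
    finally show "(\<Sum>k\<in>F. (1/2) ^ l k * D (r - int (l k)) * a k) \<le> 
       2 * (\<Sum>M\<in>{1..n}. D (r - int M + 1)) + real n * 2 ^ (n + 1) * \<epsilon>" .
  qed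
qed

section \<open>Blocks with balanced norms\<close>

context sparse_blocks begin

lemma p_unbounded: "\<exists>k. N \<le> p k"
  using gap[of N "Suc (\<kappa> N)"] by (intro exI[of _ "Suc (\<kappa> N)"]) simp

text \<open>Lower bounds on the blocks convert the bound \<open>T\<close> into a bound on all
  \<open>wt F l a\<close>; upper bounds on the blocks convert this back for the other family of
  norms. The same statement serves both directions of the final comparison.\<close>

lemma uppb_transfer:
  assumes d: "\<And>k r. lowb m r (u k) d" "0 < d" and D: "\<And>k r. uppb n r (u k) D"
    and T: "uppb m q (comb a) T"
  shows "uppb n r (comb a) (4 * D / d * T)"
  unfolding uppb_def
proof (intro allI impI)
  have le: "wt F l a \<le> T / d" if F: "adm p F l" for F l
  proof -
    have "lowb m q (comb a) (\<Sum>k\<in>F. (1/2) ^ l k * d * \<bar>a k\<bar>)"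
      by (rule lower_estimate[OF F d(1)])
    then have "(\<Sum>k\<in>F. (1/2) ^ l k * d * \<bar>a k\<bar>) \<le> T" using T unfolding lowb_def uppb_def by fastforce
    moreover have "(\<Sum>k\<in>F. (1/2) ^ l k * d * \<bar>a k\<bar>) = d * wt F l a"
      by (simp add: wt_def sum_distrib_left mult_ac)
    ultimately show ?thesis using d(2) by (simp add: field_simps)
  qed
  have ak: "\<bar>a k\<bar> \<le> T / d" for k
    using le[of "{k}" "\<lambda>_. 0"] p_pos by (simp add: wt_def adm.single)
  have D0: "0 \<le> D" using D uppb_nonneg by blast
  fix G g assume G: "tree_adm G g" "lev n r G g"
  obtain F l where F: "adm p F (\<lambda>k. Suc (l k))" 
    "wt G g (comb a) \<le> 2 * (T / d) * D + (\<Sum>k\<in>F. (1/2) ^ l k * D * \<bar>a k\<bar>)"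
    using upper_estimate[where D = "\<lambda>_. D" and a = a, OF G D ak] by blast
  \<comment> \<open>The factor \<open>2\<close> pays for the level \<open>Suc (l k)\<close> instead
    of \<open>l k\<close>; the end blocks contribute an equal share, whence
    \<open>4\<close>.\<close>
  have "(\<Sum>k\<in>F. (1/2) ^ l k * D * \<bar>a k\<bar>) = 2 * D * wt F (\<lambda>k. Suc (l k)) a"
    by (simp add: wt_def sum_distrib_left mult_ac)
  also have "\<dots> \<le> 2 * D * (T / d)" using le[OF F(1)] D0 by (intro mult_left_mono) auto
  finally have "wt G g (comb a) \<le> 2 * (T / d) * D + 2 * D * (T / d)" using F(2) by linarith
  then show "wt G g (comb a) \<le> 4 * D / d * T" by (simp add: field_simps)
qed

end

text \<open>Coordinates in the gap before a block are counted to that block, which makes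
  \<open>\<kappa>\<close> total and monotone.\<close>

lemma sparse_blocks_coord:
  assumes w: "\<And>k i. coord (w k) i \<noteq> 0 \<Longrightarrow> lo k < i \<and> i \<le> hi k"
    and lh: "\<And>k. lo k < hi k" "\<And>k. 3 * hi k \<le> lo (Suc k)"
  shows "\<exists>\<kappa>. sparse_blocks (\<lambda>k. coord (w k)) (\<lambda>k. Suc (lo k)) \<kappa> \<and>
     (\<forall>A b. finite A \<longrightarrow> coord (\<Sum>k\<in>A. b k *\<^sub>R w k) = 
        sparse_blocks.comb (\<lambda>k. coord (w k)) \<kappa> (\<lambda>k. if k \<in> A then b k else 0))"
proof -
  have hilo: "hi k \<le> lo (Suc k)" for k using lh(2)[of k] by simp
  have "lo k < lo (Suc k)" for k using lh(1)[of k] hilo[of k] by simp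
  then have slo: "strict_mono lo" by (simp add: strict_mono_Suc_iff)
  have "hi k < hi (Suc k)" for k using lh(1)[of "Suc k"] hilo[of k] by simp
  then have shi: "strict_mono hi" by (simp add: strict_mono_Suc_iff)
  have hl: "hi j \<le> lo k" if "j < k" for j k
  proof -
    have "lo (Suc j) \<le> lo k" using that by (simp add: strict_mono_less_eq[OF slo])
    then show ?thesis using hilo[of j] by simp
  qed
  define \<kappa> where "\<kappa> i = (LEAST k. i \<le> hi k)" for i
  have ex: "\<exists>k. i \<le> hi k" for i using strict_mono_imp_increasing[OF shi, of i] by blast
  have \<kappa>1: "i \<le> hi (\<kappa> i)" for i unfolding \<kappa>_def using ex by (rule LeastI_ex)
  have \<kappa>2: "\<kappa> i \<le> k" if "i \<le> hi k" for i k unfolding \<kappa>_def using that by (rule Least_le)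
  have \<kappa>w: "\<kappa> i = k" if "coord (w k) i \<noteq> 0" for k i
  proof -
    have "lo k < i" "\<kappa> i \<le> k" using w[OF that] \<kappa>2 by auto
    moreover have "\<not> \<kappa> i < k" using hl[of "\<kappa> i" k] \<kappa>1[of i] \<open>lo k < i\<close> by auto
    ultimately show ?thesis by simp
  qed
  interpret sparse_blocks "\<lambda>k. coord (w k)" "\<lambda>k. Suc (lo k)" \<kappa>
  proof
    show "mono \<kappa>" using \<kappa>1 \<kappa>2 by (meson monoI order_trans)
    show "mono (\<lambda>k. Suc (lo k))" using strict_mono_less_eq[OF slo] by (simp add: mono_def)
    show "\<kappa> i = k \<and> Suc (lo k) \<le> i" if "coord (w k) i \<noteq> 0" for k i
      using \<kappa>w[OF that] w[OF that] by simp
    show "3 * i \<le> Suc (lo k)" if "\<kappa> i < k" for i k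
    proof -
      have "lo (Suc (\<kappa> i)) \<le> lo k" using that by (simp add: strict_mono_less_eq[OF slo])
      then show ?thesis using lh(2)[of "\<kappa> i"] \<kappa>1[of i] by simp
    qed
  qed simp
  have "coord (\<Sum>k\<in>A. b k *\<^sub>R w k) i = comb (\<lambda>k. if k \<in> A then b k else 0) i" if "finite A" for A b i
  proof -
    have "coord (\<Sum>k\<in>A. b k *\<^sub>R w k) i = (\<Sum>k\<in>A. if k = \<kappa> i then b k * coord (w k) i else 0)"
      unfolding coord_sum[OF that] coord_scaleR using \<kappa>w by (intro sum.cong) auto
    then show ?thesis using that by (simp add: comb_def)
  qed
  then show ?thesis using sparse_blocks_axioms by blast
qed

section \<open>Norms for arbitrary integer residues\<close>

text \<open>The norm \<open>|x|_r^n\<close> for every integer \<open>r\<close>, periodic in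
  \<open>r\<close> modulo \<open>n\<close>.\<close>

definition rnorm :: "nat \<Rightarrow> int \<Rightarrow> tsirelson \<Rightarrow> real" where
  "rnorm n r x = (SUP (G, g)\<in>{(G, g). tree_adm G g \<and> lev n r G g}. wt G g (coord x))"

lemma rnorm_bdd: "bdd_above ((\<lambda>(G, g). wt G g (coord x)) ` {(G, g). tree_adm G g \<and> lev n r G g})"
  by (rule bdd_aboveI2[of _ _ "norm x"]) (auto intro: wt_le_norm)

lemma rnorm_ne: "{(G, g). tree_adm G g \<and> lev n r G g} \<noteq> {}"
proof -
  have "({}, id) \<in> {(G, g). tree_adm G g \<and> lev n r G g}" by (simp add: lev_def)
  then show ?thesis by blast
qed

lemma uppb_rnorm: "uppb n r (coord x) (rnorm n r x)"
  unfolding uppb_def rnorm_def using rnorm_bdd by (auto intro!: cSUP_upper2)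

lemma rnorm_least: "uppb n r (coord x) B \<Longrightarrow> rnorm n r x \<le> B"
  unfolding uppb_def rnorm_def by (rule cSUP_least[OF rnorm_ne]) auto

lemma lowb_rnorm: "c < rnorm n r x \<Longrightarrow> lowb n r (coord x) c"
  unfolding lowb_def rnorm_def less_cSUP_iff[OF rnorm_ne rnorm_bdd] by (auto intro: less_imp_le)

lemma rnorm_le_norm: "rnorm n r x \<le> norm x"
  by (rule rnorm_least) (simp add: uppb_def wt_le_norm)

lemma rnorm_nonneg: "0 \<le> rnorm n r x"
  using uppb_rnorm uppb_nonneg by blast

text \<open>Putting \<open>t\<close> levels on top of a tree with residue \<open>r - int t\<close>
  gives residue \<open>r\<close> and multiplies its value by \<open>(1/2) ^ t\<close>.\<close>

lemma rnorm_shift: "rnorm n (r - int t) x \<le> 2 ^ t * rnorm n r x"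
proof (rule rnorm_least, unfold uppb_def, intro allI impI)
  fix G g assume G: "tree_adm G g" "lev n (r - int t) G g"
  have "tree_adm G (\<lambda>k. g k + t)" by (rule adm_shift[OF G(1)])
  moreover have "lev n r G (\<lambda>k. g k + t)" using G(2) by (simp add: lev_def algebra_simps)
  ultimately have "wt G (\<lambda>k. g k + t) (coord x) \<le> rnorm n r x" using uppb_rnorm by (auto simp: uppb_def)
  then have "(1/2) ^ t * wt G g (coord x) \<le> rnorm n r x" by (simp only: wt_shift)
  then show "wt G g (coord x) \<le> 2 ^ t * rnorm n r x" by (simp add: power_one_over field_simps)
qed

lemma rnorm_period: "int n dvd r - r' \<Longrightarrow> rnorm n r x = rnorm n r' x"
proof -
  assume *: "int n dvd r - r'"
  have "int n dvd r - int (g k) \<longleftrightarrow> int n dvd r' - int (g k)" for g :: "nat \<Rightarrow> nat" and k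
    using dvd_add_right_iff[OF *, of "r' - int (g k)"] by simp
  then have "lev n r = lev n r'" by (simp add: lev_def fun_eq_iff)
  then show ?thesis by (simp add: rnorm_def)
qed

text \<open>Split the leaves into \<open>n\<close> classes by their levels modulo \<open>n\<close>.
  Each class is moved to residue \<open>r\<close> by a shift of fewer than \<open>n\<close> levels,
  at a cost of at most \<open>2 ^ n\<close>.\<close>

lemma norm_le_rnorm:
  assumes "1 \<le> n" shows "norm x \<le> real n * 2 ^ n * rnorm n r x"
proof (rule norm_least)
  fix F l assume F: "tree_adm F l"
  let ?F = "\<lambda>i. {k\<in>F. l k mod n = i}"
  have fin: "finite F" using adm_finite[OF F] .
  have "F = (\<Union>i\<in>{..<n}. ?F i)" using assms by auto
  then have "wt F l (coord x) = wt (\<Union>i\<in>{..<n}. ?F i) l (coord x)" by simp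
  also have "\<dots> = (\<Sum>i<n. wt (?F i) l (coord x))" using fin by (intro wt_UN) auto
  also have "\<dots> \<le> (\<Sum>i<n. 2 ^ n * rnorm n r x)"
  proof (rule sum_mono)
    fix i assume "i \<in> {..<n}"
    have "lev n (int i) (?F i) l" unfolding lev_def
    proof
      fix k assume "k \<in> ?F i"
      then have "int (l k) mod int n = int i mod int n" using \<open>i \<in> {..<n}\<close> by (auto simp flip: of_nat_mod)
      then show "int n dvd int i - int (l k)" by (simp add: mod_eq_dvd_iff dvd_diff_commute)
    qed
    moreover have "tree_adm (?F i) l" by (rule adm_subset[OF F]) auto
    ultimately have wi: "wt (?F i) l (coord x) \<le> rnorm n (int i) x" using uppb_rnorm by (auto simp: uppb_def)
    define t where "t = nat ((r - int i) mod int n)"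
    have t: "int t = (r - int i) mod int n" "t < n" using assms by (auto simp: t_def nat_less_iff)
    have "int n dvd (r - int i) - int t" unfolding t(1) by (simp add: dvd_minus_mod)
    then have "int n dvd (r - int t) - int i" by (simp add: algebra_simps)
    then have "rnorm n (r - int t) x = rnorm n (int i) x" by (rule rnorm_period)
    with rnorm_shift[of n r t x] have "rnorm n (int i) x \<le> 2 ^ t * rnorm n r x" by simp
    also have "\<dots> \<le> 2 ^ n * rnorm n r x" using t(2) rnorm_nonneg by (intro mult_right_mono power_increasing) auto
    finally show "wt (?F i) l (coord x) \<le> 2 ^ n * rnorm n r x"
      using wi by simp
  qed
  finally show "wt F l (coord x) \<le> real n * 2 ^ n * rnorm n r x" by simp
qed

lemma lev_1 [simp]: "lev 1 r F l" "lev (Suc 0) r F l" by (simp_all add: lev_def)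

text \<open>Moving the window by one exchanges \<open>D (r - int n)\<close> for the equal value
  \<open>D r\<close>; integer induction in both directions reaches every \<open>r\<close>.\<close>

lemma period_sum:
  fixes D :: "int \<Rightarrow> real"
  assumes "\<And>r. D (r - int n) = D r"
  shows "(\<Sum>M\<in>{1..n}. D (r - int M)) = (\<Sum>M\<in>{1..n}. D (- int M))"
proof -
  have step: "(\<Sum>M\<in>{1..n}. D (r + 1 - int M)) = (\<Sum>M\<in>{1..n}. D (r - int M))" for r
  proof (cases n)
    case (Suc m)
    have "(\<Sum>M\<in>{1..n}. D (r + 1 - int M)) = (\<Sum>k<Suc m. D (r - int k))"
      by (simp add: Suc sum.atLeast1_atMost_eq)
    also have "\<dots> = D r + (\<Sum>k<m. D (r - int (Suc k)))" by (subst sum.lessThan_Suc_shift) simp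
    also have "\<dots> = D r + (\<Sum>M\<in>{1..m}. D (r - int M))" 
      by (simp add: sum.atLeast1_atMost_eq)
    also have "\<dots> = (\<Sum>M\<in>{1..m}. D (r - int M)) + D (r - int n)" by (simp only: assms add.commute)
    also have "\<dots> = (\<Sum>M\<in>{1..n}. D (r - int M))" by (simp add: Suc)
    finally show ?thesis .
  qed simp
  show ?thesis
  proof (induction r rule: int_induct[where k = 0])
    case (step2 i)
    then show ?case using step[of "i - 1"] by simp
  qed (use step in auto)
qed

text \<open>\<open>unit_vec j\<close> lives at coordinate \<open>Suc j\<close>, so the intervals are
  open on the left and closed on the right.\<close>

lemma block_basis_unit_vec_coord:
  assumes "block_basis unit_vec y"
  shows "\<exists>P. strict_mono P \<and> (\<forall>i m. coord (y i) m \<noteq> 0 \<longrightarrow> P i < m \<and> m \<le> P (Suc i))"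
proof -
  obtain P a where P: "strict_mono P" "\<And>i. y i = (\<Sum>j\<in>{P i..<P (Suc i)}. a j *\<^sub>R unit_vec j)"
    using assms unfolding block_basis_def by blast
  have "P i < m \<and> m \<le> P (Suc i)" if "coord (y i) m \<noteq> 0" for i m
  proof -
    have "(\<Sum>j\<in>{P i..<P (Suc i)}. a j * (if m = Suc j then 1 else 0)) \<noteq> 0"
      using that by (simp add: P(2) coord_sum coord_scaleR coord_unit_vec)
    then obtain j where "j \<in> {P i..<P (Suc i)}" "a j * (if m = Suc j then 1 else 0) \<noteq> 0"
      by (rule sum.not_neutral_contains_not_neutral)
    then show ?thesis by (auto split: if_splits)
  qed
  then show ?thesis using P(1) by blast
qed

section \<open>Construction of the balanced vectors\<close>

text \<open>By \<open>norm_le_rnorm\<close> all values lie between \<open>1 / Q\<close> and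
  \<open>1\<close>. Pigeonhole makes the integer parts of their multiples by \<open>Q\<close> agree
  over one period; equal integer parts that are at least \<open>1\<close> force a ratio of at most
  \<open>2\<close>.\<close>

lemma rnorm_stable_subsequence:
  fixes x :: "nat \<Rightarrow> tsirelson"
  assumes n: "1 \<le> n" and x: "\<And>k. norm (x k) = 1"
  shows "\<exists>I. infinite I \<and> (\<forall>k\<in>I. \<forall>k'\<in>I. \<forall>r. rnorm n r (x k) \<le> 2 * rnorm n r (x k'))"
proof -
  define Q where "Q = n * 2 ^ n"
  define c where "c k = map (\<lambda>j. nat \<lfloor>real Q * rnorm n (int j) (x k)\<rfloor>) [0..<n]" for k
  have "nat \<lfloor>real Q * rnorm n (int j) (x k)\<rfloor> \<le> Q" for j k
  proof -
    have "real Q * rnorm n (int j) (x k) \<le> real Q * 1" 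
      using rnorm_le_norm[of n "int j" "x k"] x by (intro mult_left_mono) auto
    then show ?thesis by linarith
  qed
  then have "range c \<subseteq> {xs. set xs \<subseteq> {..Q} \<and> length xs = n}" by (auto simp: c_def)
  then have "finite (range c)" by (rule finite_subset) (rule finite_lists_length_eq, simp)
  then obtain k0 where inf: "infinite {k\<in>UNIV. c k = c k0}" using pigeonhole_infinite[OF infinite_UNIV_nat, of c] by blast
  have "rnorm n r (x k) \<le> 2 * rnorm n r (x k')" if "c k = c k0" "c k' = c k0" for k k' r
  proof -
    define j where "j = nat (r mod int n)"
    have j: "int j = r mod int n" "j < n" using n by (auto simp: j_def nat_less_iff)
    have r: "rnorm n r (x i) = rnorm n (int j) (x i)" for i
      by (rule rnorm_period) (simp add: j minus_mod_eq_mult_div)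
    have "c k ! j = c k' ! j" using that by simp
    then have eq: "nat \<lfloor>real Q * rnorm n (int j) (x k)\<rfloor> = nat \<lfloor>real Q * rnorm n (int j) (x k')\<rfloor>"
      using j(2) by (simp add: c_def)
    have "1 \<le> real Q * rnorm n (int j) (x i)" for i
      using norm_le_rnorm[OF n, of "x i" "int j"] x by (simp add: Q_def)
    then have "real Q * rnorm n (int j) (x k) \<le> 2 * (real Q * rnorm n (int j) (x k'))"
      using eq by (smt (verit) floor_le_one int_nat_eq le_floor_iff of_int_1 of_int_floor_le one_le_floor real_of_int_floor_add_one_gt)
    moreover have "0 < real Q" using n by (simp add: Q_def)
    ultimately show ?thesis unfolding r by (simp add: mult.left_commute)
  qed
  then show ?thesis using inf by (intro exI[of _ "{k. c k = c k0}"]) simp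
qed

text \<open>The coefficients are fixed before the weights, so one vector balances the norms of
  period \<open>n\<close> and controls the Tsirelson norm as well. \<open>s\<close> is the sum of
  the profile over a period, hence the same for all \<open>N\<close>.\<close>

lemma balanced_vectors:
  assumes y: "block_basis unit_vec y" and n: "1 \<le> n"
  shows "\<exists>s>0. \<forall>N. \<exists>c K. \<forall>r. 
     lowb 1 r (coord (\<Sum>j\<in>{N..<K}. c j *\<^sub>R y j)) (real n / 4) \<and>
     uppb 1 r (coord (\<Sum>j\<in>{N..<K}. c j *\<^sub>R y j)) (3 * real n) \<and>
     lowb n r (coord (\<Sum>j\<in>{N..<K}. c j *\<^sub>R y j)) (s / 16) \<and>
     uppb n r (coord (\<Sum>j\<in>{N..<K}. c j *\<^sub>R y j)) (3 * s)"
proof -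
  obtain P where P: "strict_mono P" "\<And>i m. coord (y i) m \<noteq> 0 \<Longrightarrow> P i < m \<and> m \<le> P (Suc i)"
    using block_basis_unit_vec_coord[OF y] by blast
  have y0: "y i \<noteq> 0" for i using y unfolding block_basis_def by blast
  define x where "x i = (1 / norm (y i)) *\<^sub>R y i" for i
  have x1: "norm (x i) = 1" for i using y0 by (simp add: x_def)
  obtain I where I: "infinite I" "\<And>k k' r. k \<in> I \<Longrightarrow> k' \<in> I \<Longrightarrow> rnorm n r (x k) \<le> 2 * rnorm n r (x k')"
    using rnorm_stable_subsequence[of n x, OF n x1] by blast
  have "\<forall>m. \<exists>m'. m < m' \<and> m' \<in> I \<and> 3 * P (Suc m) \<le> P m'"
  proof
    fix m
    obtain m' where m': "m' \<in> I" "max m (3 * P (Suc m)) < m'" 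
      using I(1) unfolding infinite_nat_iff_unbounded by blast
    moreover have "m' \<le> P m'" using P(1) by (rule strict_mono_imp_increasing)
    ultimately show "\<exists>m'. m < m' \<and> m' \<in> I \<and> 3 * P (Suc m) \<le> P m'" by (intro exI[of _ m']) auto
  qed
  then obtain nx where nx: "\<And>m. m < nx m" "\<And>m. nx m \<in> I" "\<And>m. 3 * P (Suc m) \<le> P (nx m)" by metis
  obtain \<tau> where \<tau>: "strict_mono \<tau>" "\<And>i. \<tau> (Suc i) = nx (\<tau> i)"
    using funpow_intervals[of "\<lambda>_. nx" 0] nx(1) by auto
  \<comment> \<open>Starting at \<open>\<tau> 1\<close> ensures that every index lies in
    \<open>I\<close>, as \<open>\<tau> 0\<close> need not.\<close>
  define \<sigma> where "\<sigma> k = \<tau> (Suc k)" for k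
  have \<sigma>: "strict_mono \<sigma>" "\<And>k. \<sigma> k \<in> I" "\<And>k. 3 * P (Suc (\<sigma> k)) \<le> P (\<sigma> (Suc k))"
    using \<tau> nx by (auto simp: \<sigma>_def strict_mono_Suc_iff)
  define w where "w k = x (\<sigma> k)" for k
  have "\<exists>\<kappa>. sparse_blocks (\<lambda>k. coord (w k)) (\<lambda>k. Suc (P (\<sigma> k))) \<kappa> \<and>
     (\<forall>A b. finite A \<longrightarrow> coord (\<Sum>k\<in>A. b k *\<^sub>R w k) = 
        sparse_blocks.comb (\<lambda>k. coord (w k)) \<kappa> (\<lambda>k. if k \<in> A then b k else 0))"
  proof (rule sparse_blocks_coord)
    show "P (\<sigma> k) < i \<and> i \<le> P (Suc (\<sigma> k))" if "coord (w k) i \<noteq> 0" for k i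
      using that P(2)[of "\<sigma> k" i] by (auto simp: w_def x_def coord_scaleR)
    show "P (\<sigma> k) < P (Suc (\<sigma> k))" for k using P(1) by (simp add: strict_mono_less)
  qed (rule \<sigma>(3))
  then obtain \<kappa> where sb: "sparse_blocks (\<lambda>k. coord (w k)) (\<lambda>k. Suc (P (\<sigma> k))) \<kappa>"
    and cb: "\<And>A b. finite A \<Longrightarrow> coord (\<Sum>k\<in>A. b k *\<^sub>R w k) = 
        sparse_blocks.comb (\<lambda>k. coord (w k)) \<kappa> (\<lambda>k. if k \<in> A then b k else 0)" by blast
  interpret sparse_blocks "\<lambda>k. coord (w k)" "\<lambda>k. Suc (P (\<sigma> k))" \<kappa> by (rule sb)
  \<comment> \<open>By stability, \<open>D\<close> is an upper bound common to all
    \<open>w k\<close>, with \<open>D r / 4\<close> a lower bound.\<close>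
  define D where "D r = 2 * rnorm n r (w 0)" for r
  have rn: "rnorm n r (w k) \<le> 2 * rnorm n r (w k')" for r k k'
    using I(2) \<sigma>(2) by (simp add: w_def)
  have rn_pos: "0 < rnorm n r (w k)" for r k
    using norm_le_rnorm[OF n, of "w k" r] x1 n rnorm_nonneg[of n r "w k"] by (cases "rnorm n r (w k) = 0") (auto simp: w_def)
  have D: "0 < D r" "D r \<le> 2" "D (r - int t) \<le> 2 ^ t * D r" "D (r - int n) = D r" for r t
    using rn_pos rnorm_le_norm[of n r "w 0"] x1 rnorm_shift[of n r t "w 0"] rnorm_period[of n "r - int n" r "w 0"]
    by (auto simp: D_def w_def)
  define s where "s = (\<Sum>M\<in>{1..n}. D (- int M))"
  have s: "0 < s" unfolding s_def using D(1) n by (intro sum_pos) auto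
  have sum_D: "(\<Sum>M\<in>{1..n}. D (r - int M)) = s" for r
    unfolding s_def by (rule period_sum) (rule D(4))
  \<comment> \<open>Of the total error \<open>6 * (real n * 2 ^ n * \<epsilon>)\<close>, four parts
    come from the end blocks and two from the averages.\<close>
  define \<epsilon> where "\<epsilon> = min s (real n) / (6 * real n * 2 ^ n)"
  have \<epsilon>: "0 < \<epsilon>" "6 * (real n * 2 ^ n * \<epsilon>) \<le> s" "6 * (real n * 2 ^ n * \<epsilon>) \<le> real n" 
    using s n by (auto simp: \<epsilon>_def)
  have uD: "uppb n r (coord (w k)) (D r)" for k r
    using uppb_rnorm[of n r "w k"] rn[of r k 0] unfolding uppb_def D_def by (meson order_trans)
  \<comment> \<open>Below the lower bound \<open>D r / 4\<close> by a further factor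
    \<open>2\<close>, for the strict inequality in \<open>lowb_rnorm\<close>.\<close>
  have lD: "lowb n r (coord (w k)) (D r / 8)" for k r
    by (rule lowb_rnorm) (use rn[of r 0 k] rn_pos[of r 0] in \<open>simp add: D_def\<close>)
  have nw: "norm (w k) = 1" for k by (simp add: w_def x1)
  have u1: "uppb 1 r (coord (w k)) 1" for k r
    using wt_le_norm[of _ _ "w k"] nw by (simp add: uppb_def)
  have l1: "lowb 1 r (coord (w k)) (1/2)" for k r
  proof (rule lowb_rnorm)
    have "norm (w k) \<le> rnorm 1 r (w k)"
      using uppb_rnorm[of 1 r "w k"] by (intro norm_least) (simp add: uppb_def)
    then show "1/2 < rnorm 1 r (w k)" using nw[of k] by simp
  qed
  have "\<exists>c K. \<forall>r. 
     lowb 1 r (coord (\<Sum>j\<in>{N..<K}. c j *\<^sub>R y j)) (real n / 4) \<and>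
     uppb 1 r (coord (\<Sum>j\<in>{N..<K}. c j *\<^sub>R y j)) (3 * real n) \<and>
     lowb n r (coord (\<Sum>j\<in>{N..<K}. c j *\<^sub>R y j)) (s / 16) \<and>
     uppb n r (coord (\<Sum>j\<in>{N..<K}. c j *\<^sub>R y j)) (3 * s)" for N
  proof -
    obtain a K where a: "\<And>k. 0 \<le> a k" "\<And>k. a k \<noteq> 0 \<Longrightarrow> k \<in> {N..<K}" "\<And>k. a k \<le> real n * 2 ^ n * \<epsilon>"
      and a_low: "\<exists>F l. adm (\<lambda>k. Suc (P (\<sigma> k))) F l \<and> (\<forall>r e. (\<Sum>k\<in>F. (1/2) ^ l k * e (r - int (l k)) * a k) = 
         1/2 * (\<Sum>M\<in>{1..n}. e (r - int M - 1)))"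
      and a_up: "\<And>F l D r. adm (\<lambda>k. Suc (P (\<sigma> k))) F (\<lambda>k. Suc (l k)) \<Longrightarrow> (\<And>r. 0 \<le> D r \<and> D r \<le> 2) \<Longrightarrow> 
         (\<And>r t. D (r - int t) \<le> 2 ^ t * D r) \<Longrightarrow> (\<Sum>k\<in>F. (1/2) ^ l k * D (r - int (l k)) * a k) \<le> 
         2 * (\<Sum>M\<in>{1..n}. D (r - int M + 1)) + real n * 2 ^ (n + 1) * \<epsilon>"
    proof (rule balanced_coefficients[OF mono_p p_unbounded p_pos \<epsilon>(1), where n = n and ?k0.0 = N], goal_cases)
      case (1 a K)
      show thesis by (rule that[of a K]) (fact 1)+
    qed
    \<comment> \<open>Stated for a general profile \<open>E\<close>, as it is applied to the
      Tsirelson norm with \<open>E = 1\<close> and to period \<open>n\<close> with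
      \<open>E = D\<close>.\<close>
    have up: "uppb q r (comb a) (3 * S)" 
      if E: "\<And>k r. uppb q r (coord (w k)) (E r)" "\<And>r. 0 \<le> E r \<and> E r \<le> 2" "\<And>r t. E (r - int t) \<le> 2 ^ t * E r"
        "\<And>r. (\<Sum>M\<in>{1..n}. E (r - int M)) = S" "6 * (real n * 2 ^ n * \<epsilon>) \<le> S" for q r E S
      unfolding uppb_def
    proof (intro allI impI)
      fix G g assume G: "tree_adm G g" "lev q r G g"
      have "\<bar>a k\<bar> \<le> real n * 2 ^ n * \<epsilon>" for k using a(1,3)[of k] by simp
      then obtain F l where F: "adm (\<lambda>k. Suc (P (\<sigma> k))) F (\<lambda>k. Suc (l k))" 
        "wt G g (comb a) \<le> 2 * (real n * 2 ^ n * \<epsilon>) * E r + (\<Sum>k\<in>F. (1/2) ^ l k * E (r - int (l k)) * \<bar>a k\<bar>)"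
        using upper_estimate[where D = E and a = a, OF G E(1)] by blast
      have "(\<Sum>k\<in>F. (1/2) ^ l k * E (r - int (l k)) * \<bar>a k\<bar>) \<le> 
         2 * (\<Sum>M\<in>{1..n}. E (r - int M + 1)) + real n * 2 ^ (n + 1) * \<epsilon>"
        using a_up[OF F(1) E(2,3), of r] a(1) by simp
      also have "(\<Sum>M\<in>{1..n}. E (r - int M + 1)) = S" using E(4)[of "r + 1"] by (simp add: algebra_simps)
      finally have "(\<Sum>k\<in>F. (1/2) ^ l k * E (r - int (l k)) * \<bar>a k\<bar>) \<le> 2 * S + 2 * (real n * 2 ^ n * \<epsilon>)"
        by simp
      moreover have "2 * (real n * 2 ^ n * \<epsilon>) * E r \<le> 2 * (real n * 2 ^ n * \<epsilon>) * 2"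
        using E(2) \<epsilon>(1) by (intro mult_left_mono) auto
      ultimately show "wt G g (comb a) \<le> 3 * S" using F(2) E(5) by linarith
    qed
    have lo: "lowb q r (comb a) (1/2 * (\<Sum>M\<in>{1..n}. e (r - int M - 1)))"
      if e: "\<And>k r. lowb q r (coord (w k)) (e r)" for q r e
    proof -
      obtain F l where F: "adm (\<lambda>k. Suc (P (\<sigma> k))) F l" 
        "(\<Sum>k\<in>F. (1/2) ^ l k * e (r - int (l k)) * a k) = 1/2 * (\<Sum>M\<in>{1..n}. e (r - int M - 1))"
        using a_low by blast
      show ?thesis using lower_estimate[where a = a and r = r and e = "\<lambda>k. e (r - int (l k))", OF F(1) e] F(2) a(1) by simp
    qed
    \<comment> \<open>Coefficients relative to the original \<open>y\<close>: undo the normalisation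
      and put zeros off the subsequence.\<close>
    define c where "c j = (if j \<in> \<sigma> ` {N..<K} then a (inv \<sigma> j) / norm (y j) else 0)" for j
    have inj: "inj \<sigma>" using \<sigma>(1) by (rule strict_mono_imp_inj_on)
    have "\<sigma> ` {N..<K} \<subseteq> {N..<\<sigma> K}"
      using strict_mono_imp_increasing[OF \<sigma>(1)] \<sigma>(1) by (fastforce simp: strict_mono_less intro: order_trans)
    then have "(\<Sum>j\<in>{N..<\<sigma> K}. c j *\<^sub>R y j) = (\<Sum>j\<in>\<sigma> ` {N..<K}. c j *\<^sub>R y j)"
      by (intro sum.mono_neutral_right) (auto simp: c_def)
    also have "\<dots> = (\<Sum>k\<in>{N..<K}. c (\<sigma> k) *\<^sub>R y (\<sigma> k))"
      using inj by (subst sum.reindex) (auto intro: inj_on_subset)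
    also have "\<dots> = (\<Sum>k\<in>{N..<K}. a k *\<^sub>R w k)"
      using inj by (intro sum.cong) (auto simp: c_def w_def x_def inv_f_f)
    finally have "coord (\<Sum>j\<in>{N..<\<sigma> K}. c j *\<^sub>R y j) = comb (\<lambda>k. if k \<in> {N..<K} then a k else 0)"
      by (simp add: cb)
    also have "(\<lambda>k. if k \<in> {N..<K} then a k else 0) = a" using a(2) by (intro ext) (metis (full_types))
    finally have coord_v: "coord (\<Sum>j\<in>{N..<\<sigma> K}. c j *\<^sub>R y j) = comb a" .
    have "lowb 1 r (comb a) (real n / 4)" for r using lo[OF l1, of r] by simp
    moreover have "uppb 1 r (comb a) (3 * real n)" for r
      using up[of 1 "\<lambda>_. 1" "real n" r] u1 \<epsilon>(3) by simp
    moreover have "lowb n r (comb a) (s / 16)" for r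
    proof -
      have "(\<Sum>M\<in>{1..n}. D (r - int M - 1) / 8) = (\<Sum>M\<in>{1..n}. D ((r - 1) - int M)) / 8"
        by (simp add: sum_divide_distrib algebra_simps)
      then have "1/2 * (\<Sum>M\<in>{1..n}. D (r - int M - 1) / 8) = s / 16" by (simp only: sum_D)
      then show ?thesis using lo[OF lD, of r] by (simp only:)
    qed
    moreover have "uppb n r (comb a) (3 * s)" for r
      by (rule up[OF uD]) (use D sum_D \<epsilon>(2) in \<open>auto intro: less_imp_le\<close>)
    ultimately show ?thesis unfolding coord_v[symmetric] by blast
  qed
  then show ?thesis using s by blast
qed

section \<open>Continuity, chained blocks and the final comparison\<close>

text \<open>Every functional \<open>wt F l\<close> is subadditive and dominated by the Tsirelson
  norm, so the tree norms are 1-Lipschitz.\<close>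

lemma tree_norm_le_add: 
  assumes "j < n" shows "tree_norm j n x \<le> tree_norm j n y + dist x y"
proof (rule tree_norm_least)
  fix F l assume F: "tree_adm F l" "lev n (int j) F l"
  have "wt F l (coord x) \<le> wt F l (coord y) + wt F l (coord (x - y))"
    unfolding wt_def sum.distrib[symmetric] distrib_left[symmetric]
    by (intro sum_mono mult_left_mono) (auto simp: coord_diff)
  also have "\<dots> \<le> tree_norm j n y + dist x y"
    unfolding dist_norm by (intro add_mono wt_le_tree_norm wt_le_norm F assms)
  finally show "wt F l (coord x) \<le> tree_norm j n y + dist x y" .
qed

lemma continuous_on_tree_norm: "j < n \<Longrightarrow> continuous_on S (tree_norm j n)"
proof (rule lipschitz_on_continuous_on, rule lipschitz_onI)
  fix x y assume "j < n"
  then show "dist (tree_norm j n x) (tree_norm j n y) \<le> 1 * dist x y"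
    using tree_norm_le_add[of j n x y] tree_norm_le_add[of j n y x] by (simp add: dist_real_def dist_commute abs_le_iff)
qed simp

lemma uppb_tree_norm: "j < n \<Longrightarrow> uppb n (int j) (coord x) (tree_norm j n x)"
  by (simp add: uppb_def wt_le_tree_norm)

lemma uppb_norm: "uppb 1 r (coord x) (norm x)"
  by (simp add: uppb_def wt_le_norm)

text \<open>Starting each vector at or after the end of the previous one makes the chosen vectors a
  block basis; \<open>Q\<close> leaves room for further sparseness.\<close>

lemma block_basis_chain:
  assumes Q: "\<And>N. N < Q N" 
    and v: "\<And>N. v N = (\<Sum>j\<in>{N..<K N}. c N j *\<^sub>R y j)" "\<And>N. v N \<noteq> 0" "\<And>N. K N \<le> Q N"
  shows "\<exists>S. (\<forall>k. S (Suc k) = Q (S k)) \<and> block_basis y (\<lambda>k. v (S k))"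
proof -
  obtain S where S: "strict_mono S" "\<And>k. S (Suc k) = Q (S k)"
    using funpow_intervals[of "\<lambda>_. Q" 0] Q by auto
  define \<rho> where "\<rho> j = (LEAST k. j < S (Suc k))" for j
  \<comment> \<open>One coefficient sequence for all blocks; the zeros fill the gap between
    \<open>K (S k)\<close> and \<open>S (Suc k)\<close>.\<close>
  define a where "a j = (if j < K (S (\<rho> j)) then c (S (\<rho> j)) j else 0)" for j
  have \<rho>: "\<rho> j = k" if "j \<in> {S k..<S (Suc k)}" for j k
    unfolding \<rho>_def
  proof (rule Least_equality)
    show "k \<le> k'" if "j < S (Suc k')" for k'
    proof -
      have "S k < S (Suc k')" using that \<open>j \<in> _\<close> by auto
      then show ?thesis by (simp add: strict_mono_less[OF S(1)])
    qed
  qed (use that in auto)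
  have "v (S k) = (\<Sum>j\<in>{S k..<S (Suc k)}. a j *\<^sub>R y j)" for k
  proof -
    have "(\<Sum>j\<in>{S k..<S (Suc k)}. a j *\<^sub>R y j) = (\<Sum>j\<in>{S k..<S (Suc k)}. if j < K (S k) then c (S k) j *\<^sub>R y j else 0)"
      using \<rho> by (intro sum.cong) (auto simp: a_def)
    also have "\<dots> = (\<Sum>j\<in>{S k..<K (S k)}. c (S k) j *\<^sub>R y j)"
      using v(3)[of "S k"] S(2)[of k] by (intro sum.mono_neutral_cong_right) auto
    finally show ?thesis using v(1) by simp
  qed
  then show ?thesis unfolding block_basis_def using S v(2) by blast
qed

theorem theorem3p1:
  shows "\<exists>K>1. \<forall>y. block_basis unit_vec y \<longrightarrow>
           (\<forall>n\<ge>1. \<exists>Z d. block_subspace y Z \<and> d > 0 \<and>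
              (\<forall>j<n. \<forall>z\<in>Z \<inter> sphere 0 1. d \<le> tree_norm j n z \<and> tree_norm j n z \<le> K * d))"
proof (intro exI[of _ "9216::real"] conjI allI impI)
  \<comment> \<open>\<open>9216 = 48 \<cdot> 192\<close>, where \<open>tree_norm j n z \<le> 48 s / n \<parallel>z\<parallel>\<close> and \<open>\<parallel>z\<parallel> \<le> 192 n / s tree_norm j n z\<close>\<close>
  fix y :: "nat \<Rightarrow> tsirelson" and n :: nat assume y: "block_basis unit_vec y" and n: "1 \<le> n"
  obtain P where P: "strict_mono P" "\<And>i m. coord (y i) m \<noteq> 0 \<Longrightarrow> P i < m \<and> m \<le> P (Suc i)"
    using block_basis_unit_vec_coord[OF y] by blast
  obtain s where s: "0 < s" and ex: "\<And>N. \<exists>c K. \<forall>r. 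
     lowb 1 r (coord (\<Sum>j\<in>{N..<K}. c j *\<^sub>R y j)) (real n / 4) \<and>
     uppb 1 r (coord (\<Sum>j\<in>{N..<K}. c j *\<^sub>R y j)) (3 * real n) \<and>
     lowb n r (coord (\<Sum>j\<in>{N..<K}. c j *\<^sub>R y j)) (s / 16) \<and>
     uppb n r (coord (\<Sum>j\<in>{N..<K}. c j *\<^sub>R y j)) (3 * s)"
    using balanced_vectors[OF y n] by blast
  define good where "good x \<longleftrightarrow> (\<forall>r. lowb 1 r (coord x) (real n / 4) \<and> uppb 1 r (coord x) (3 * real n) \<and>
     lowb n r (coord x) (s / 16) \<and> uppb n r (coord x) (3 * s))" for x
  have "\<forall>N. \<exists>c K. good (\<Sum>j\<in>{N..<K}. c j *\<^sub>R y j)" using ex by (simp add: good_def)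
  then obtain c K where cK: "\<And>N. good (\<Sum>j\<in>{N..<K N}. c N j *\<^sub>R y j)" by metis
  define v where "v N = (\<Sum>j\<in>{N..<K N}. c N j *\<^sub>R y j)" for N
  have v0: "v N \<noteq> 0" for N
  proof
    assume "v N = 0"
    then have "lowb 1 0 (\<lambda>_. 0) (real n / 4)" using cK[of N] by (simp add: good_def v_def coord_zero)
    then show False using n by (auto simp: lowb_def wt_def)
  qed
  have NK: "N < K N" for N using v0[of N] by (cases "N < K N") (auto simp: v_def)
  \<comment> \<open>The first entry keeps the blocks successive. The second gives the factor
    \<open>3\<close> in the supports, because \<open>j \<le> P j\<close>.\<close>
  define Q where "Q N = max (K N) (3 * P (K N))" for N
  obtain S where S: "\<And>k. S (Suc k) = Q (S k)" and bb: "block_basis y (\<lambda>k. v (S k))"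
    using block_basis_chain[where Q = Q and v = v and K = K and c = c and y = y] v_def v0 NK
    by (auto simp: Q_def less_max_iff_disj)
  define w where "w k = v (S k)" for k
  have "\<exists>\<kappa>. sparse_blocks (\<lambda>k. coord (w k)) (\<lambda>k. Suc (P (S k))) \<kappa> \<and>
     (\<forall>A b. finite A \<longrightarrow> coord (\<Sum>k\<in>A. b k *\<^sub>R w k) = 
        sparse_blocks.comb (\<lambda>k. coord (w k)) \<kappa> (\<lambda>k. if k \<in> A then b k else 0))"
  proof (rule sparse_blocks_coord)
    show "P (S k) < i \<and> i \<le> P (K (S k))" if "coord (w k) i \<noteq> 0" for k i
    proof -
      have "(\<Sum>j\<in>{S k..<K (S k)}. c (S k) j * coord (y j) i) \<noteq> 0"
        using that by (simp add: w_def v_def coord_sum coord_scaleR)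
      then obtain j where j: "j \<in> {S k..<K (S k)}" "c (S k) j * coord (y j) i \<noteq> 0"
        by (rule sum.not_neutral_contains_not_neutral)
      then have "P j < i" "i \<le> P (Suc j)" using P(2)[of j i] by auto
      moreover have "P (S k) \<le> P j" "P (Suc j) \<le> P (K (S k))" using j(1) by (simp_all add: strict_mono_less_eq[OF P(1)])
      ultimately show ?thesis by simp
    qed
    show "P (S k) < P (K (S k))" for k using NK P(1) by (simp add: strict_mono_less)
    show "3 * P (K (S k)) \<le> P (S (Suc k))" for k
    proof -
      have "3 * P (K (S k)) \<le> S (Suc k)" by (simp add: S Q_def)
      also have "\<dots> \<le> P (S (Suc k))" by (rule strict_mono_imp_increasing[OF P(1)])
      finally show ?thesis .
    qed
  qed
  then obtain \<kappa> where sb: "sparse_blocks (\<lambda>k. coord (w k)) (\<lambda>k. Suc (P (S k))) \<kappa>"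
    and cb: "\<And>A b. finite A \<Longrightarrow> coord (\<Sum>k\<in>A. b k *\<^sub>R w k) = 
        sparse_blocks.comb (\<lambda>k. coord (w k)) \<kappa> (\<lambda>k. if k \<in> A then b k else 0)" by blast
  interpret sparse_blocks "\<lambda>k. coord (w k)" "\<lambda>k. Suc (P (S k))" \<kappa> by (rule sb)
  have bounds: "lowb 1 r (coord (w k)) (real n / 4)" "uppb 1 r (coord (w k)) (3 * real n)"
    "lowb n r (coord (w k)) (s / 16)" "uppb n r (coord (w k)) (3 * s)" for r k
    using cK[of "S k"] by (simp_all add: good_def w_def v_def)
  let ?Z = "closure (span (range w))"
  define d where "d = s / (192 * real n)"
  have d: "0 < d" using s n by (simp add: d_def)
  have span: "d * norm z \<le> tree_norm j n z \<and> tree_norm j n z \<le> 9216 * d * norm z" 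
    if j: "j < n" and z: "z \<in> span (range w)" for j z
  proof -
    \<comment> \<open>Distinct blocks have disjoint supports and are nonzero; this allows a
      combination of vectors to be indexed by block numbers.\<close>
    have "inj w"
    proof (rule injI, rule ccontr)
      fix k k' assume "w k = w k'" "k \<noteq> k'"
      then have "coord (w k) i = 0" for i using supp[of k i] supp[of k' i] by metis
      then show False using v0[of "S k"] coord_inject[of "w k" 0] by (auto simp: w_def coord_zero)
    qed
    obtain A b where "finite A" "z = (\<Sum>x\<in>A. b x *\<^sub>R x)" "A \<subseteq> range w" using z unfolding span_explicit by auto
    then obtain B where "finite B" "A = w ` B" by (meson finite_subset_image)
    then have z_eq: "z = (\<Sum>k\<in>B. b (w k) *\<^sub>R w k)"
      using \<open>z = _\<close> sum.reindex[of w B "\<lambda>x. b x *\<^sub>R x"] inj_on_subset[OF \<open>inj w\<close>, of B] by simp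
    define a where "a k = (if k \<in> B then b (w k) else 0)" for k
    have za: "coord z = comb a" unfolding z_eq a_def using cb[OF \<open>finite B\<close>] by simp
    \<comment> \<open>Transfer from the Tsirelson norm, using the lower bound
      \<open>real n / 4\<close> and the upper bound \<open>3 * s\<close> on the blocks.\<close>
    have "uppb n (int j) (coord z) (4 * (3 * s) / (real n / 4) * norm z)"
      unfolding za by (rule uppb_transfer[where m = 1 and q = 0]) (use bounds n uppb_norm[of 0 z] za in auto)
    then have "tree_norm j n z \<le> 4 * (3 * s) / (real n / 4) * norm z"
      unfolding uppb_def by (intro tree_norm_least) blast
    also have "\<dots> = 9216 * d * norm z" using n by (simp add: d_def)
    finally have 1: "tree_norm j n z \<le> 9216 * d * norm z" .
    \<comment> \<open>Transfer in the other direction, with the lower bound \<open>s / 16\<close>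
      and the upper bound \<open>3 * real n\<close>.\<close>
    have "uppb 1 0 (coord z) (4 * (3 * real n) / (s / 16) * tree_norm j n z)"
      unfolding za by (rule uppb_transfer[where m = n and q = "int j"]) (use bounds s uppb_tree_norm[OF j, of z] za in auto)
    then have "norm z \<le> 4 * (3 * real n) / (s / 16) * tree_norm j n z"
      unfolding uppb_def by (intro norm_least) auto
    then have "d * norm z \<le> d * (4 * (3 * real n) / (s / 16) * tree_norm j n z)"
      using d by (intro mult_left_mono) auto
    also have "\<dots> = tree_norm j n z" using n s by (simp add: d_def)
    finally show ?thesis using 1 by simp
  qed
  \<comment> \<open>Both inequalities are closed conditions, so they extend from the span to its
    closure.\<close>
  have cl: "d * norm z \<le> tree_norm j n z \<and> tree_norm j n z \<le> 9216 * d * norm z" if j: "j < n" and z: "z \<in> ?Z" for j z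
  proof -
    have "closed {z. d * norm z \<le> tree_norm j n z \<and> tree_norm j n z \<le> 9216 * d * norm z}"
      by (intro closed_Collect_conj closed_Collect_le continuous_intros continuous_on_tree_norm j)
    then have "?Z \<subseteq> {z. d * norm z \<le> tree_norm j n z \<and> tree_norm j n z \<le> 9216 * d * norm z}"
      using span[OF j] by (intro closure_minimal) auto
    then show ?thesis using z by blast
  qed
  show "\<exists>Z d. block_subspace y Z \<and> d > 0 \<and>
     (\<forall>j<n. \<forall>z\<in>Z \<inter> sphere 0 1. d \<le> tree_norm j n z \<and> tree_norm j n z \<le> 9216 * d)"
  proof (intro exI[of _ ?Z] exI[of _ d] conjI d)
    show "block_subspace y ?Z" unfolding block_subspace_def using bb by (auto simp: w_def[abs_def])
    show "\<forall>j<n. \<forall>z\<in>?Z \<inter> sphere 0 1. d \<le> tree_norm j n z \<and> tree_norm j n z \<le> 9216 * d"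
      using cl by fastforce
  qed
qed simp

end
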